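(* Let $(V,\Gamma,K)$ be a valued vector space with variable base field $K$ and value set $(\Gamma,<)$ in the language $\mathrm{L}_{W,\lambda}$, and let $(W,\Delta,L)\supseteq(V,\Gamma,K)$ be an extension (of valued vector spaces, in the language $\mathrm{L}_{W,\lambda}$). Then the following are equivalent: - $(W,\Delta,L)\succeq(V,\Gamma,K)$; - $L\succeq K$ as fields and $(\Delta,(E_n)_{n\in\mathbb{N}},<)\succeq(\Gamma,(D_n)_{n\in\mathbb{N}},<)$ as coloured linear orders, where $E_n:=\{\gamma\in\Delta\mid\dim_L(B_\gamma(W))=n\}$ and $D_n:=\{\gamma\in\Gamma\mid\dim_K(B_\gamma(V))=n\}$.
   Context: Valued vector space: $K$ is a field, $V$ a $K$-vector space, $(\Gamma,<,\infty)$ a totally ordered set with last element $\infty$, and $\mathrm{val}:V\to\Gamma$ a surjective map such that $\mathrm{val}(x)=\infty$ iff $x=0$, $\mathrm{val}(x-y)\ge\min(\mathrm{val}(x),\mathrm{val}(y))$, and $\mathrm{val}(kx)=\mathrm{val}(x)$ for all $k\in K\setminus\{0\}$, $x\in V$. For $\gamma\in\Gamma$, $B_\gamma(V)$ is the $K$-vector space $\{x\in V\mid\mathrm{val}(x)\ge\gamma\}/\{x\in V\mid\mathrm{val}(x)>\gamma\}$, with the convention $B_\infty(V)=\{0\}$. $\mathrm{L}_{W,\lambda}:=\{(V,+,0),(K,+,\cdot,0,1),(\Gamma,<,\infty),\mathrm{scal}:K\times V\to V,\mathrm{val}:V\to\Gamma\}\cup\{W_n\subset V^n\}_n\cup\{\lambda_{n,i}:V^{n+1}\to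 K\}_{1\le i\le n}$, where $\mathrm{scal}$ is scalar multiplication. $W_n(v_1,\dots,v_n)$ holds iff the $v_i$ are nonzero, $\mathrm{val}(v_1)=\dots=\mathrm{val}(v_n)$, and for all $k_1,\dots,k_n\in K$, $\mathrm{val}(\sum_ik_iv_i)>\mathrm{val}(v_1)$ implies $k_1=\dots=k_n=0$. If $W_n(v_1,\dots,v_n)$ and $\neg W_{n+1}(v,v_1,\dots,v_n)$, then $(\lambda_{n,i}(v,v_1,\dots,v_n))_{1\le i\le n}$ is the unique tuple in $K$ with $\mathrm{val}(\sum_i\lambda_{n,i}(v,v_1,\dots,v_n)v_i-v)>\mathrm{val}(v)$; all $\lambda_{n,i}$ take the value $0$ when no such tuple exists or the condition fails. *)

theory Defs
  imports "HOL-Algebra.Algebra" "Jordan_Normal_Form.Missing_VectorSpace"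
begin

section \<open>Many-sorted first-order logic\<close>

text \<open>
  A symbol whose type is \<^const>\<open>None\<close> does not belong to the language. This allows a datatype of
  symbols to contain junk such as $\lambda_{n,i}$ with $i > n$.
\<close>

record ('s, 'f, 'p) lang =
  fun_type :: "'f \<Rightarrow> ('s list \<times> 's) option"
  rel_type :: "'p \<Rightarrow> 's list option"

datatype ('s, 'f) trm =
  Var 's nat
| Fn 'f "('s, 'f) trm list"

datatype ('s, 'f, 'p) fm =
  Eq "('s, 'f) trm" "('s, 'f) trm"
| Rel 'p "('s, 'f) trm list"
| Neg "('s, 'f, 'p) fm"
| Conj "('s, 'f, 'p) fm" "('s, 'f, 'p) fm"
| Exists 's nat "('s, 'f, 'p) fm"

inductive has_sort :: "('s, 'f, 'p) lang \<Rightarrow> ('s, 'f) trm \<Rightarrow> 's \<Rightarrow> bool"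
  for S :: "('s, 'f, 'p) lang" where
  has_sort_Var: "has_sort S (Var s x) s"
| has_sort_Fn: "fun_type S f = Some (ss, s) \<Longrightarrow> list_all2 (has_sort S) ts ss \<Longrightarrow> has_sort S (Fn f ts) s"
monos list.rel_mono_strong

primrec wf_fm :: "('s, 'f, 'p) lang \<Rightarrow> ('s, 'f, 'p) fm \<Rightarrow> bool" where
  "wf_fm S (Eq t u) \<longleftrightarrow> (\<exists>s. has_sort S t s \<and> has_sort S u s)"
| "wf_fm S (Rel p ts) \<longleftrightarrow> (\<exists>ss. rel_type S p = Some ss \<and> list_all2 (has_sort S) ts ss)"
| "wf_fm S (Neg \<phi>) \<longleftrightarrow> wf_fm S \<phi>"
| "wf_fm S (Conj \<phi> \<psi>) \<longleftrightarrow> wf_fm S \<phi> \<and> wf_fm S \<psi>"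
| "wf_fm S (Exists s x \<phi>) \<longleftrightarrow> wf_fm S \<phi>"

text \<open>
  All sorts of a structure live in one type \<open>'u\<close>. Interpretations are total functions on lists;
  only their values on lists matching the type of the symbol are meaningful.
\<close>

record ('s, 'f, 'p, 'u) struct =
  univ :: "'s \<Rightarrow> 'u set"
  fun_int :: "'f \<Rightarrow> 'u list \<Rightarrow> 'u"
  rel_int :: "'p \<Rightarrow> 'u list \<Rightarrow> bool"

primrec eval_trm :: "('s, 'f, 'p, 'u) struct \<Rightarrow> ('s \<Rightarrow> nat \<Rightarrow> 'u) \<Rightarrow> ('s, 'f) trm \<Rightarrow> 'u" where
  "eval_trm M e (Var s x) = e s x"
| "eval_trm M e (Fn f ts) = fun_int M f (map (eval_trm M e) ts)"

primrec sat :: "('s, 'f, 'p, 'u) struct \<Rightarrow> ('s \<Rightarrow> nat \<Rightarrow> 'u) \<Rightarrow> ('s, 'f, 'p) fm \<Rightarrow> bool" where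
  "sat M e (Eq t u) \<longleftrightarrow> eval_trm M e t = eval_trm M e u"
| "sat M e (Rel p ts) \<longleftrightarrow> rel_int M p (map (eval_trm M e) ts)"
| "sat M e (Neg \<phi>) \<longleftrightarrow> \<not> sat M e \<phi>"
| "sat M e (Conj \<phi> \<psi>) \<longleftrightarrow> sat M e \<phi> \<and> sat M e \<psi>"
| "sat M e (Exists s x \<phi>) \<longleftrightarrow> (\<exists>a \<in> univ M s. sat M (e(s := (e s)(x := a))) \<phi>)"

definition substructure ::
    "('s, 'f, 'p) lang \<Rightarrow> ('s, 'f, 'p, 'u) struct \<Rightarrow> ('s, 'f, 'p, 'u) struct \<Rightarrow> bool" where
  "substructure S M N \<longleftrightarrow>
     (\<forall>s. univ M s \<subseteq> univ N s) \<and>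
     (\<forall>f ss s xs. fun_type S f = Some (ss, s) \<and> list_all2 (\<lambda>x s. x \<in> univ M s) xs ss \<longrightarrow>
        fun_int M f xs = fun_int N f xs) \<and>
     (\<forall>p ss xs. rel_type S p = Some ss \<and> list_all2 (\<lambda>x s. x \<in> univ M s) xs ss \<longrightarrow>
        (rel_int M p xs \<longleftrightarrow> rel_int N p xs))"

definition elementary_substructure ::
    "('s, 'f, 'p) lang \<Rightarrow> ('s, 'f, 'p, 'u) struct \<Rightarrow> ('s, 'f, 'p, 'u) struct \<Rightarrow> bool" where
  "elementary_substructure S M N \<longleftrightarrow>
     substructure S M N \<and>
     (\<forall>\<phi> e. wf_fm S \<phi> \<and> (\<forall>s x. e s x \<in> univ M s) \<longrightarrow> (sat M e \<phi> \<longleftrightarrow> sat N e \<phi>))"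


section \<open>Valued vector spaces\<close>

record ('k, 'v, 'g) valued_space =
  scalars :: "'k ring"
  vectors :: "('k, 'v) module"
  value_set :: "'g gorder"
  infty :: 'g
  val :: "'v \<Rightarrow> 'g"

locale valued_vector_space =
  fixes V :: "('k, 'v, 'g) valued_space"
  assumes vectorspace: "vectorspace (scalars V) (vectors V)"
    and total_order: "total_order (value_set V)"
    and infty_closed: "infty V \<in> carrier (value_set V)"
    and infty_last: "\<gamma> \<in> carrier (value_set V) \<Longrightarrow> \<gamma> \<sqsubseteq>\<^bsub>value_set V\<^esub> infty V"
    and val_surj: "val V ` carrier (vectors V) = carrier (value_set V)"
    and val_eq_infty_iff:
      "x \<in> carrier (vectors V) \<Longrightarrow> val V x = infty V \<longleftrightarrow> x = \<zero>\<^bsub>vectors V\<^esub>"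
    and val_diff:
      "x \<in> carrier (vectors V) \<Longrightarrow> y \<in> carrier (vectors V) \<Longrightarrow>
        (if val V x \<sqsubseteq>\<^bsub>value_set V\<^esub> val V y then val V x else val V y)
          \<sqsubseteq>\<^bsub>value_set V\<^esub> val V (x \<ominus>\<^bsub>vectors V\<^esub> y)"
    and val_smult:
      "k \<in> carrier (scalars V) \<Longrightarrow> k \<noteq> \<zero>\<^bsub>scalars V\<^esub> \<Longrightarrow> x \<in> carrier (vectors V) \<Longrightarrow>
        val V (k \<odot>\<^bsub>vectors V\<^esub> x) = val V x"

text \<open>The multiplicative part of the underlying \<^typ>\<open>'b set ring\<close> plays no role in a module.\<close>

definition quot_module :: "('a, 'b, 'm) module_scheme \<Rightarrow> 'b set \<Rightarrow> ('a, 'b set) module" where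
  "quot_module M N =
     \<lparr>carrier = a_rcosets\<^bsub>M\<^esub> N, monoid.mult = undefined, one = undefined, ring.zero = N, add = set_add M,
      smult = (\<lambda>k A. \<Union>x\<in>A. N +>\<^bsub>M\<^esub> (k \<odot>\<^bsub>M\<^esub> x))\<rparr>"

definition closed_ball :: "('k, 'v, 'g) valued_space \<Rightarrow> 'g \<Rightarrow> 'v set" where
  "closed_ball V \<gamma> = {x \<in> carrier (vectors V). \<gamma> \<sqsubseteq>\<^bsub>value_set V\<^esub> val V x}"

text \<open>
  No vector has value greater than \<open>\<infinity>\<close>. Taking the zero space instead of the empty set makes
  the quotient at \<open>\<infinity>\<close> the zero space, which is the usual convention.
\<close>

definition open_ball :: "('k, 'v, 'g) valued_space \<Rightarrow> 'g \<Rightarrow> 'v set" where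
  "open_ball V \<gamma> =
     (if \<gamma> = infty V then {\<zero>\<^bsub>vectors V\<^esub>}
      else {x \<in> carrier (vectors V). \<gamma> \<sqsubset>\<^bsub>value_set V\<^esub> val V x})"

definition ball_quot :: "('k, 'v, 'g) valued_space \<Rightarrow> 'g \<Rightarrow> ('k, 'v set) module" where
  "ball_quot V \<gamma> = quot_module ((vectors V)\<lparr>carrier := closed_ball V \<gamma>\<rparr>) (open_ball V \<gamma>)"

text \<open>The library's \<open>dim\<close> has a junk value on infinite-dimensional spaces.\<close>

definition dim_colour :: "('k, 'v, 'g) valued_space \<Rightarrow> nat \<Rightarrow> 'g set" where
  "dim_colour V n =
     {\<gamma> \<in> carrier (value_set V).
        vectorspace.fin_dim (scalars V) (ball_quot V \<gamma>) \<and>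
        vectorspace.dim (scalars V) (ball_quot V \<gamma>) = n}"


section \<open>The language of valued vector spaces\<close>

definition lin_comb :: "('k, 'v, 'g) valued_space \<Rightarrow> 'k list \<Rightarrow> 'v list \<Rightarrow> 'v" where
  "lin_comb V ks vs = (\<Oplus>\<^bsub>vectors V\<^esub>i\<in>{..<length vs}. (ks ! i) \<odot>\<^bsub>vectors V\<^esub> (vs ! i))"

text \<open>For a nonempty list \<open>vs\<close> of length \<open>n\<close>, this is $W_n$.\<close>

definition W_holds :: "('k, 'v, 'g) valued_space \<Rightarrow> 'v list \<Rightarrow> bool" where
  "W_holds V vs \<longleftrightarrow>
     (\<forall>v \<in> set vs. v \<noteq> \<zero>\<^bsub>vectors V\<^esub> \<and> val V v = val V (hd vs)) \<and>
     (\<forall>ks. length ks = length vs \<and> set ks \<subseteq> carrier (scalars V) \<and>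
           val V (hd vs) \<sqsubset>\<^bsub>value_set V\<^esub> val V (lin_comb V ks vs) \<longrightarrow>
        (\<forall>k \<in> set ks. k = \<zero>\<^bsub>scalars V\<^esub>))"

definition is_lam :: "('k, 'v, 'g) valued_space \<Rightarrow> 'v \<Rightarrow> 'v list \<Rightarrow> 'k list \<Rightarrow> bool" where
  "is_lam V v vs ks \<longleftrightarrow>
     length ks = length vs \<and> set ks \<subseteq> carrier (scalars V) \<and>
     val V v \<sqsubset>\<^bsub>value_set V\<^esub> val V (lin_comb V ks vs \<ominus>\<^bsub>vectors V\<^esub> v)"

text \<open>The index \<open>i\<close> starts at 1.\<close>

definition lam :: "('k, 'v, 'g) valued_space \<Rightarrow> nat \<Rightarrow> 'v \<Rightarrow> 'v list \<Rightarrow> 'k" where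
  "lam V i v vs =
     (if W_holds V vs \<and> \<not> W_holds V (v # vs) \<and> (\<exists>!ks. is_lam V v vs ks)
      then (THE ks. is_lam V v vs ks) ! (i - 1) else \<zero>\<^bsub>scalars V\<^esub>)"

datatype vsort = VecS | FldS | ValS

datatype vfun =
  VAdd | VZero | KAdd | KMul | KZero | KOne | Infty | Scal | Val | Lam nat nat

datatype vrel = Less | WRel nat

primrec vfun_type :: "vfun \<Rightarrow> (vsort list \<times> vsort) option" where
  "vfun_type VAdd = Some ([VecS, VecS], VecS)"
| "vfun_type VZero = Some ([], VecS)"
| "vfun_type KAdd = Some ([FldS, FldS], FldS)"
| "vfun_type KMul = Some ([FldS, FldS], FldS)"
| "vfun_type KZero = Some ([], FldS)"
| "vfun_type KOne = Some ([], FldS)"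
| "vfun_type Infty = Some ([], ValS)"
| "vfun_type Scal = Some ([FldS, VecS], VecS)"
| "vfun_type Val = Some ([VecS], ValS)"
| "vfun_type (Lam n i) =
     (if 1 \<le> i \<and> i \<le> n then Some (replicate (Suc n) VecS, FldS) else None)"

primrec vrel_type :: "vrel \<Rightarrow> vsort list option" where
  "vrel_type Less = Some [ValS, ValS]"
| "vrel_type (WRel n) = (if 1 \<le> n then Some (replicate n VecS) else None)"

definition L_W_lam :: "(vsort, vfun, vrel) lang" where
  "L_W_lam = \<lparr>fun_type = vfun_type, rel_type = vrel_type\<rparr>"

datatype ('k, 'v, 'g) elt = Vec (the_vec: 'v) | Fld (the_fld: 'k) | Vl (the_vl: 'g)

primrec valued_univ :: "('k, 'v, 'g) valued_space \<Rightarrow> vsort \<Rightarrow> ('k, 'v, 'g) elt set" where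
  "valued_univ V VecS = Vec ` carrier (vectors V)"
| "valued_univ V FldS = Fld ` carrier (scalars V)"
| "valued_univ V ValS = Vl ` carrier (value_set V)"

text \<open>Arguments are extracted with selectors, so lists not matching the type of a symbol yield junk.\<close>

primrec valued_fun ::
    "('k, 'v, 'g) valued_space \<Rightarrow> vfun \<Rightarrow> ('k, 'v, 'g) elt list \<Rightarrow> ('k, 'v, 'g) elt" where
  "valued_fun V VAdd = (\<lambda>ys. Vec (the_vec (ys ! 0) \<oplus>\<^bsub>vectors V\<^esub> the_vec (ys ! 1)))"
| "valued_fun V VZero = (\<lambda>ys. Vec \<zero>\<^bsub>vectors V\<^esub>)"
| "valued_fun V KAdd = (\<lambda>ys. Fld (the_fld (ys ! 0) \<oplus>\<^bsub>scalars V\<^esub> the_fld (ys ! 1)))"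
| "valued_fun V KMul = (\<lambda>ys. Fld (the_fld (ys ! 0) \<otimes>\<^bsub>scalars V\<^esub> the_fld (ys ! 1)))"
| "valued_fun V KZero = (\<lambda>ys. Fld \<zero>\<^bsub>scalars V\<^esub>)"
| "valued_fun V KOne = (\<lambda>ys. Fld \<one>\<^bsub>scalars V\<^esub>)"
| "valued_fun V Infty = (\<lambda>ys. Vl (infty V))"
| "valued_fun V Scal = (\<lambda>ys. Vec (the_fld (ys ! 0) \<odot>\<^bsub>vectors V\<^esub> the_vec (ys ! 1)))"
| "valued_fun V Val = (\<lambda>ys. Vl (val V (the_vec (ys ! 0))))"
| "valued_fun V (Lam n i) = (\<lambda>ys. Fld (lam V i (the_vec (hd ys)) (map the_vec (tl ys))))"

primrec valued_rel :: "('k, 'v, 'g) valued_space \<Rightarrow> vrel \<Rightarrow> ('k, 'v, 'g) elt list \<Rightarrow> bool" where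
  "valued_rel V Less = (\<lambda>ys. the_vl (ys ! 0) \<sqsubset>\<^bsub>value_set V\<^esub> the_vl (ys ! 1))"
| "valued_rel V (WRel n) = (\<lambda>ys. W_holds V (map the_vec ys))"

definition valued_struct ::
    "('k, 'v, 'g) valued_space \<Rightarrow> (vsort, vfun, vrel, ('k, 'v, 'g) elt) struct" where
  "valued_struct V =
     \<lparr>univ = valued_univ V, fun_int = valued_fun V, rel_int = valued_rel V\<rparr>"


section \<open>The languages of fields and of coloured linear orders\<close>

text \<open>
  Both are one-sorted, with \<^typ>\<open>unit\<close> as the type of sorts. \<^typ>\<open>unit\<close> also serves as symbol type
  where there are no symbols.
\<close>

datatype ffun = FAdd | FMul | FZero | FOne

primrec ffun_type :: "ffun \<Rightarrow> (unit list \<times> unit) option" where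
  "ffun_type FAdd = Some ([(), ()], ())"
| "ffun_type FMul = Some ([(), ()], ())"
| "ffun_type FZero = Some ([], ())"
| "ffun_type FOne = Some ([], ())"

definition L_field :: "(unit, ffun, unit) lang" where
  "L_field = \<lparr>fun_type = ffun_type, rel_type = (\<lambda>_. None)\<rparr>"

primrec field_fun :: "'k ring \<Rightarrow> ffun \<Rightarrow> 'k list \<Rightarrow> 'k" where
  "field_fun K FAdd = (\<lambda>ys. ys ! 0 \<oplus>\<^bsub>K\<^esub> ys ! 1)"
| "field_fun K FMul = (\<lambda>ys. ys ! 0 \<otimes>\<^bsub>K\<^esub> ys ! 1)"
| "field_fun K FZero = (\<lambda>ys. \<zero>\<^bsub>K\<^esub>)"
| "field_fun K FOne = (\<lambda>ys. \<one>\<^bsub>K\<^esub>)"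

definition field_struct :: "'k ring \<Rightarrow> (unit, ffun, unit, 'k) struct" where
  "field_struct K =
     \<lparr>univ = (\<lambda>_. carrier K), fun_int = field_fun K, rel_int = (\<lambda>_ _. False)\<rparr>"

datatype crel = CLess | Colour nat

primrec crel_type :: "crel \<Rightarrow> unit list option" where
  "crel_type CLess = Some [(), ()]"
| "crel_type (Colour n) = Some [()]"

definition L_coloured_order :: "(unit, unit, crel) lang" where
  "L_coloured_order = \<lparr>fun_type = (\<lambda>_. None), rel_type = crel_type\<rparr>"

primrec coloured_rel :: "'g gorder \<Rightarrow> (nat \<Rightarrow> 'g set) \<Rightarrow> crel \<Rightarrow> 'g list \<Rightarrow> bool" where
  "coloured_rel G D CLess = (\<lambda>ys. ys ! 0 \<sqsubset>\<^bsub>G\<^esub> ys ! 1)"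
| "coloured_rel G D (Colour n) = (\<lambda>ys. ys ! 0 \<in> D n)"

definition coloured_struct ::
    "'g gorder \<Rightarrow> (nat \<Rightarrow> 'g set) \<Rightarrow> (unit, unit, crel, 'g) struct" where
  "coloured_struct G D =
     \<lparr>univ = (\<lambda>_. carrier G), fun_int = undefined, rel_int = coloured_rel G D\<rparr>"

end

theory Submission
  imports Defs
begin

text \<open>
  Every finite-dimensional subspace has a valuation independent basis: a vector outside the span has
  a best approximation, and the difference extends the basis. Relative to such a basis vectors are
  coefficient tuples, the value of a vector is the minimum of the values of the basis vectors
  occurring in it, and hence $W_n$ and $\lambda_{n,i}$ are definable from the coefficients and the
  values of the basis. A further vector is either in the span, or adds a basis vector of some value
  \<open>\<gamma>\<close>; the latter is possible if and only if the basis vectors of value \<open>\<gamma>\<close> are fewer than the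
  dimension of the quotient at \<open>\<gamma>\<close>, which the colours decide. So vector quantifiers can be replaced
  by quantifiers over the field and over the coloured order, uniformly in the space. As a basis stays
  valuation independent in the extension because the \<open>W\<^sub>n\<close> are preserved, elementarity of the field and
  of the coloured order imply that of the space. Conversely the field is a sort, and the colours are
  definable by the \<open>W\<^sub>n\<close>.
\<close>

section \<open>Renaming variables\<close>

text \<open>A vector quantifier has no counterpart in the two smaller languages, so definability is
  handled semantically: a predicate on a space with assignments of scalars and values counts as
  definable if one fixed list of formulas decides it in every valued vector space, and this class is
  closed under connectives, quantifiers and substitution of definable functions. Uniformity in the
  space is essential: the two spaces are compared by evaluating the same list at the same scalars
  and values. The obstacle is the choice of basis. Scalars and values determine a vector only once a
  basis is fixed, and an eliminated quantifier must not remember which new basis vector it used.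
  Truth turns out to depend on a basis only through the list of values of its members, so any new
  vector of the right value serves. Definability is therefore stated relative to a list of value
  functions, for all independent families with these values. Scalars and values interact only
  through vectors; once these are gone, every condition splits into a field part and an order
  part.\<close>

primrec trm_bound :: "('s, 'f) trm \<Rightarrow> nat" where
  "trm_bound (Var s x) = Suc x"
| "trm_bound (Fn f ts) = sum_list (map trm_bound ts)"

text \<open>Exceeds every index in the terms of the formula, of whatever sort. A sum serves in place
  of a maximum, since each summand is below a sum of naturals.\<close>

primrec fm_bound :: "('s, 'f, 'p) fm \<Rightarrow> nat" where
  "fm_bound (Eq t u) = trm_bound t + trm_bound u"
| "fm_bound (Rel p ts) = sum_list (map trm_bound ts)"
| "fm_bound (Neg \<phi>) = fm_bound \<phi>"
| "fm_bound (Conj \<phi> \<psi>) = fm_bound \<phi> + fm_bound \<psi>"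
| "fm_bound (Exists s x \<phi>) = fm_bound \<phi>"

lemma trm_bound_le: "t \<in> set ts \<Longrightarrow> x < trm_bound t \<Longrightarrow> x < sum_list (map trm_bound ts)"
  by (rule less_le_trans) (auto intro: member_le_sum_list)

lemma eval_trm_cong: "(\<And>s x. x < trm_bound t \<Longrightarrow> e s x = e' s x) \<Longrightarrow> eval_trm M e t = eval_trm M e' t"
proof (induction t)
  case (Fn f ts)
  have "map (eval_trm M e) ts = map (eval_trm M e') ts"
    using Fn trm_bound_le by (intro map_cong refl) (auto intro!: Fn.IH Fn.prems)
  then show ?case by (simp only: eval_trm.simps)
qed simp

text \<open>Truth depends on finitely many variables only. For this reason one finite valuation
  independent family suffices for an assignment that may involve infinitely many vectors.\<close>

lemma sat_cong: "(\<And>s x. x < fm_bound \<phi> \<Longrightarrow> e s x = e' s x) \<Longrightarrow> sat M e \<phi> \<longleftrightarrow> sat M e' \<phi>"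
proof (induction \<phi> arbitrary: e e')
  case (Eq t u)
  have "eval_trm M e t = eval_trm M e' t" "eval_trm M e u = eval_trm M e' u"
    using Eq by (auto intro!: eval_trm_cong)
  then show ?case by simp
next
  case (Rel p ts)
  have "map (eval_trm M e) ts = map (eval_trm M e') ts"
    using Rel trm_bound_le by (intro map_cong refl) (auto intro!: eval_trm_cong Rel)
  then show ?case by (simp only: sat.simps)
next
  case (Neg \<phi>)
  then show ?case by (metis fm_bound.simps(3) sat.simps(3))
next
  case (Conj \<phi> \<psi>)
  have "sat M e \<phi> \<longleftrightarrow> sat M e' \<phi>" "sat M e \<psi> \<longleftrightarrow> sat M e' \<psi>"
    by (rule Conj.IH; simp add: Conj.prems)+
  then show ?case by simp
next
  case (Exists s x \<phi>)
  have "sat M (e(s := (e s)(x := a))) \<phi> \<longleftrightarrow> sat M (e'(s := (e' s)(x := a))) \<phi>" for a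
    by (rule Exists.IH) (simp add: Exists.prems)
  then show ?case by simp
qed

primrec rename_trm :: "('s \<Rightarrow> nat \<Rightarrow> nat) \<Rightarrow> ('s, 'f) trm \<Rightarrow> ('s, 'f) trm" where
  "rename_trm \<rho> (Var s x) = Var s (\<rho> s x)"
| "rename_trm \<rho> (Fn f ts) = Fn f (map (rename_trm \<rho>) ts)"

lemma has_sort_rename: "has_sort S t s \<Longrightarrow> has_sort S (rename_trm \<rho> t) s"
proof (induction rule: has_sort.induct)
  case (has_sort_Fn f ss s ts)
  then show ?case
    by (auto intro!: has_sort.has_sort_Fn simp: list.rel_map elim: list.rel_mono_strong)
qed (auto intro: has_sort.intros)

lemma eval_rename_trm: "eval_trm M e (rename_trm \<rho> t) = eval_trm M (\<lambda>s. e s \<circ> \<rho> s) t"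
  by (induction t) (auto cong: map_cong)

text \<open>The successor of the sum exceeds every image, so the new bound variable captures nothing.\<close>

primrec rename_fm :: "('s, 'f, 'p) fm \<Rightarrow> ('s \<Rightarrow> nat \<Rightarrow> nat) \<Rightarrow> ('s, 'f, 'p) fm" where
  "rename_fm (Eq t u) \<rho> = Eq (rename_trm \<rho> t) (rename_trm \<rho> u)"
| "rename_fm (Rel p ts) \<rho> = Rel p (map (rename_trm \<rho>) ts)"
| "rename_fm (Neg \<phi>) \<rho> = Neg (rename_fm \<phi> \<rho>)"
| "rename_fm (Conj \<phi> \<psi>) \<rho> = Conj (rename_fm \<phi> \<rho>) (rename_fm \<psi> \<rho>)"
| "rename_fm (Exists s x \<phi>) \<rho> =
     (let y = Suc (\<Sum>z<fm_bound \<phi>. \<rho> s z)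
      in Exists s y (rename_fm \<phi> (\<rho>(s := (\<rho> s)(x := y)))))"

lemma wf_rename_fm: "wf_fm S \<phi> \<Longrightarrow> wf_fm S (rename_fm \<phi> \<rho>)"
proof (induction \<phi> arbitrary: \<rho>)
  case (Rel p ts)
  then show ?case
    by (auto simp: list.rel_map elim!: list.rel_mono_strong intro: has_sort_rename)
qed (auto simp: Let_def intro: has_sort_rename)

lemma sat_rename_fm: "sat M e (rename_fm \<phi> \<rho>) \<longleftrightarrow> sat M (\<lambda>s. e s \<circ> \<rho> s) \<phi>"
proof (induction \<phi> arbitrary: \<rho> e)
  case (Eq t u)
  show ?case by (simp only: sat.simps rename_fm.simps eval_rename_trm)
next
  case (Rel p ts)
  have "map (eval_trm M e) (map (rename_trm \<rho>) ts) = map (eval_trm M (\<lambda>s. e s \<circ> \<rho> s)) ts"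
    by (simp add: eval_rename_trm)
  then show ?case by (simp only: sat.simps rename_fm.simps)
next
  case (Exists s x \<phi>)
  define y where "y = Suc (\<Sum>z<fm_bound \<phi>. \<rho> s z)"
  have "\<rho> s z < y" if "z < fm_bound \<phi>" for z
    using member_le_sum[of z "{..<fm_bound \<phi>}" "\<rho> s"] that by (auto simp: y_def)
  then have "sat M (\<lambda>t. (e(s := (e s)(y := a))) t \<circ> (\<rho>(s := (\<rho> s)(x := y))) t) \<phi> \<longleftrightarrow>
      sat M ((\<lambda>s. e s \<circ> \<rho> s)(s := (e s \<circ> \<rho> s)(x := a))) \<phi>" for a
    by (intro sat_cong) auto
  then show ?case
    by (simp only: rename_fm.simps Let_def sat.simps Exists.IH flip: y_def)
qed simp_all

section \<open>Definable relations on scalars and values\<close>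

text \<open>Assignments of field variables and of value variables in a fixed valued vector space.\<close>

datatype ('k, 'v, 'g) point =
  Point (space: "('k, 'v, 'g) valued_space") (fld: "nat \<Rightarrow> 'k") (vlu: "nat \<Rightarrow> 'g")

abbreviation Fp :: "('k, 'v, 'g) point \<Rightarrow> 'k ring" where "Fp p \<equiv> scalars (space p)"
abbreviation Gp :: "('k, 'v, 'g) point \<Rightarrow> 'g gorder" where "Gp p \<equiv> value_set (space p)"

definition valid :: "('k, 'v, 'g) point \<Rightarrow> bool" where
  "valid p \<longleftrightarrow> valued_vector_space (space p) \<and>
     (\<forall>n. fld p n \<in> carrier (Fp p)) \<and> (\<forall>n. vlu p n \<in> carrier (Gp p))"

definition sat_fld :: "('k, 'v, 'g) point \<Rightarrow> (unit, ffun, unit) fm \<Rightarrow> bool" where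
  "sat_fld p \<phi> \<longleftrightarrow> sat (field_struct (Fp p)) (\<lambda>_. fld p) \<phi>"

definition sat_vlu :: "('k, 'v, 'g) point \<Rightarrow> (unit, unit, crel) fm \<Rightarrow> bool" where
  "sat_vlu p \<psi> \<longleftrightarrow> sat (coloured_struct (Gp p) (dim_colour (space p))) (\<lambda>_. vlu p) \<psi>"

definition sat_dnf :: "('k, 'v, 'g) point \<Rightarrow> ((unit, ffun, unit) fm \<times> (unit, unit, crel) fm) list \<Rightarrow> bool" where
  "sat_dnf p cs \<longleftrightarrow> (\<exists>c \<in> set cs. sat_fld p (fst c) \<and> sat_vlu p (snd c))"

definition wf_dnf :: "((unit, ffun, unit) fm \<times> (unit, unit, crel) fm) list \<Rightarrow> bool" where
  "wf_dnf cs \<longleftrightarrow> (\<forall>c \<in> set cs. wf_fm L_field (fst c) \<and> wf_fm L_coloured_order (snd c))"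

text \<open>
  Since the field and the value set do not interact, every formula about both is equivalent to a
  disjunction of conjunctions of a formula about the field and one about the value set.
\<close>

definition dpred :: "(('k, 'v, 'g) point \<Rightarrow> bool) \<Rightarrow> bool" where
  "dpred P \<longleftrightarrow> (\<exists>cs. wf_dnf cs \<and> (\<forall>p. valid p \<longrightarrow> (P p \<longleftrightarrow> sat_dnf p cs)))"

lemma dpred_cong: "dpred P \<Longrightarrow> (\<And>p. valid p \<Longrightarrow> P p \<longleftrightarrow> Q p) \<Longrightarrow> dpred Q"
  unfolding dpred_def by auto

text \<open>Neither language has a constant for truth. This tautology fills the component of a
  disjunct that imposes no condition.\<close>

abbreviation "true_fm \<equiv> Neg (Conj (Eq (Var () 0) (Var () 0)) (Neg (Eq (Var () 0) (Var () 0))))"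

lemma sat_true_fm [simp]: "sat M e true_fm"
  by simp

lemma wf_true_fm [simp]: "wf_fm S true_fm"
  by (auto intro: has_sort_Var)

lemma dpred_fld: "wf_fm L_field \<phi> \<Longrightarrow> dpred (\<lambda>p. sat_fld p \<phi>)"
  unfolding dpred_def
  by (intro exI[of _ "[(\<phi>, true_fm)]"]) (simp add: wf_dnf_def sat_dnf_def sat_vlu_def del: sat.simps wf_fm.simps)

lemma dpred_vlu: "wf_fm L_coloured_order \<psi> \<Longrightarrow> dpred (\<lambda>p. sat_vlu p \<psi>)"
  unfolding dpred_def
  by (intro exI[of _ "[(true_fm, \<psi>)]"]) (simp add: wf_dnf_def sat_dnf_def sat_fld_def del: sat.simps wf_fm.simps)

lemma dpred_const: "dpred (\<lambda>p. b)"
proof (cases b)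
  case True
  then show ?thesis by (intro dpred_cong[OF dpred_fld[OF wf_true_fm]]) (simp add: sat_fld_def)
next
  case False
  then show ?thesis
    by (auto simp: dpred_def wf_dnf_def sat_dnf_def intro!: exI[of _ "[]"])
qed

lemma dpred_disj: "dpred P \<Longrightarrow> dpred Q \<Longrightarrow> dpred (\<lambda>p. P p \<or> Q p)"
  unfolding dpred_def
proof (elim exE conjE)
  fix cs ds
  assume "wf_dnf cs" "wf_dnf ds" and
    "\<forall>p. valid p \<longrightarrow> P p = sat_dnf p cs" "\<forall>p. valid p \<longrightarrow> Q p = sat_dnf p ds"
  then show "\<exists>cs. wf_dnf cs \<and> (\<forall>p. valid p \<longrightarrow> (P p \<or> Q p) = sat_dnf p cs)"
    by (intro exI[of _ "cs @ ds"]) (auto simp: wf_dnf_def sat_dnf_def)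
qed

lemma dpred_conj: "dpred P \<Longrightarrow> dpred Q \<Longrightarrow> dpred (\<lambda>p. P p \<and> Q p)"
  unfolding dpred_def
proof (elim exE conjE)
  fix cs ds
  assume cs: "wf_dnf cs" "\<forall>p. valid p \<longrightarrow> P p = sat_dnf p cs"
    and ds: "wf_dnf ds" "\<forall>p. valid p \<longrightarrow> Q p = sat_dnf p ds"
  have "sat_dnf p (map (\<lambda>(c, d). (Conj (fst c) (fst d), Conj (snd c) (snd d))) (List.product cs ds)) \<longleftrightarrow>
      sat_dnf p cs \<and> sat_dnf p ds" for p :: "('a, 'b, 'c) point"
    by (auto simp: sat_dnf_def sat_fld_def sat_vlu_def)
  moreover have "wf_dnf (map (\<lambda>(c, d). (Conj (fst c) (fst d), Conj (snd c) (snd d))) (List.product cs ds))"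
    using cs ds by (auto simp: wf_dnf_def)
  ultimately show "\<exists>cs. wf_dnf cs \<and> (\<forall>p. valid p \<longrightarrow> (P p \<and> Q p) = sat_dnf p cs)"
    using cs ds by blast
qed

text \<open>De Morgan along the list: a disjunct fails if its field part or its value part fails.
  Either failure is again a condition on a single sort, so conjoining it with the negation of the
  remaining disjuncts stays in the class.\<close>

lemma dpred_not: "dpred P \<Longrightarrow> dpred (\<lambda>p. \<not> P p)"
proof -
  have "dpred (\<lambda>p :: ('a, 'b, 'c) point. \<not> sat_dnf p cs)" if "wf_dnf cs" for cs
    using that
  proof (induction cs)
    case Nil
    show ?case by (rule dpred_cong[OF dpred_const[of True]]) (simp add: sat_dnf_def)
  next
    case (Cons c cs)
    obtain \<phi> \<psi> where c: "c = (\<phi>, \<psi>)" by fastforce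
    have wf: "wf_fm L_field (Neg \<phi>)" "wf_fm L_coloured_order (Neg \<psi>)" "wf_dnf cs"
      using Cons.prems by (auto simp: wf_dnf_def c)
    show ?case
      by (rule dpred_cong[OF dpred_conj[OF dpred_disj[OF dpred_fld[OF wf(1)] dpred_vlu[OF wf(2)]]
              Cons.IH[OF wf(3)]]])
        (auto simp: sat_dnf_def sat_fld_def sat_vlu_def c)
  qed
  then show "dpred P \<Longrightarrow> dpred (\<lambda>p. \<not> P p)"
    unfolding dpred_def[of P] by (auto intro: dpred_cong)
qed

lemma dpred_imp: "dpred P \<Longrightarrow> dpred Q \<Longrightarrow> dpred (\<lambda>p. P p \<longrightarrow> Q p)"
  by (rule dpred_cong[OF dpred_disj[OF dpred_not]]) auto

lemma dpred_Ball: "finite A \<Longrightarrow> (\<And>a. a \<in> A \<Longrightarrow> dpred (P a)) \<Longrightarrow> dpred (\<lambda>p. \<forall>a\<in>A. P a p)"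
proof (induction A rule: finite_induct)
  case empty
  then show ?case by (auto intro: dpred_cong[OF dpred_const[of True]])
next
  case (insert a A)
  then have "dpred (\<lambda>p. P a p \<and> (\<forall>a\<in>A. P a p))"
    by (intro dpred_conj) auto
  then show ?case by (rule dpred_cong) auto
qed

text \<open>Variables are numbered in de Bruijn fashion, scalars and values separately; hence one
  renaming map for each of the two sorts.\<close>

definition reindex :: "(nat \<Rightarrow> nat) \<Rightarrow> (nat \<Rightarrow> nat) \<Rightarrow> ('k, 'v, 'g) point \<Rightarrow> ('k, 'v, 'g) point" where
  "reindex \<rho> \<sigma> p = Point (space p) (fld p \<circ> \<rho>) (vlu p \<circ> \<sigma>)"

lemma reindex_sel [simp]:
  "space (reindex \<rho> \<sigma> p) = space p" "fld (reindex \<rho> \<sigma> p) = fld p \<circ> \<rho>" "vlu (reindex \<rho> \<sigma> p) = vlu p \<circ> \<sigma>"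
  by (auto simp: reindex_def)

lemma valid_reindex [simp]: "valid p \<Longrightarrow> valid (reindex \<rho> \<sigma> p)"
  by (simp add: valid_def)

lemma dpred_reindex:
  assumes "dpred P" shows "dpred (\<lambda>p. P (reindex \<rho> \<sigma> p))"
proof -
  obtain cs where cs: "wf_dnf cs" "\<And>p. valid p \<Longrightarrow> P p \<longleftrightarrow> sat_dnf p cs"
    using assms by (auto simp: dpred_def)
  let ?cs = "map (\<lambda>c. (rename_fm (fst c) (\<lambda>_. \<rho>), rename_fm (snd c) (\<lambda>_. \<sigma>))) cs"
  have "sat_dnf p ?cs \<longleftrightarrow> sat_dnf (reindex \<rho> \<sigma> p) cs" for p :: "('a, 'b, 'c) point"
    by (simp add: sat_dnf_def sat_fld_def sat_vlu_def sat_rename_fm)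
  moreover have "wf_dnf ?cs"
    using cs by (auto simp: wf_dnf_def wf_rename_fm)
  ultimately show ?thesis
    unfolding dpred_def using cs(2) by (intro exI[of _ ?cs]) simp
qed

definition push_fld :: "'k \<Rightarrow> ('k, 'v, 'g) point \<Rightarrow> ('k, 'v, 'g) point" where
  "push_fld k p = Point (space p) (case_nat k (fld p)) (vlu p)"

definition push_vlu :: "'g \<Rightarrow> ('k, 'v, 'g) point \<Rightarrow> ('k, 'v, 'g) point" where
  "push_vlu g p = Point (space p) (fld p) (case_nat g (vlu p))"

abbreviation pop_fld :: "('k, 'v, 'g) point \<Rightarrow> ('k, 'v, 'g) point" where
  "pop_fld \<equiv> reindex Suc id"

abbreviation pop_vlu :: "('k, 'v, 'g) point \<Rightarrow> ('k, 'v, 'g) point" where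
  "pop_vlu \<equiv> reindex id Suc"

lemma push_sel [simp]:
  "space (push_fld k p) = space p" "fld (push_fld k p) = case_nat k (fld p)" "vlu (push_fld k p) = vlu p"
  "space (push_vlu g p) = space p" "vlu (push_vlu g p) = case_nat g (vlu p)" "fld (push_vlu g p) = fld p"
  by (auto simp: push_fld_def push_vlu_def)

lemma pop_push [simp]: "pop_fld (push_fld k p) = p" "pop_vlu (push_vlu g p) = p"
  by (cases p; auto simp: reindex_def o_def)+

lemma valid_push [simp]:
  "valid p \<Longrightarrow> k \<in> carrier (Fp p) \<Longrightarrow> valid (push_fld k p)"
  "valid p \<Longrightarrow> g \<in> carrier (Gp p) \<Longrightarrow> valid (push_vlu g p)"
  by (auto simp: valid_def split: nat.split)

text \<open>The quantifier distributes over the disjunction, and within a disjunct it passes the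
  value part, which does not see scalars. Only the field part gets quantified.\<close>

lemma dpred_ex_fld:
  assumes "dpred P" shows "dpred (\<lambda>p. \<exists>k\<in>carrier (Fp p). P (push_fld k p))"
proof -
  obtain cs where cs: "wf_dnf cs" "\<And>p. valid p \<Longrightarrow> P p \<longleftrightarrow> sat_dnf p cs"
    using assms by (auto simp: dpred_def)
  let ?cs = "map (\<lambda>c. (Exists () 0 (fst c), snd c)) cs"
  have *: "(\<lambda>_. fld p)(() := (fld p)(0 := k)) = (\<lambda>_. fld (push_fld k (pop_fld p)))"
    for p :: "('a, 'b, 'c) point" and k
    by (auto simp: fun_eq_iff split: nat.split)
  have **: "sat_fld p (Exists () 0 \<phi>) \<longleftrightarrow> (\<exists>k\<in>carrier (Fp p). sat_fld (push_fld k (pop_fld p)) \<phi>)"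
    for p :: "('a, 'b, 'c) point" and \<phi>
    unfolding sat_fld_def sat.simps * by (simp add: field_struct_def)
  have ***: "sat_vlu (push_fld k (pop_fld p)) \<phi> \<longleftrightarrow> sat_vlu p \<phi>" for p :: "('a, 'b, 'c) point" and k \<phi>
    by (simp add: sat_vlu_def)
  have "sat_dnf p ?cs \<longleftrightarrow> (\<exists>k\<in>carrier (Fp p). sat_dnf (push_fld k (pop_fld p)) cs)"
    for p :: "('a, 'b, 'c) point"
    by (auto simp: sat_dnf_def ** ***)
  moreover have "wf_dnf ?cs"
    using cs by (auto simp: wf_dnf_def)
  ultimately have "dpred (\<lambda>p. \<exists>k\<in>carrier (Fp p). P (push_fld k (pop_fld p)))"
    unfolding dpred_def using cs(2) by (intro exI[of _ ?cs]) auto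
  \<comment> \<open>\<open>Exists () 0\<close> overwrites index 0, whereas \<open>push_fld\<close>
    inserts in front of it. Reading the assignment through \<open>n - 1\<close> doubles the variable
    at 0, so that only a copy is overwritten.\<close>
  from dpred_reindex[OF this, of "\<lambda>n. n - 1" id] show ?thesis
  proof (rule dpred_cong)
    fix p :: "('a, 'b, 'c) point"
    have "push_fld k (pop_fld (reindex (\<lambda>n. n - 1) id p)) = push_fld k p" for k
      by (cases p) (auto simp: push_fld_def o_def)
    then show "(\<exists>k\<in>carrier (Fp (reindex (\<lambda>n. n - 1) id p)). P (push_fld k (pop_fld (reindex (\<lambda>n. n - 1) id p)))) \<longleftrightarrow>
        (\<exists>k\<in>carrier (Fp p). P (push_fld k p))" by simp
  qed
qed

lemma dpred_ex_vlu:
  assumes "dpred P" shows "dpred (\<lambda>p. \<exists>g\<in>carrier (Gp p). P (push_vlu g p))"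
proof -
  obtain cs where cs: "wf_dnf cs" "\<And>p. valid p \<Longrightarrow> P p \<longleftrightarrow> sat_dnf p cs"
    using assms by (auto simp: dpred_def)
  let ?cs = "map (\<lambda>c. (fst c, Exists () 0 (snd c))) cs"
  have *: "(\<lambda>_. vlu p)(() := (vlu p)(0 := g)) = (\<lambda>_. vlu (push_vlu g (pop_vlu p)))"
    for p :: "('a, 'b, 'c) point" and g
    by (auto simp: fun_eq_iff split: nat.split)
  have **: "sat_vlu p (Exists () 0 \<phi>) \<longleftrightarrow> (\<exists>g\<in>carrier (Gp p). sat_vlu (push_vlu g (pop_vlu p)) \<phi>)"
    for p :: "('a, 'b, 'c) point" and \<phi>
    unfolding sat_vlu_def sat.simps * by (simp add: coloured_struct_def)
  have ***: "sat_fld (push_vlu g (pop_vlu p)) \<phi> \<longleftrightarrow> sat_fld p \<phi>" for p :: "('a, 'b, 'c) point" and g \<phi>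
    by (simp add: sat_fld_def)
  have "sat_dnf p ?cs \<longleftrightarrow> (\<exists>g\<in>carrier (Gp p). sat_dnf (push_vlu g (pop_vlu p)) cs)"
    for p :: "('a, 'b, 'c) point"
    by (auto simp: sat_dnf_def ** ***)
  moreover have "wf_dnf ?cs"
    using cs by (auto simp: wf_dnf_def)
  ultimately have "dpred (\<lambda>p. \<exists>g\<in>carrier (Gp p). P (push_vlu g (pop_vlu p)))"
    unfolding dpred_def using cs(2) by (intro exI[of _ ?cs]) auto
  from dpred_reindex[OF this, of id "\<lambda>n. n - 1"] show ?thesis
  proof (rule dpred_cong)
    fix p :: "('a, 'b, 'c) point"
    have "push_vlu g (pop_vlu (reindex id (\<lambda>n. n - 1) p)) = push_vlu g p" for g
      by (cases p) (auto simp: push_vlu_def o_def)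
    then show "(\<exists>g\<in>carrier (Gp (reindex id (\<lambda>n. n - 1) p)). P (push_vlu g (pop_vlu (reindex id (\<lambda>n. n - 1) p)))) \<longleftrightarrow>
        (\<exists>g\<in>carrier (Gp p). P (push_vlu g p))" by simp
  qed
qed


section \<open>Linear combinations and valuation independence\<close>

text \<open>A recursive counterpart of \<open>lin_comb\<close>, suited to list induction. Surplus
  entries of the longer list are ignored.\<close>

fun lcomb :: "('k, 'v, 'g) valued_space \<Rightarrow> 'k list \<Rightarrow> 'v list \<Rightarrow> 'v" where
  "lcomb V (k # ks) (v # vs) = k \<odot>\<^bsub>vectors V\<^esub> v \<oplus>\<^bsub>vectors V\<^esub> lcomb V ks vs"
| "lcomb V _ _ = \<zero>\<^bsub>vectors V\<^esub>"

text \<open>Only an upper bound on the value is demanded, since the ultrametric inequality supplies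
  the lower one; together they make the value of a combination the minimum over its nonzero terms.
  As the members are nonzero, linear independence is included, and so is the absence of
  repetitions.\<close>

definition vindep :: "('k, 'v, 'g) valued_space \<Rightarrow> 'v list \<Rightarrow> bool" where
  "vindep V bs \<longleftrightarrow> set bs \<subseteq> carrier (vectors V) - {\<zero>\<^bsub>vectors V\<^esub>} \<and>
     (\<forall>ks. length ks = length bs \<and> set ks \<subseteq> carrier (scalars V) \<longrightarrow>
        (\<forall>(k, b) \<in> set (zip ks bs). k \<noteq> \<zero>\<^bsub>scalars V\<^esub> \<longrightarrow> val V (lcomb V ks bs) \<sqsubseteq>\<^bsub>value_set V\<^esub> val V b))"

text \<open>Linear independence of the residues in the quotient at \<open>\<gamma>\<close>.\<close>

definition rindep :: "('k, 'v, 'g) valued_space \<Rightarrow> 'g \<Rightarrow> 'v list \<Rightarrow> bool" where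
  "rindep V \<gamma> vs \<longleftrightarrow> set vs \<subseteq> closed_ball V \<gamma> \<and>
     (\<forall>ks. length ks = length vs \<and> set ks \<subseteq> carrier (scalars V) \<and> lcomb V ks vs \<in> open_ball V \<gamma> \<longrightarrow>
        set ks \<subseteq> {\<zero>\<^bsub>scalars V\<^esub>})"

fun select :: "('v \<Rightarrow> bool) \<Rightarrow> 'k list \<Rightarrow> 'v list \<Rightarrow> 'k list" where
  "select P (k # ks) (v # vs) = (if P v then k # select P ks vs else select P ks vs)"
| "select P _ _ = []"

lemma select_facts:
  assumes "length ks = length vs"
  shows "length (select P ks vs) = length (filter P vs)"
    and "set (select P ks vs) \<subseteq> set ks"
    and "set (zip (select P ks vs) (filter P vs)) = {(k, v) \<in> set (zip ks vs). P v}"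
  using assms by (induction ks vs rule: list_induct2) auto

context valued_vector_space
begin

section \<open>Order and ultrametric inequalities\<close>

abbreviation "K \<equiv> scalars V"
abbreviation "M \<equiv> vectors V"
abbreviation "G \<equiv> value_set V"
abbreviation val_le (infix "\<le>\<^sub>v" 50) where "a \<le>\<^sub>v b \<equiv> a \<sqsubseteq>\<^bsub>value_set V\<^esub> b"
abbreviation val_lt (infix "<\<^sub>v" 50) where "a <\<^sub>v b \<equiv> a \<sqsubset>\<^bsub>value_set V\<^esub> b"

sublocale vs: vectorspace "scalars V" "vectors V"
  by (rule vectorspace)

sublocale ord: total_order "value_set V"
  by (rule total_order)

lemma lt_iff: "a <\<^sub>v b \<longleftrightarrow> a \<le>\<^sub>v b \<and> a \<noteq> b"
  by (simp add: lless_def ord.eq_is_equal)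

lemma not_lt_iff: "a \<in> carrier G \<Longrightarrow> b \<in> carrier G \<Longrightarrow> \<not> a <\<^sub>v b \<longleftrightarrow> b \<le>\<^sub>v a"
  using ord.total_order_total ord.le_antisym by (auto simp: lt_iff)

lemma lt_trans: "a <\<^sub>v b \<Longrightarrow> b \<le>\<^sub>v c \<Longrightarrow> a \<in> carrier G \<Longrightarrow> b \<in> carrier G \<Longrightarrow> c \<in> carrier G \<Longrightarrow> a <\<^sub>v c"
  by (metis lt_iff ord.le_trans ord.le_antisym)

lemma lt_infty: "a \<in> carrier G \<Longrightarrow> a \<noteq> infty V \<Longrightarrow> a <\<^sub>v infty V"
  by (simp add: lt_iff infty_last)

lemma lt_imp_neq_infty: "a <\<^sub>v b \<Longrightarrow> a \<in> carrier G \<Longrightarrow> b \<in> carrier G \<Longrightarrow> a \<noteq> infty V"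
  using infty_last not_lt_iff by blast

lemma finite_has_min: "finite A \<Longrightarrow> A \<noteq> {} \<Longrightarrow> A \<subseteq> carrier G \<Longrightarrow> \<exists>m\<in>A. \<forall>a\<in>A. m \<le>\<^sub>v a"
proof (induction A rule: finite_ne_induct)
  case (insert x A)
  then obtain m where m: "m \<in> A" "\<forall>a\<in>A. m \<le>\<^sub>v a" by auto
  show ?case
  proof (cases "x \<le>\<^sub>v m")
    case True
    then have "\<forall>a\<in>insert x A. x \<le>\<^sub>v a" using m insert.prems ord.le_trans[of x m] by auto
    then show ?thesis by blast
  next
    case False
    then have "\<forall>a\<in>insert x A. m \<le>\<^sub>v a" using m insert.prems ord.total_order_total[of x m] by auto
    then show ?thesis using m by blast
  qed
qed auto

lemma finite_has_max: "finite A \<Longrightarrow> A \<noteq> {} \<Longrightarrow> A \<subseteq> carrier G \<Longrightarrow> \<exists>m\<in>A. \<forall>a\<in>A. a \<le>\<^sub>v m"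
proof (induction A rule: finite_ne_induct)
  case (insert x A)
  then obtain m where m: "m \<in> A" "\<forall>a\<in>A. a \<le>\<^sub>v m" by auto
  show ?case
  proof (cases "m \<le>\<^sub>v x")
    case True
    then have "\<forall>a\<in>insert x A. a \<le>\<^sub>v x" using m insert.prems ord.le_trans[of _ m x] by auto
    then show ?thesis by blast
  next
    case False
    then have "\<forall>a\<in>insert x A. a \<le>\<^sub>v m" using m insert.prems ord.total_order_total[of x m] by auto
    then show ?thesis using m by blast
  qed
qed auto

lemma val_closed [simp]: "x \<in> carrier M \<Longrightarrow> val V x \<in> carrier G"
  using val_surj by auto

lemma val_zero [simp]: "val V \<zero>\<^bsub>M\<^esub> = infty V"
  by (simp add: val_eq_infty_iff)

lemma neg_one_neq_zero: "\<ominus>\<^bsub>K\<^esub> \<one>\<^bsub>K\<^esub> \<noteq> \<zero>\<^bsub>K\<^esub>"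
  by (metis vs.R.add.inv_eq_1_iff vs.R.one_closed vs.zero_not_one)

lemma neg_eq_smult: "x \<in> carrier M \<Longrightarrow> \<ominus>\<^bsub>M\<^esub> x = (\<ominus>\<^bsub>K\<^esub> \<one>\<^bsub>K\<^esub>) \<odot>\<^bsub>M\<^esub> x"
  by (simp add: vs.smult_l_minus)

lemma val_neg [simp]: "x \<in> carrier M \<Longrightarrow> val V (\<ominus>\<^bsub>M\<^esub> x) = val V x"
  by (simp add: neg_eq_smult val_smult neg_one_neq_zero)

lemma val_diff_ge:
  assumes "\<gamma> \<in> carrier G" "x \<in> carrier M" "y \<in> carrier M" "\<gamma> \<le>\<^sub>v val V x" "\<gamma> \<le>\<^sub>v val V y"
  shows "\<gamma> \<le>\<^sub>v val V (x \<ominus>\<^bsub>M\<^esub> y)"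
  using val_diff[OF assms(2,3)] assms by (auto split: if_splits intro: ord.le_trans)

lemma val_add_ge:
  assumes "\<gamma> \<in> carrier G" "x \<in> carrier M" "y \<in> carrier M" "\<gamma> \<le>\<^sub>v val V x" "\<gamma> \<le>\<^sub>v val V y"
  shows "\<gamma> \<le>\<^sub>v val V (x \<oplus>\<^bsub>M\<^esub> y)"
  using val_diff_ge[of \<gamma> x "\<ominus>\<^bsub>M\<^esub> y"] assms by (simp add: vs.M.minus_eq)

lemma val_diff_gt:
  assumes "\<gamma> \<in> carrier G" "x \<in> carrier M" "y \<in> carrier M" "\<gamma> <\<^sub>v val V x" "\<gamma> <\<^sub>v val V y"
  shows "\<gamma> <\<^sub>v val V (x \<ominus>\<^bsub>M\<^esub> y)"
  using val_diff[OF assms(2,3)] assms by (auto split: if_splits intro: lt_trans)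

lemma val_add_gt:
  assumes "\<gamma> \<in> carrier G" "x \<in> carrier M" "y \<in> carrier M" "\<gamma> <\<^sub>v val V x" "\<gamma> <\<^sub>v val V y"
  shows "\<gamma> <\<^sub>v val V (x \<oplus>\<^bsub>M\<^esub> y)"
  using val_diff_gt[of \<gamma> x "\<ominus>\<^bsub>M\<^esub> y"] assms by (simp add: vs.M.minus_eq)

lemma val_smult_le: "k \<in> carrier K \<Longrightarrow> x \<in> carrier M \<Longrightarrow> val V x \<le>\<^sub>v val V (k \<odot>\<^bsub>M\<^esub> x)"
  by (cases "k = \<zero>\<^bsub>K\<^esub>") (auto simp: val_smult infty_last)

lemma diff_closed [simp]: "x \<in> carrier M \<Longrightarrow> y \<in> carrier M \<Longrightarrow> x \<ominus>\<^bsub>M\<^esub> y \<in> carrier M"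
  by (simp add: vs.M.minus_eq)

lemma neg_zero [simp]: "\<ominus>\<^bsub>M\<^esub> \<zero>\<^bsub>M\<^esub> = \<zero>\<^bsub>M\<^esub>"
  using vs.M.r_neg[of "\<zero>\<^bsub>M\<^esub>"] by simp

lemma add_diff_cancel: "x \<in> carrier M \<Longrightarrow> y \<in> carrier M \<Longrightarrow> (x \<oplus>\<^bsub>M\<^esub> y) \<ominus>\<^bsub>M\<^esub> y = x"
  by (simp add: vs.M.minus_eq vs.M.a_assoc vs.M.r_neg)

lemma add_diff_cancel': "x \<in> carrier M \<Longrightarrow> y \<in> carrier M \<Longrightarrow> (x \<oplus>\<^bsub>M\<^esub> y) \<ominus>\<^bsub>M\<^esub> x = y"
  by (metis add_diff_cancel vs.M.a_comm)

lemma diff_add_cancel: "x \<in> carrier M \<Longrightarrow> y \<in> carrier M \<Longrightarrow> (x \<ominus>\<^bsub>M\<^esub> y) \<oplus>\<^bsub>M\<^esub> y = x"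
  by (simp add: vs.M.minus_eq vs.M.a_assoc vs.M.l_neg)

lemma diff_diff_eq:
  assumes "x \<in> carrier M" "y \<in> carrier M" "z \<in> carrier M"
  shows "x \<ominus>\<^bsub>M\<^esub> y \<ominus>\<^bsub>M\<^esub> (x \<ominus>\<^bsub>M\<^esub> z) = z \<ominus>\<^bsub>M\<^esub> y"
proof -
  have "x \<ominus>\<^bsub>M\<^esub> y \<ominus>\<^bsub>M\<^esub> (x \<ominus>\<^bsub>M\<^esub> z) = x \<oplus>\<^bsub>M\<^esub> (z \<oplus>\<^bsub>M\<^esub> (\<ominus>\<^bsub>M\<^esub> x \<oplus>\<^bsub>M\<^esub> \<ominus>\<^bsub>M\<^esub> y))"
    using assms by (simp add: vs.M.minus_eq vs.M.minus_add vs.M.a_ac)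
  also have "\<dots> = x \<oplus>\<^bsub>M\<^esub> (\<ominus>\<^bsub>M\<^esub> x \<oplus>\<^bsub>M\<^esub> (z \<oplus>\<^bsub>M\<^esub> \<ominus>\<^bsub>M\<^esub> y))"
    using assms by (subst vs.M.a_lcomm[of z]) auto
  finally show ?thesis using assms by (simp add: vs.M.r_neg2 vs.M.minus_eq)
qed

lemma diff_eq_zero_iff: "x \<in> carrier M \<Longrightarrow> y \<in> carrier M \<Longrightarrow> x \<ominus>\<^bsub>M\<^esub> y = \<zero>\<^bsub>M\<^esub> \<longleftrightarrow> x = y"
  by (metis diff_add_cancel vs.M.l_zero vs.M.minus_eq vs.M.r_neg)

text \<open>The smaller value dominates: were the value of \<open>x - y\<close> larger than that of
  \<open>x\<close>, adding \<open>y\<close> back would give \<open>x\<close> a value larger than its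
  own.\<close>

lemma val_diff_eq:
  assumes "x \<in> carrier M" "y \<in> carrier M" "val V x <\<^sub>v val V y"
  shows "val V (x \<ominus>\<^bsub>M\<^esub> y) = val V x"
proof (rule ord.le_antisym)
  show "val V x \<le>\<^sub>v val V (x \<ominus>\<^bsub>M\<^esub> y)"
    using assms by (intro val_diff_ge) (auto simp: lt_iff)
  have "\<not> val V x <\<^sub>v val V (x \<ominus>\<^bsub>M\<^esub> y)"
  proof
    assume "val V x <\<^sub>v val V (x \<ominus>\<^bsub>M\<^esub> y)"
    then have "val V x <\<^sub>v val V (x \<ominus>\<^bsub>M\<^esub> y \<oplus>\<^bsub>M\<^esub> y)"
      using assms by (intro val_add_gt) auto
    then show False using assms by (simp add: diff_add_cancel lt_iff)
  qed
  then show "val V (x \<ominus>\<^bsub>M\<^esub> y) \<le>\<^sub>v val V x"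
    using assms by (simp add: not_lt_iff)
qed (use assms in auto)

section \<open>Linear combinations of lists\<close>

lemma lcomb_closed [simp]:
  "set ks \<subseteq> carrier K \<Longrightarrow> set vs \<subseteq> carrier M \<Longrightarrow> lcomb V ks vs \<in> carrier M"
  by (induction ks vs rule: list_induct2') auto

lemma lin_comb_eq_lcomb:
  "length ks = length vs \<Longrightarrow> set ks \<subseteq> carrier K \<Longrightarrow> set vs \<subseteq> carrier M \<Longrightarrow> lin_comb V ks vs = lcomb V ks vs"
proof (induction ks vs rule: list_induct2)
  case Nil
  then show ?case by (simp add: lin_comb_def)
next
  case (Cons k ks v vs)
  define f where "f = (\<lambda>i. ((k # ks) ! i) \<odot>\<^bsub>M\<^esub> ((v # vs) ! i))"
  have f: "f i \<in> carrier M" if "i < Suc (length vs)" for i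
    using that Cons.prems Cons.hyps nth_mem[of i "k # ks"] nth_mem[of i "v # vs"]
    unfolding f_def by (intro vs.smult_closed) auto
  have "{..<Suc (length vs)} = insert 0 (Suc ` {..<length vs})"
    by (rule lessThan_Suc_eq_insert_0)
  then have "lin_comb V (k # ks) (v # vs) = finsum M f (insert 0 (Suc ` {..<length vs}))"
    by (simp add: lin_comb_def f_def)
  also have "\<dots> = f 0 \<oplus>\<^bsub>M\<^esub> finsum M f (Suc ` {..<length vs})"
    using f by (intro vs.M.finsum_insert) auto
  also have "finsum M f (Suc ` {..<length vs}) = finsum M (\<lambda>i. f (Suc i)) {..<length vs}"
    using f by (intro vs.M.finsum_reindex) auto
  also have "\<dots> = lin_comb V ks vs"
    by (simp add: f_def lin_comb_def)
  finally show ?case using Cons by (simp add: f_def)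
qed

lemma lcomb_zero: "set ks \<subseteq> {\<zero>\<^bsub>K\<^esub>} \<Longrightarrow> set vs \<subseteq> carrier M \<Longrightarrow> lcomb V ks vs = \<zero>\<^bsub>M\<^esub>"
  by (induction ks vs rule: list_induct2') auto

lemma lcomb_smult:
  "c \<in> carrier K \<Longrightarrow> set ks \<subseteq> carrier K \<Longrightarrow> set vs \<subseteq> carrier M \<Longrightarrow>
    lcomb V (map ((\<otimes>\<^bsub>K\<^esub>) c) ks) vs = c \<odot>\<^bsub>M\<^esub> lcomb V ks vs"
  by (induction ks vs rule: list_induct2') (auto simp: vs.smult_assoc1 vs.smult_r_distr)

lemma lcomb_add:
  "length ks = length ls \<Longrightarrow> set ks \<subseteq> carrier K \<Longrightarrow> set ls \<subseteq> carrier K \<Longrightarrow> set vs \<subseteq> carrier M \<Longrightarrow>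
    lcomb V (map2 (\<oplus>\<^bsub>K\<^esub>) ks ls) vs = lcomb V ks vs \<oplus>\<^bsub>M\<^esub> lcomb V ls vs"
proof (induction ks ls arbitrary: vs rule: list_induct2)
  case (Cons k ks l ls)
  then show ?case
    by (cases vs) (simp_all add: vs.smult_l_distr vs.M.a_ac)
qed auto

lemma lcomb_neg:
  assumes "set ks \<subseteq> carrier K" "set vs \<subseteq> carrier M"
  shows "lcomb V (map (\<lambda>k. \<ominus>\<^bsub>K\<^esub> k) ks) vs = \<ominus>\<^bsub>M\<^esub> lcomb V ks vs"
  using assms
  by (induction ks vs rule: list_induct2') (auto simp: vs.smult_l_minus vs.M.minus_add)

lemma map2_add_closed:
  "set ks \<subseteq> carrier K \<Longrightarrow> set ls \<subseteq> carrier K \<Longrightarrow> set (map2 (\<oplus>\<^bsub>K\<^esub>) ks ls) \<subseteq> carrier K"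
  by (induction ks ls rule: list_induct2') auto

lemma lcomb_split:
  "length ks = length vs \<Longrightarrow> set ks \<subseteq> carrier K \<Longrightarrow> set vs \<subseteq> carrier M \<Longrightarrow>
    lcomb V ks vs = lcomb V (select P ks vs) (filter P vs) \<oplus>\<^bsub>M\<^esub>
      lcomb V (select (\<lambda>v. \<not> P v) ks vs) (filter (\<lambda>v. \<not> P v) vs)"
proof (induction ks vs rule: list_induct2)
  case (Cons k ks v vs)
  have "lcomb V (select Q ks vs) (filter Q vs) \<in> carrier M" for Q
    using Cons select_facts(2)[of ks vs Q] by (intro lcomb_closed) auto
  then show ?case using Cons by (simp add: vs.M.a_ac)
qed auto

text \<open>Zero coefficients are inserted at the vectors dropped by the filter. The inclusion of
  the zips records that each coefficient stays with its vector, so that the bound in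
  \<open>vindep\<close> can be applied to the full family.\<close>

lemma lcomb_extend:
  "length ks = length (filter P vs) \<Longrightarrow> set ks \<subseteq> carrier K \<Longrightarrow> set vs \<subseteq> carrier M \<Longrightarrow>
    \<exists>ls. length ls = length vs \<and> set ls \<subseteq> carrier K \<and> lcomb V ls vs = lcomb V ks (filter P vs) \<and>
      set (zip ks (filter P vs)) \<subseteq> set (zip ls vs)"
proof (induction vs arbitrary: ks)
  case (Cons v vs)
  show ?case
  proof (cases "P v")
    case True
    then obtain l ks' where ks: "ks = l # ks'" "length ks' = length (filter P vs)"
      using Cons.prems by (auto simp: length_Suc_conv)
    then obtain ls where "length ls = length vs" "set ls \<subseteq> carrier K"
        "lcomb V ls vs = lcomb V ks' (filter P vs)" "set (zip ks' (filter P vs)) \<subseteq> set (zip ls vs)"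
      using Cons.IH[of ks'] Cons.prems by auto
    then show ?thesis
      using ks True Cons.prems by (intro exI[of _ "l # ls"]) auto
  next
    case False
    then obtain ls where "length ls = length vs" "set ls \<subseteq> carrier K"
        "lcomb V ls vs = lcomb V ks (filter P vs)" "set (zip ks (filter P vs)) \<subseteq> set (zip ls vs)"
      using Cons.IH[of ks] Cons.prems by auto
    moreover have "lcomb V ls vs \<in> carrier M"
      using \<open>set ls \<subseteq> carrier K\<close> Cons.prems by simp
    ultimately show ?thesis
      using False Cons.prems by (intro exI[of _ "\<zero>\<^bsub>K\<^esub> # ls"]) auto
  qed
qed auto

text \<open>The occurrence of one among the coefficients is recorded because it contradicts the
  vanishing of all coefficients in a residually independent list.\<close>

lemma lcomb_unit:
  "v \<in> set vs \<Longrightarrow> set vs \<subseteq> carrier M \<Longrightarrow>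
    \<exists>ks. length ks = length vs \<and> set ks \<subseteq> carrier K \<and> \<one>\<^bsub>K\<^esub> \<in> set ks \<and> lcomb V ks vs = v"
proof (induction vs)
  case (Cons w vs)
  show ?case
  proof (cases "v = w")
    case True
    have "lcomb V (replicate (length vs) \<zero>\<^bsub>K\<^esub>) vs = \<zero>\<^bsub>M\<^esub>"
      using Cons.prems by (intro lcomb_zero) auto
    then show ?thesis
      using True Cons.prems by (intro exI[of _ "\<one>\<^bsub>K\<^esub> # replicate (length vs) \<zero>\<^bsub>K\<^esub>"]) auto
  next
    case False
    then obtain ks where "length ks = length vs" "set ks \<subseteq> carrier K" "\<one>\<^bsub>K\<^esub> \<in> set ks" "lcomb V ks vs = v"
      using Cons by auto
    then show ?thesis using Cons.prems by (intro exI[of _ "\<zero>\<^bsub>K\<^esub> # ks"]) auto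
  qed
qed auto

lemma val_lcomb_ge:
  "length ks = length vs \<Longrightarrow> set ks \<subseteq> carrier K \<Longrightarrow> set vs \<subseteq> carrier M \<Longrightarrow> \<gamma> \<in> carrier G \<Longrightarrow>
    \<forall>(k, v) \<in> set (zip ks vs). k \<noteq> \<zero>\<^bsub>K\<^esub> \<longrightarrow> \<gamma> \<le>\<^sub>v val V v \<Longrightarrow> \<gamma> \<le>\<^sub>v val V (lcomb V ks vs)"
proof (induction ks vs rule: list_induct2)
  case (Cons k ks v vs)
  have "\<gamma> \<le>\<^sub>v val V (k \<odot>\<^bsub>M\<^esub> v)"
    using Cons.prems by (cases "k = \<zero>\<^bsub>K\<^esub>") (auto simp: val_smult infty_last)
  then show ?case
    using Cons by (auto intro!: val_add_ge)
qed (simp add: infty_last)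

text \<open>The hypothesis \<open>\<gamma> \<noteq> infty V\<close> accounts for the zero
  combination, whose value is \<infinity> and so lies above every other \<gamma>.\<close>

lemma val_lcomb_gt:
  "length ks = length vs \<Longrightarrow> set ks \<subseteq> carrier K \<Longrightarrow> set vs \<subseteq> carrier M \<Longrightarrow> \<gamma> \<in> carrier G \<Longrightarrow>
    \<gamma> \<noteq> infty V \<Longrightarrow> \<forall>(k, v) \<in> set (zip ks vs). k \<noteq> \<zero>\<^bsub>K\<^esub> \<longrightarrow> \<gamma> <\<^sub>v val V v \<Longrightarrow> \<gamma> <\<^sub>v val V (lcomb V ks vs)"
proof (induction ks vs rule: list_induct2)
  case (Cons k ks v vs)
  have "\<gamma> <\<^sub>v val V (k \<odot>\<^bsub>M\<^esub> v)"
    using Cons.prems by (cases "k = \<zero>\<^bsub>K\<^esub>") (auto simp: val_smult lt_infty)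
  then show ?case
    using Cons by (auto intro!: val_add_gt)
qed (simp add: lt_infty)

section \<open>Valuation independent families\<close>

lemma vindepD:
  "vindep V bs \<Longrightarrow> length ks = length bs \<Longrightarrow> set ks \<subseteq> carrier K \<Longrightarrow> (k, b) \<in> set (zip ks bs) \<Longrightarrow>
    k \<noteq> \<zero>\<^bsub>K\<^esub> \<Longrightarrow> val V (lcomb V ks bs) \<le>\<^sub>v val V b"
  unfolding vindep_def by fast

lemma vindepI:
  assumes "set bs \<subseteq> carrier M - {\<zero>\<^bsub>M\<^esub>}"
    and "\<And>ks k b. length ks = length bs \<Longrightarrow> set ks \<subseteq> carrier K \<Longrightarrow> (k, b) \<in> set (zip ks bs) \<Longrightarrow>
      k \<noteq> \<zero>\<^bsub>K\<^esub> \<Longrightarrow> val V (lcomb V ks bs) \<le>\<^sub>v val V b"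
  shows "vindep V bs"
  using assms unfolding vindep_def by blast

lemma vindep_closed: "vindep V bs \<Longrightarrow> set bs \<subseteq> carrier M"
  by (auto simp: vindep_def)

lemma vindep_Nil [simp]: "vindep V []"
  by (auto simp: vindep_def)

lemma vindep_tl:
  assumes "vindep V (w # bs)" shows "vindep V bs"
proof (rule vindepI)
  show "set bs \<subseteq> carrier M - {\<zero>\<^bsub>M\<^esub>}" using assms by (auto simp: vindep_def)
  fix ks k b
  assume ks: "length ks = length bs" "set ks \<subseteq> carrier K" "(k, b) \<in> set (zip ks bs)" "k \<noteq> \<zero>\<^bsub>K\<^esub>"
  have "val V (lcomb V (\<zero>\<^bsub>K\<^esub> # ks) (w # bs)) \<le>\<^sub>v val V b"
    using ks by (intro vindepD[OF assms]) auto
  then show "val V (lcomb V ks bs) \<le>\<^sub>v val V b"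
    using vindep_closed[OF assms] ks by simp
qed

text \<open>The hypothesis says that \<open>w\<close> cannot be improved by elements of the span. If
  its coefficient in a combination is zero, independence of \<open>bs\<close> applies; otherwise
  dividing by the coefficient, which does not change the value, leads back to the
  hypothesis.\<close>

lemma vindep_extend:
  assumes bs: "vindep V bs" and w: "w \<in> carrier M" "w \<noteq> \<zero>\<^bsub>M\<^esub>"
    and le: "\<And>ks. length ks = length bs \<Longrightarrow> set ks \<subseteq> carrier K \<Longrightarrow> val V (w \<oplus>\<^bsub>M\<^esub> lcomb V ks bs) \<le>\<^sub>v val V w"
  shows "vindep V (w # bs)"
proof (rule vindepI)
  note bsc = vindep_closed[OF bs]
  show "set (w # bs) \<subseteq> carrier M - {\<zero>\<^bsub>M\<^esub>}" using bs w by (auto simp: vindep_def)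
  fix ks c b
  assume ks: "length ks = length (w # bs)" "set ks \<subseteq> carrier K" "(c, b) \<in> set (zip ks (w # bs))" "c \<noteq> \<zero>\<^bsub>K\<^esub>"
  then obtain d cs where dcs: "ks = d # cs" "length cs = length bs" "d \<in> carrier K" "set cs \<subseteq> carrier K"
    by (auto simp: length_Suc_conv)
  let ?a = "lcomb V cs bs" and ?u = "lcomb V ks (w # bs)"
  have a: "?a \<in> carrier M" using dcs bsc by simp
  have u: "?u = d \<odot>\<^bsub>M\<^esub> w \<oplus>\<^bsub>M\<^esub> ?a" by (simp add: dcs)
  show "val V ?u \<le>\<^sub>v val V b"
  proof (cases "d = \<zero>\<^bsub>K\<^esub>")
    case True
    then have "?u = ?a" using u a w by simp
    moreover have "(c, b) \<in> set (zip cs bs)" using ks dcs True by auto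
    ultimately show ?thesis using vindepD[OF bs dcs(2,4) _ ks(4)] by simp
  next
    case False
    let ?i = "inv\<^bsub>K\<^esub> d"
    have i: "?i \<in> carrier K" "d \<otimes>\<^bsub>K\<^esub> ?i = \<one>\<^bsub>K\<^esub>"
      using False dcs vs.field_Units by auto
    have "d \<odot>\<^bsub>M\<^esub> (w \<oplus>\<^bsub>M\<^esub> lcomb V (map ((\<otimes>\<^bsub>K\<^esub>) ?i) cs) bs) = ?u"
      using i dcs w a bsc by (simp add: u lcomb_smult vs.smult_r_distr flip: vs.smult_assoc1)
    moreover have "val V (d \<odot>\<^bsub>M\<^esub> (w \<oplus>\<^bsub>M\<^esub> lcomb V (map ((\<otimes>\<^bsub>K\<^esub>) ?i) cs) bs)) \<le>\<^sub>v val V w"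
      using False i dcs w bsc
      by (subst val_smult) (auto intro!: le lcomb_closed vs.R.m_closed vs.M.a_closed)
    ultimately have uw: "val V ?u \<le>\<^sub>v val V w" by simp
    show ?thesis
    proof (cases "b = w")
      case True
      then show ?thesis using uw by simp
    next
      case nb: False
      then have cb: "(c, b) \<in> set (zip cs bs)" using ks dcs by auto
      have uc: "?u \<in> carrier M" using u a dcs w by simp
      \<comment> \<open>The part over \<open>bs\<close> is the difference of the combination and its
        multiple of \<open>w\<close>, neither of which has smaller value than the combination. Thus
        its value is at least that of the combination, and independence of \<open>bs\<close> bounds
        it from above.\<close>
      have "?a = ?u \<ominus>\<^bsub>M\<^esub> d \<odot>\<^bsub>M\<^esub> w"
        unfolding u using a dcs w by (intro add_diff_cancel'[symmetric]) auto
      moreover have "val V ?u \<le>\<^sub>v val V (?u \<ominus>\<^bsub>M\<^esub> d \<odot>\<^bsub>M\<^esub> w)"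
        using uc dcs w uw by (intro val_diff_ge) (auto simp: val_smult False)
      ultimately have "val V ?u \<le>\<^sub>v val V ?a" by simp
      moreover have "val V ?a \<le>\<^sub>v val V b" by (rule vindepD[OF bs dcs(2,4) cb ks(4)])
      moreover have "b \<in> carrier M" using cb bsc by (auto dest: set_zip_rightD)
      ultimately show ?thesis using uc a by (blast intro: ord.le_trans val_closed)
    qed
  qed
qed

text \<open>The minimum of the values over the nonzero terms is a lower bound for any family and an
  upper bound by independence. In particular the span has only finitely many values.\<close>

lemma val_lcomb_mem:
  assumes bs: "vindep V bs" and ks: "length ks = length bs" "set ks \<subseteq> carrier K"
  shows "val V (lcomb V ks bs) \<in> insert (infty V) (val V ` set bs)"
proof -
  note bsc = vindep_closed[OF bs]
  let ?A = "{(k, b) \<in> set (zip ks bs). k \<noteq> \<zero>\<^bsub>K\<^esub>}"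
  let ?B = "(\<lambda>(k, b). val V b) ` ?A"
  show ?thesis
  proof (cases "?A = {}")
    case True
    have "set ks \<subseteq> {\<zero>\<^bsub>K\<^esub>}"
    proof
      fix k assume "k \<in> set ks"
      then obtain i where i: "i < length ks" "ks ! i = k" by (auto simp: in_set_conv_nth)
      then have "(k, bs ! i) \<in> set (zip ks bs)" using ks by (auto simp: in_set_zip)
      then show "k \<in> {\<zero>\<^bsub>K\<^esub>}" using True by auto
    qed
    then show ?thesis using bsc by (simp add: lcomb_zero)
  next
    case False
    have "finite ?A" by (rule finite_subset[of _ "set (zip ks bs)"]) auto
    moreover have "?B \<subseteq> carrier G"
      using bsc by (auto dest!: set_zip_rightD)
    ultimately obtain m where m: "m \<in> ?B" "\<forall>a\<in>?B. m \<le>\<^sub>v a"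
      using finite_has_min[of ?B] False by blast
    then obtain k b where kb: "(k, b) \<in> set (zip ks bs)" "k \<noteq> \<zero>\<^bsub>K\<^esub>" "m = val V b" by auto
    have b: "b \<in> set bs" using kb by (auto dest: set_zip_rightD)
    have mc: "m \<in> carrier G" using kb b bsc by auto
    have "m \<le>\<^sub>v val V (lcomb V ks bs)"
      using m(2) bsc ks by (intro val_lcomb_ge mc) auto
    moreover have "val V (lcomb V ks bs) \<le>\<^sub>v m"
      using vindepD[OF bs ks kb(1,2)] kb by simp
    ultimately have "val V (lcomb V ks bs) = m"
      using mc bsc ks by (intro ord.le_antisym) auto
    then show ?thesis using kb b by auto
  qed
qed

text \<open>
  A vector outside the span has a best approximation: a value of \<open>v - a\<close> that can be improved is
  attained on the span, where there are only finitely many values.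
\<close>

lemma vindep_approx:
  assumes bs: "vindep V bs" and v: "v \<in> carrier M"
  shows "\<exists>ks. length ks = length bs \<and> set ks \<subseteq> carrier K \<and>
    (v = lcomb V ks bs \<or> vindep V ((v \<ominus>\<^bsub>M\<^esub> lcomb V ks bs) # bs))"
proof -
  note bsc = vindep_closed[OF bs]
  define C where "C = {ks. length ks = length bs \<and> set ks \<subseteq> carrier K}"
  have C0: "replicate (length bs) \<zero>\<^bsub>K\<^esub> \<in> C" by (auto simp: C_def)
  define f where "f ks = val V (v \<ominus>\<^bsub>M\<^esub> lcomb V ks bs)" for ks
  have f: "f ks \<in> carrier G" if "ks \<in> C" for ks
    using that v bsc by (auto simp: f_def C_def)
  have sub: "\<exists>cs\<in>C. lcomb V cs bs = lcomb V ks bs \<ominus>\<^bsub>M\<^esub> lcomb V ls bs"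
    if "ks \<in> C" "ls \<in> C" for ks ls
  proof -
    have ls': "set (map (\<lambda>k. \<ominus>\<^bsub>K\<^esub> k) ls) \<subseteq> carrier K" using that by (auto simp: C_def)
    have ks: "set ks \<subseteq> carrier K" using that by (auto simp: C_def)
    have "set (map2 (\<oplus>\<^bsub>K\<^esub>) ks (map (\<lambda>k. \<ominus>\<^bsub>K\<^esub> k) ls)) \<subseteq> carrier K"
      by (rule map2_add_closed[OF ks ls'])
    moreover have "lcomb V (map2 (\<oplus>\<^bsub>K\<^esub>) ks (map (\<lambda>k. \<ominus>\<^bsub>K\<^esub> k) ls)) bs = lcomb V ks bs \<ominus>\<^bsub>M\<^esub> lcomb V ls bs"
      using that ls' bsc by (subst lcomb_add) (auto simp: C_def lcomb_neg vs.M.minus_eq)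
    ultimately show ?thesis
      using that by (intro bexI[of _ "map2 (\<oplus>\<^bsub>K\<^esub>) ks (map (\<lambda>k. \<ominus>\<^bsub>K\<^esub> k) ls)"]) (auto simp: C_def)
  qed
  have "\<exists>ks\<in>C. \<forall>ls\<in>C. f ls \<le>\<^sub>v f ks"
  proof (rule ccontr)
    assume "\<not> ?thesis"
    then have neg: "\<exists>ls\<in>C. \<not> f ls \<le>\<^sub>v f ks" if "ks \<in> C" for ks
      using that by auto
    have ex: "\<exists>ls\<in>C. f ks <\<^sub>v f ls" if "ks \<in> C" for ks
      using neg[OF that] not_lt_iff[OF f[OF that] f] by auto
    have "f ` C \<subseteq> insert (infty V) (val V ` set bs)"
    proof clarify
      fix ks assume ks: "ks \<in> C" and nb: "f ks \<notin> val V ` set bs"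
      obtain ls where ls: "ls \<in> C" "f ks <\<^sub>v f ls" using ex[OF ks] by auto
      have "f ks = val V (v \<ominus>\<^bsub>M\<^esub> lcomb V ks bs \<ominus>\<^bsub>M\<^esub> (v \<ominus>\<^bsub>M\<^esub> lcomb V ls bs))"
        using ls ks v bsc unfolding f_def by (intro val_diff_eq[symmetric]) (auto simp: C_def)
      also have "v \<ominus>\<^bsub>M\<^esub> lcomb V ks bs \<ominus>\<^bsub>M\<^esub> (v \<ominus>\<^bsub>M\<^esub> lcomb V ls bs) = lcomb V ls bs \<ominus>\<^bsub>M\<^esub> lcomb V ks bs"
        using ls ks v bsc by (intro diff_diff_eq) (auto simp: C_def)
      also obtain cs where "lcomb V ls bs \<ominus>\<^bsub>M\<^esub> lcomb V ks bs = lcomb V cs bs" and cs: "cs \<in> C"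
        using sub[OF ls(1) ks] by metis
      note this(1)
      finally have "f ks \<in> insert (infty V) (val V ` set bs)"
        using val_lcomb_mem[OF bs, of cs] cs by (simp add: C_def)
      then show "f ks = infty V" using nb by auto
    qed
    then have "finite (f ` C)" by (rule finite_subset) auto
    moreover have "f ` C \<noteq> {}" using C0 by auto
    ultimately obtain m where "m \<in> f ` C" "\<forall>a\<in>f ` C. a \<le>\<^sub>v m"
      using finite_has_max[of "f ` C"] f by auto
    then show False using neg by auto
  qed
  then obtain ks where ks: "ks \<in> C" and max: "\<And>ls. ls \<in> C \<Longrightarrow> f ls \<le>\<^sub>v f ks" by auto
  let ?w = "v \<ominus>\<^bsub>M\<^esub> lcomb V ks bs"
  have a: "lcomb V ks bs \<in> carrier M" using ks bsc by (auto simp: C_def)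
  have "vindep V (?w # bs)" if "v \<noteq> lcomb V ks bs"
  proof (rule vindep_extend[OF bs])
    show "?w \<in> carrier M" "?w \<noteq> \<zero>\<^bsub>M\<^esub>"
      using v a that by (auto simp: diff_eq_zero_iff)
    fix ls assume "length ls = length bs" "set ls \<subseteq> carrier K"
    then have ls: "ls \<in> C" by (simp add: C_def)
    have l: "lcomb V ls bs \<in> carrier M" using ls bsc by (auto simp: C_def)
    \<comment> \<open>Adding an element of the span to the best approximation error yields another
      approximation error, so maximality bounds its value.\<close>
    have "?w \<oplus>\<^bsub>M\<^esub> lcomb V ls bs = v \<ominus>\<^bsub>M\<^esub> (lcomb V ks bs \<ominus>\<^bsub>M\<^esub> lcomb V ls bs)"
      using v a l by (simp add: vs.M.minus_eq vs.M.minus_add vs.M.a_ac)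
    moreover obtain cs where "cs \<in> C" "lcomb V ks bs \<ominus>\<^bsub>M\<^esub> lcomb V ls bs = lcomb V cs bs"
      using sub[OF ks ls] by metis
    ultimately show "val V (?w \<oplus>\<^bsub>M\<^esub> lcomb V ls bs) \<le>\<^sub>v val V ?w"
      using max[of cs] by (simp add: f_def)
  qed
  then show ?thesis using ks by (auto simp: C_def)
qed

text \<open>An analogue of Gram-Schmidt: each new vector lies in the span already, or its best
  approximation error joins the family. Earlier vectors then get coefficient zero at the new
  member.\<close>

lemma vindep_cover:
  assumes "finite A" "A \<subseteq> carrier M"
  shows "\<exists>bs. vindep V bs \<and> (\<forall>x\<in>A. \<exists>ks. length ks = length bs \<and> set ks \<subseteq> carrier K \<and> x = lcomb V ks bs)"
  using assms
proof (induction A rule: finite_induct)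
  case (insert v A)
  then obtain bs where bs: "vindep V bs"
    and A: "\<And>x. x \<in> A \<Longrightarrow> \<exists>ks. length ks = length bs \<and> set ks \<subseteq> carrier K \<and> x = lcomb V ks bs"
    by auto
  note bsc = vindep_closed[OF bs]
  obtain cs where cs: "length cs = length bs" "set cs \<subseteq> carrier K"
    and v: "v = lcomb V cs bs \<or> vindep V ((v \<ominus>\<^bsub>M\<^esub> lcomb V cs bs) # bs)"
    using vindep_approx[OF bs] insert.prems by blast
  show ?case
  proof (cases "v = lcomb V cs bs")
    case True
    then show ?thesis using bs A cs by (intro exI[of _ bs]) auto
  next
    case False
    let ?w = "v \<ominus>\<^bsub>M\<^esub> lcomb V cs bs"
    have w: "?w \<in> carrier M" using insert.prems cs bsc by simp
    have "\<exists>ks. length ks = length (?w # bs) \<and> set ks \<subseteq> carrier K \<and> x = lcomb V ks (?w # bs)" if "x \<in> A" for x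
    proof -
      obtain ks where "length ks = length bs" "set ks \<subseteq> carrier K" "x = lcomb V ks bs" using A[OF \<open>x \<in> A\<close>] by auto
      then show ?thesis using w bsc by (intro exI[of _ "\<zero>\<^bsub>K\<^esub> # ks"]) auto
    qed
    moreover have "v = lcomb V (\<one>\<^bsub>K\<^esub> # cs) (?w # bs)"
      using insert.prems cs bsc w by (simp add: diff_add_cancel)
    then have "\<exists>ks. length ks = length (?w # bs) \<and> set ks \<subseteq> carrier K \<and> v = lcomb V ks (?w # bs)"
      using cs by (intro exI[of _ "\<one>\<^bsub>K\<^esub> # cs"]) auto
    ultimately show ?thesis using v False by (intro exI[of _ "?w # bs"]) blast
  qed
qed (auto intro: exI[of _ "[]"])

end


section \<open>Dimensions of the graded pieces\<close>

text \<open>An independent set whose size is the dimension is a basis, and conversely a finite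
  spanning independent set witnesses both finite dimension and its value.\<close>

lemma (in vectorspace) fin_dim_card_iff_span:
  assumes "finite S" "S \<subseteq> carrier V" "lin_indpt S"
  shows "fin_dim \<and> dim = card S \<longleftrightarrow> span S = carrier V"
proof
  assume "fin_dim \<and> dim = card S"
  then have "basis S" using assms by (intro dim_li_is_basis) auto
  then show "span S = carrier V" by (simp add: basis_def)
next
  assume "span S = carrier V"
  then have "basis S" "fin_dim" using assms by (auto simp: basis_def fin_dim_def)
  then show "fin_dim \<and> dim = card S" using dim_basis[OF assms(1)] by simp
qed

context valued_vector_space
begin

section \<open>Balls as subspaces\<close>

lemma closed_ballD: "x \<in> closed_ball V \<gamma> \<Longrightarrow> x \<in> carrier M" "x \<in> closed_ball V \<gamma> \<Longrightarrow> \<gamma> \<le>\<^sub>v val V x"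
  by (auto simp: closed_ball_def)

lemma open_ball_subset:
  assumes "\<gamma> \<in> carrier G" shows "open_ball V \<gamma> \<subseteq> closed_ball V \<gamma>"
  using assms by (auto simp: open_ball_def closed_ball_def lt_iff infty_last split: if_splits)

lemma open_ball_iff: "\<gamma> \<in> carrier G \<Longrightarrow> \<gamma> \<noteq> infty V \<Longrightarrow> x \<in> open_ball V \<gamma> \<longleftrightarrow> x \<in> carrier M \<and> \<gamma> <\<^sub>v val V x"
  by (auto simp: open_ball_def)

lemma closed_ball_zero: "\<gamma> \<in> carrier G \<Longrightarrow> \<zero>\<^bsub>M\<^esub> \<in> closed_ball V \<gamma>"
  by (simp add: closed_ball_def infty_last)

lemma closed_ball_add:
  "\<gamma> \<in> carrier G \<Longrightarrow> x \<in> closed_ball V \<gamma> \<Longrightarrow> y \<in> closed_ball V \<gamma> \<Longrightarrow> x \<oplus>\<^bsub>M\<^esub> y \<in> closed_ball V \<gamma>"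
  by (auto simp: closed_ball_def intro: val_add_ge)

lemma closed_ball_smult:
  "\<gamma> \<in> carrier G \<Longrightarrow> k \<in> carrier K \<Longrightarrow> x \<in> closed_ball V \<gamma> \<Longrightarrow> k \<odot>\<^bsub>M\<^esub> x \<in> closed_ball V \<gamma>"
  using val_smult_le[of k x] by (auto simp: closed_ball_def intro: ord.le_trans[of \<gamma> "val V x"])

lemma closed_ball_neg: "\<gamma> \<in> carrier G \<Longrightarrow> x \<in> closed_ball V \<gamma> \<Longrightarrow> \<ominus>\<^bsub>M\<^esub> x \<in> closed_ball V \<gamma>"
  by (auto simp: closed_ball_def)

lemma open_ball_zero: "\<gamma> \<in> carrier G \<Longrightarrow> \<zero>\<^bsub>M\<^esub> \<in> open_ball V \<gamma>"
  by (simp add: open_ball_def lt_infty)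

lemma open_ball_add:
  "\<gamma> \<in> carrier G \<Longrightarrow> x \<in> open_ball V \<gamma> \<Longrightarrow> y \<in> open_ball V \<gamma> \<Longrightarrow> x \<oplus>\<^bsub>M\<^esub> y \<in> open_ball V \<gamma>"
  by (auto simp: open_ball_def intro: val_add_gt split: if_splits)

lemma open_ball_smult:
  "\<gamma> \<in> carrier G \<Longrightarrow> k \<in> carrier K \<Longrightarrow> x \<in> open_ball V \<gamma> \<Longrightarrow> k \<odot>\<^bsub>M\<^esub> x \<in> open_ball V \<gamma>"
  using val_smult_le[of k x] by (auto simp: open_ball_def intro: lt_trans[of \<gamma> "val V x"] split: if_splits)

lemma open_ball_neg: "\<gamma> \<in> carrier G \<Longrightarrow> x \<in> open_ball V \<gamma> \<Longrightarrow> \<ominus>\<^bsub>M\<^esub> x \<in> open_ball V \<gamma>"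
  by (auto simp: open_ball_def split: if_splits)

lemma lcomb_closed_ball:
  "\<gamma> \<in> carrier G \<Longrightarrow> set ks \<subseteq> carrier K \<Longrightarrow> set vs \<subseteq> closed_ball V \<gamma> \<Longrightarrow> lcomb V ks vs \<in> closed_ball V \<gamma>"
  by (induction ks vs rule: list_induct2') (auto intro: closed_ball_zero closed_ball_add closed_ball_smult)

section \<open>The quotient of the balls as a vector space of residues\<close>

definition residue :: "'g \<Rightarrow> 'v \<Rightarrow> 'v set" where
  "residue \<gamma> x = (\<lambda>h. h \<oplus>\<^bsub>M\<^esub> x) ` open_ball V \<gamma>"

lemma residue_eq_iff:
  assumes \<gamma>: "\<gamma> \<in> carrier G" and x: "x \<in> closed_ball V \<gamma>" and y: "y \<in> closed_ball V \<gamma>"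
  shows "residue \<gamma> x = residue \<gamma> y \<longleftrightarrow> x \<ominus>\<^bsub>M\<^esub> y \<in> open_ball V \<gamma>"
proof
  note c = closed_ballD(1)[OF x] closed_ballD(1)[OF y]
  note oc = subsetD[OF open_ball_subset[OF \<gamma>], THEN closed_ballD(1)]
  {
    assume "residue \<gamma> x = residue \<gamma> y"
    moreover have "x \<in> residue \<gamma> x"
      using open_ball_zero[OF \<gamma>] c by (auto simp: residue_def intro!: image_eqI[of _ _ "\<zero>\<^bsub>M\<^esub>"])
    ultimately obtain h where "h \<in> open_ball V \<gamma>" "x = h \<oplus>\<^bsub>M\<^esub> y" by (auto simp: residue_def)
    then show "x \<ominus>\<^bsub>M\<^esub> y \<in> open_ball V \<gamma>" using c oc by (simp add: add_diff_cancel)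
  next
    assume h: "x \<ominus>\<^bsub>M\<^esub> y \<in> open_ball V \<gamma>"
    have "g \<oplus>\<^bsub>M\<^esub> x = (g \<oplus>\<^bsub>M\<^esub> (x \<ominus>\<^bsub>M\<^esub> y)) \<oplus>\<^bsub>M\<^esub> y" if "g \<in> open_ball V \<gamma>" for g
      using c oc[OF that] by (simp add: vs.M.a_assoc diff_add_cancel)
    moreover have "g \<oplus>\<^bsub>M\<^esub> y = (g \<oplus>\<^bsub>M\<^esub> \<ominus>\<^bsub>M\<^esub> (x \<ominus>\<^bsub>M\<^esub> y)) \<oplus>\<^bsub>M\<^esub> x" if "g \<in> open_ball V \<gamma>" for g
    proof -
      have "\<ominus>\<^bsub>M\<^esub> (x \<ominus>\<^bsub>M\<^esub> y) = y \<ominus>\<^bsub>M\<^esub> x"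
        using c by (simp add: vs.M.minus_eq vs.M.minus_add vs.M.a_comm)
      then show ?thesis using c oc[OF that] by (simp add: vs.M.a_assoc diff_add_cancel)
    qed
    ultimately show "residue \<gamma> x = residue \<gamma> y"
      unfolding residue_def using open_ball_add[OF \<gamma> _ h] open_ball_add[OF \<gamma> _ open_ball_neg[OF \<gamma> h]]
      by (intro equalityI subsetI; elim imageE) (blast intro: image_eqI)+
  }
qed

lemma residue_zero: "\<gamma> \<in> carrier G \<Longrightarrow> residue \<gamma> \<zero>\<^bsub>M\<^esub> = open_ball V \<gamma>"
  using open_ball_subset[of \<gamma>] closed_ballD(1) by (force simp: residue_def)

lemma carrier_ball_quot: "carrier (ball_quot V \<gamma>) = residue \<gamma> ` closed_ball V \<gamma>"
  by (auto simp: ball_quot_def quot_module_def residue_def A_RCOSETS_def' a_r_coset_def')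

lemma zero_ball_quot: "\<gamma> \<in> carrier G \<Longrightarrow> \<zero>\<^bsub>ball_quot V \<gamma>\<^esub> = residue \<gamma> \<zero>\<^bsub>M\<^esub>"
  by (simp add: ball_quot_def quot_module_def residue_zero)

lemma add_ball_quot:
  assumes \<gamma>: "\<gamma> \<in> carrier G" and x: "x \<in> closed_ball V \<gamma>" and y: "y \<in> closed_ball V \<gamma>"
  shows "residue \<gamma> x \<oplus>\<^bsub>ball_quot V \<gamma>\<^esub> residue \<gamma> y = residue \<gamma> (x \<oplus>\<^bsub>M\<^esub> y)"
proof -
  note c = closed_ballD(1)[OF x] closed_ballD(1)[OF y]
  note oc = subsetD[OF open_ball_subset[OF \<gamma>], THEN closed_ballD(1)]
  have "residue \<gamma> x \<oplus>\<^bsub>ball_quot V \<gamma>\<^esub> residue \<gamma> y =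
      {(g \<oplus>\<^bsub>M\<^esub> x) \<oplus>\<^bsub>M\<^esub> (h \<oplus>\<^bsub>M\<^esub> y) | g h. g \<in> open_ball V \<gamma> \<and> h \<in> open_ball V \<gamma>}"
    by (auto simp: ball_quot_def quot_module_def residue_def set_add_def')
  also have "\<dots> = {(g \<oplus>\<^bsub>M\<^esub> h) \<oplus>\<^bsub>M\<^esub> (x \<oplus>\<^bsub>M\<^esub> y) | g h. g \<in> open_ball V \<gamma> \<and> h \<in> open_ball V \<gamma>}"
  proof -
    have "(g \<oplus>\<^bsub>M\<^esub> x) \<oplus>\<^bsub>M\<^esub> (h \<oplus>\<^bsub>M\<^esub> y) = (g \<oplus>\<^bsub>M\<^esub> h) \<oplus>\<^bsub>M\<^esub> (x \<oplus>\<^bsub>M\<^esub> y)"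
      if "g \<in> open_ball V \<gamma>" "h \<in> open_ball V \<gamma>" for g h
      using c oc[OF that(1)] oc[OF that(2)] by (simp add: vs.M.a_ac)
    then show ?thesis by (metis (no_types, lifting))
  qed
  also have "\<dots> = residue \<gamma> (x \<oplus>\<^bsub>M\<^esub> y)"
  proof (intro equalityI subsetI)
    fix z assume "z \<in> {(g \<oplus>\<^bsub>M\<^esub> h) \<oplus>\<^bsub>M\<^esub> (x \<oplus>\<^bsub>M\<^esub> y) | g h. g \<in> open_ball V \<gamma> \<and> h \<in> open_ball V \<gamma>}"
    then show "z \<in> residue \<gamma> (x \<oplus>\<^bsub>M\<^esub> y)"
      using open_ball_add[OF \<gamma>] by (auto simp: residue_def)
  next
    fix z assume "z \<in> residue \<gamma> (x \<oplus>\<^bsub>M\<^esub> y)"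
    then obtain g where g: "g \<in> open_ball V \<gamma>" "z = g \<oplus>\<^bsub>M\<^esub> (x \<oplus>\<^bsub>M\<^esub> y)" by (auto simp: residue_def)
    then have "z = (g \<oplus>\<^bsub>M\<^esub> \<zero>\<^bsub>M\<^esub>) \<oplus>\<^bsub>M\<^esub> (x \<oplus>\<^bsub>M\<^esub> y)" using oc by simp
    then show "z \<in> {(g \<oplus>\<^bsub>M\<^esub> h) \<oplus>\<^bsub>M\<^esub> (x \<oplus>\<^bsub>M\<^esub> y) | g h. g \<in> open_ball V \<gamma> \<and> h \<in> open_ball V \<gamma>}"
      using g open_ball_zero[OF \<gamma>] by blast
  qed
  finally show ?thesis .
qed

text \<open>The scalar multiple in the quotient is a union over all representatives. Two
  representatives differ by an element of the open ball, which is closed under scalars, so every set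
  in this union is the same residue class.\<close>

lemma smult_ball_quot:
  assumes \<gamma>: "\<gamma> \<in> carrier G" and k: "k \<in> carrier K" and x: "x \<in> closed_ball V \<gamma>"
  shows "k \<odot>\<^bsub>ball_quot V \<gamma>\<^esub> residue \<gamma> x = residue \<gamma> (k \<odot>\<^bsub>M\<^esub> x)"
proof -
  note c = closed_ballD(1)[OF x]
  note oc = subsetD[OF open_ball_subset[OF \<gamma>]]
  have "residue \<gamma> (k \<odot>\<^bsub>M\<^esub> (h \<oplus>\<^bsub>M\<^esub> x)) = residue \<gamma> (k \<odot>\<^bsub>M\<^esub> x)" if h: "h \<in> open_ball V \<gamma>" for h
  proof -
    have hx: "h \<in> closed_ball V \<gamma>" "h \<in> carrier M" using oc[OF h] closed_ballD by auto
    have "k \<odot>\<^bsub>M\<^esub> (h \<oplus>\<^bsub>M\<^esub> x) \<ominus>\<^bsub>M\<^esub> k \<odot>\<^bsub>M\<^esub> x = k \<odot>\<^bsub>M\<^esub> h"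
      using hx c k by (simp add: vs.smult_r_distr add_diff_cancel)
    then show ?thesis
      using open_ball_smult[OF \<gamma> k h] closed_ball_smult[OF \<gamma> k] closed_ball_add[OF \<gamma> hx(1) x] x
      by (subst residue_eq_iff[OF \<gamma>]) auto
  qed
  then have "(\<Union>a\<in>residue \<gamma> x. residue \<gamma> (k \<odot>\<^bsub>M\<^esub> a)) = residue \<gamma> (k \<odot>\<^bsub>M\<^esub> x)"
    using open_ball_zero[OF \<gamma>] by (auto simp: residue_def)
  moreover have "open_ball V \<gamma> +>\<^bsub>M\<lparr>carrier := closed_ball V \<gamma>\<rparr>\<^esub> y = residue \<gamma> y" for y
    by (auto simp: residue_def a_r_coset_def')
  ultimately show ?thesis by (simp add: ball_quot_def quot_module_def)
qed

lemma vectorspace_ball_quot: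
  assumes \<gamma>: "\<gamma> \<in> carrier G"
  shows "vectorspace K (ball_quot V \<gamma>)"
proof -
  note simps = carrier_ball_quot zero_ball_quot[OF \<gamma>] add_ball_quot[OF \<gamma>] smult_ball_quot[OF \<gamma>]
    closed_ball_zero[OF \<gamma>] closed_ball_add[OF \<gamma>] closed_ball_smult[OF \<gamma>] closed_ball_neg[OF \<gamma>]
  note c = closed_ballD(1)
  have "module K (ball_quot V \<gamma>)"
  proof (rule module_criteria)
    show "\<forall>v\<in>carrier (ball_quot V \<gamma>). \<exists>w\<in>carrier (ball_quot V \<gamma>). v \<oplus>\<^bsub>ball_quot V \<gamma>\<^esub> w = \<zero>\<^bsub>ball_quot V \<gamma>\<^esub>"
    proof
      fix v assume "v \<in> carrier (ball_quot V \<gamma>)"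
      then obtain x where x: "x \<in> closed_ball V \<gamma>" "v = residue \<gamma> x" by (auto simp: carrier_ball_quot)
      then have "v \<oplus>\<^bsub>ball_quot V \<gamma>\<^esub> residue \<gamma> (\<ominus>\<^bsub>M\<^esub> x) = \<zero>\<^bsub>ball_quot V \<gamma>\<^esub>"
        using c[of x] by (simp add: simps vs.M.r_neg)
      then show "\<exists>w\<in>carrier (ball_quot V \<gamma>). v \<oplus>\<^bsub>ball_quot V \<gamma>\<^esub> w = \<zero>\<^bsub>ball_quot V \<gamma>\<^esub>"
        using x by (auto simp: carrier_ball_quot intro: simps)
    qed
  qed (use c in \<open>auto simp: simps vs.M.a_ac vs.smult_assoc1 vs.smult_l_distr vs.smult_r_distr vs.R.is_cring\<close>)
  then show ?thesis
    using vs.field_axioms by (simp add: vectorspace_def)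
qed

section \<open>Residual independence and dimension\<close>

lemma rindepD:
  "rindep V \<gamma> vs \<Longrightarrow> length ks = length vs \<Longrightarrow> set ks \<subseteq> carrier K \<Longrightarrow> lcomb V ks vs \<in> open_ball V \<gamma> \<Longrightarrow>
    set ks \<subseteq> {\<zero>\<^bsub>K\<^esub>}"
  unfolding rindep_def by blast

lemma rindep_closed: "rindep V \<gamma> vs \<Longrightarrow> set vs \<subseteq> closed_ball V \<gamma>"
  by (simp add: rindep_def)

lemma rindep_Nil [simp]: "rindep V \<gamma> []"
  by (simp add: rindep_def)

text \<open>A relation modulo the open ball with nonzero coefficient at \<open>w\<close> can be
  divided by that coefficient, which expresses \<open>w\<close> through \<open>vs\<close>; without
  such a relation, every relation is one among \<open>vs\<close> alone.\<close>

lemma rindep_Cons_iff: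
  assumes \<gamma>: "\<gamma> \<in> carrier G"
  shows "rindep V \<gamma> (w # vs) \<longleftrightarrow> rindep V \<gamma> vs \<and> w \<in> closed_ball V \<gamma> \<and>
    \<not> (\<exists>ks. length ks = length vs \<and> set ks \<subseteq> carrier K \<and> w \<ominus>\<^bsub>M\<^esub> lcomb V ks vs \<in> open_ball V \<gamma>)"
proof
  assume r: "rindep V \<gamma> (w # vs)"
  then have wv: "w \<in> closed_ball V \<gamma>" "set vs \<subseteq> closed_ball V \<gamma>" using rindep_closed[OF r] by auto
  then have c: "w \<in> carrier M" "set vs \<subseteq> carrier M" using closed_ballD by auto
  have "rindep V \<gamma> vs"
    unfolding rindep_def
  proof (intro conjI allI impI wv, elim conjE)
    fix ks assume "length ks = length vs" "set ks \<subseteq> carrier K" "lcomb V ks vs \<in> open_ball V \<gamma>"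
    then show "set ks \<subseteq> {\<zero>\<^bsub>K\<^esub>}"
      using rindepD[OF r, of "\<zero>\<^bsub>K\<^esub> # ks"] c by simp
  qed
  moreover have False
    if "length ks = length vs" "set ks \<subseteq> carrier K" "w \<ominus>\<^bsub>M\<^esub> lcomb V ks vs \<in> open_ball V \<gamma>" for ks
  proof -
    have "lcomb V (map (\<lambda>k. \<ominus>\<^bsub>K\<^esub> k) ks) vs = \<ominus>\<^bsub>M\<^esub> lcomb V ks vs"
      using that c by (intro lcomb_neg) auto
    then have "lcomb V (\<one>\<^bsub>K\<^esub> # map (\<lambda>k. \<ominus>\<^bsub>K\<^esub> k) ks) (w # vs) \<in> open_ball V \<gamma>"
      using that c by (simp add: vs.M.minus_eq)
    then have "\<one>\<^bsub>K\<^esub> = \<zero>\<^bsub>K\<^esub>"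
      using rindepD[OF r, of "\<one>\<^bsub>K\<^esub> # map (\<lambda>k. \<ominus>\<^bsub>K\<^esub> k) ks"] that by auto
    then show False by simp
  qed
  ultimately show "rindep V \<gamma> vs \<and> w \<in> closed_ball V \<gamma> \<and>
      \<not> (\<exists>ks. length ks = length vs \<and> set ks \<subseteq> carrier K \<and> w \<ominus>\<^bsub>M\<^esub> lcomb V ks vs \<in> open_ball V \<gamma>)"
    using wv by blast
next
  assume *: "rindep V \<gamma> vs \<and> w \<in> closed_ball V \<gamma> \<and>
      \<not> (\<exists>ks. length ks = length vs \<and> set ks \<subseteq> carrier K \<and> w \<ominus>\<^bsub>M\<^esub> lcomb V ks vs \<in> open_ball V \<gamma>)"
  then have wv: "set (w # vs) \<subseteq> closed_ball V \<gamma>" and r: "rindep V \<gamma> vs"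
    and no: "\<And>ks. length ks = length vs \<Longrightarrow> set ks \<subseteq> carrier K \<Longrightarrow> w \<ominus>\<^bsub>M\<^esub> lcomb V ks vs \<notin> open_ball V \<gamma>"
    using rindep_closed by auto
  then have c: "w \<in> carrier M" "set vs \<subseteq> carrier M" using closed_ballD by auto
  show "rindep V \<gamma> (w # vs)"
    unfolding rindep_def
  proof (intro conjI allI impI wv, elim conjE)
    fix ks assume ks: "length ks = length (w # vs)" "set ks \<subseteq> carrier K" "lcomb V ks (w # vs) \<in> open_ball V \<gamma>"
    then obtain d cs where dcs: "ks = d # cs" "length cs = length vs" "d \<in> carrier K" "set cs \<subseteq> carrier K"
      by (auto simp: length_Suc_conv)
    have d: "d = \<zero>\<^bsub>K\<^esub>"
    proof (rule ccontr)
      assume "d \<noteq> \<zero>\<^bsub>K\<^esub>"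
      then have i: "inv\<^bsub>K\<^esub> d \<in> carrier K" "inv\<^bsub>K\<^esub> d \<otimes>\<^bsub>K\<^esub> d = \<one>\<^bsub>K\<^esub>"
        using dcs vs.field_Units by auto
      \<comment> \<open>The sign and the inverse come from solving \<open>d w + \<Sum> c v\<close>
        for \<open>w\<close>: multiplied by the inverse of \<open>d\<close>, it is \<open>w\<close>
        minus the combination with coefficients \<open>- c / d\<close>.\<close>
      let ?cs = "map ((\<otimes>\<^bsub>K\<^esub>) (\<ominus>\<^bsub>K\<^esub> (inv\<^bsub>K\<^esub> d))) cs"
      have "inv\<^bsub>K\<^esub> d \<odot>\<^bsub>M\<^esub> lcomb V ks (w # vs) \<in> open_ball V \<gamma>"
        using open_ball_smult[OF \<gamma> i(1) ks(3)] .
      moreover have "inv\<^bsub>K\<^esub> d \<odot>\<^bsub>M\<^esub> lcomb V ks (w # vs) = w \<ominus>\<^bsub>M\<^esub> lcomb V ?cs vs"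
        using dcs i c by (simp add: lcomb_smult vs.smult_r_distr vs.smult_l_minus vs.M.minus_eq flip: vs.smult_assoc1)
      moreover have "set ?cs \<subseteq> carrier K" using i dcs by auto
      ultimately show False using no[of ?cs] dcs by simp
    qed
    then have "set cs \<subseteq> {\<zero>\<^bsub>K\<^esub>}"
      using rindepD[OF r dcs(2,4)] ks(3) dcs c by simp
    then show "set ks \<subseteq> {\<zero>\<^bsub>K\<^esub>}" using d dcs by simp
  qed
qed

text \<open>The residues of list combinations form a submodule containing the generators, and each
  of them lies in the span. Hence they are the span, and membership becomes a statement about
  coefficient lists.\<close>

lemma residue_in_span_iff:
  assumes \<gamma>: "\<gamma> \<in> carrier G" and x: "x \<in> closed_ball V \<gamma>" and vs: "set vs \<subseteq> closed_ball V \<gamma>"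
  shows "residue \<gamma> x \<in> module.span K (ball_quot V \<gamma>) (residue \<gamma> ` set vs) \<longleftrightarrow>
    (\<exists>ks. length ks = length vs \<and> set ks \<subseteq> carrier K \<and> x \<ominus>\<^bsub>M\<^esub> lcomb V ks vs \<in> open_ball V \<gamma>)"
proof -
  interpret Q: vectorspace K "ball_quot V \<gamma>" by (rule vectorspace_ball_quot[OF \<gamma>])
  have c: "set vs \<subseteq> carrier M" using vs closed_ballD by auto
  define N where "N = {residue \<gamma> (lcomb V ks vs) | ks. length ks = length vs \<and> set ks \<subseteq> carrier K}"
  have S: "residue \<gamma> ` set vs \<subseteq> carrier (ball_quot V \<gamma>)" using vs by (auto simp: carrier_ball_quot)
  have "submodule K N (ball_quot V \<gamma>)"
  proof
    show "N \<subseteq> carrier (ball_quot V \<gamma>)"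
      using lcomb_closed_ball[OF \<gamma> _ vs] by (auto simp: N_def carrier_ball_quot)
    show "\<zero>\<^bsub>ball_quot V \<gamma>\<^esub> \<in> N"
    proof -
      have "lcomb V (replicate (length vs) \<zero>\<^bsub>K\<^esub>) vs = \<zero>\<^bsub>M\<^esub>" using c by (intro lcomb_zero) auto
      then show ?thesis
        unfolding N_def zero_ball_quot[OF \<gamma>]
        by (intro CollectI exI[of _ "replicate (length vs) \<zero>\<^bsub>K\<^esub>"]) auto
    qed
  next
    fix v w assume "v \<in> N" "w \<in> N"
    then obtain ks ls where *: "v = residue \<gamma> (lcomb V ks vs)" "length ks = length vs" "set ks \<subseteq> carrier K"
        "w = residue \<gamma> (lcomb V ls vs)" "length ls = length vs" "set ls \<subseteq> carrier K"
      by (auto simp: N_def)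
    then have "v \<oplus>\<^bsub>ball_quot V \<gamma>\<^esub> w = residue \<gamma> (lcomb V (map2 (\<oplus>\<^bsub>K\<^esub>) ks ls) vs)"
      using c by (simp add: add_ball_quot[OF \<gamma>] lcomb_closed_ball[OF \<gamma> _ vs] lcomb_add)
    then show "v \<oplus>\<^bsub>ball_quot V \<gamma>\<^esub> w \<in> N"
      using * map2_add_closed[of ks ls] unfolding N_def
      by (intro CollectI exI[of _ "map2 (\<oplus>\<^bsub>K\<^esub>) ks ls"]) auto
  next
    fix k v assume k: "k \<in> carrier K" and "v \<in> N"
    then obtain ks where *: "v = residue \<gamma> (lcomb V ks vs)" "length ks = length vs" "set ks \<subseteq> carrier K"
      by (auto simp: N_def)
    then have "k \<odot>\<^bsub>ball_quot V \<gamma>\<^esub> v = residue \<gamma> (lcomb V (map ((\<otimes>\<^bsub>K\<^esub>) k) ks) vs)"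
      using c k by (simp add: smult_ball_quot[OF \<gamma>] lcomb_closed_ball[OF \<gamma> _ vs] lcomb_smult)
    then show "k \<odot>\<^bsub>ball_quot V \<gamma>\<^esub> v \<in> N"
      using * k unfolding N_def by (intro CollectI exI[of _ "map ((\<otimes>\<^bsub>K\<^esub>) k) ks"]) auto
  qed
  moreover have "residue \<gamma> ` set vs \<subseteq> N"
  proof
    fix y assume "y \<in> residue \<gamma> ` set vs"
    then obtain v where "v \<in> set vs" "y = residue \<gamma> v" by auto
    then show "y \<in> N" using lcomb_unit[OF _ c, of v] by (auto simp: N_def)
  qed
  ultimately have "Q.span (residue \<gamma> ` set vs) \<subseteq> N" by (intro Q.span_is_subset) auto
  \<comment> \<open>The second list is any list with entries from \<open>vs\<close>, while the span
    stays that of all of \<open>vs\<close>; otherwise the induction would shrink the span along with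
    the list.\<close>
  moreover have "residue \<gamma> (lcomb V ks us) \<in> Q.span (residue \<gamma> ` set vs)"
    if "set ks \<subseteq> carrier K" "set us \<subseteq> set vs" for ks us
    using that
  proof (induction ks us rule: list_induct2')
    case (4 k ks u us)
    have *: "k \<odot>\<^bsub>M\<^esub> u \<in> closed_ball V \<gamma>" "lcomb V ks us \<in> closed_ball V \<gamma>" "u \<in> closed_ball V \<gamma>"
      using 4 vs by (auto intro!: closed_ball_smult lcomb_closed_ball \<gamma>)
    have sub: "submodule K (Q.span (residue \<gamma> ` set vs)) (ball_quot V \<gamma>)"
      by (rule Q.span_is_submodule[OF S])
    have "residue \<gamma> u \<in> Q.span (residue \<gamma> ` set vs)"
      using Q.in_own_span[OF S] 4 by auto
    then have "k \<odot>\<^bsub>ball_quot V \<gamma>\<^esub> residue \<gamma> u \<oplus>\<^bsub>ball_quot V \<gamma>\<^esub> residue \<gamma> (lcomb V ks us) \<in> Q.span (residue \<gamma> ` set vs)"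
      using 4 by (intro submodule.m_closed[OF sub] submodule.smult_closed[OF sub]) auto
    then show ?case using * 4 by (simp add: add_ball_quot[OF \<gamma>] smult_ball_quot[OF \<gamma>])
  qed (use Q.span_zero[of "residue \<gamma> ` set vs"] in \<open>auto simp: zero_ball_quot[OF \<gamma>]\<close>)
  then have "N \<subseteq> Q.span (residue \<gamma> ` set vs)" by (auto simp: N_def)
  ultimately have "Q.span (residue \<gamma> ` set vs) = N" by blast
  moreover have "residue \<gamma> x \<in> N \<longleftrightarrow>
      (\<exists>ks. length ks = length vs \<and> set ks \<subseteq> carrier K \<and> residue \<gamma> x = residue \<gamma> (lcomb V ks vs))"
    by (auto simp: N_def)
  moreover have "residue \<gamma> x = residue \<gamma> (lcomb V ks vs) \<longleftrightarrow> x \<ominus>\<^bsub>M\<^esub> lcomb V ks vs \<in> open_ball V \<gamma>"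
    if "set ks \<subseteq> carrier K" for ks
    by (rule residue_eq_iff[OF \<gamma> x lcomb_closed_ball[OF \<gamma> that vs]])
  ultimately show ?thesis by auto
qed

text \<open>Translates lists into sets of residues. The equality of cardinalities says that the
  residues are distinct, so that the length of the list is the number to be compared with the
  dimension.\<close>

lemma rindep_imp_lin_indpt:
  assumes \<gamma>: "\<gamma> \<in> carrier G" and "rindep V \<gamma> vs"
  shows "card (residue \<gamma> ` set vs) = length vs \<and> \<not> module.lin_dep K (ball_quot V \<gamma>) (residue \<gamma> ` set vs)"
  using assms(2)
proof (induction vs)
  interpret Q: vectorspace K "ball_quot V \<gamma>" by (rule vectorspace_ball_quot[OF \<gamma>])
  {
    case Nil
    show ?case by (auto simp: Q.lin_dep_def)
  next
    case (Cons w vs)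
    let ?S = "residue \<gamma> ` set vs"
    have r: "rindep V \<gamma> vs" "w \<in> closed_ball V \<gamma>" and vs: "set vs \<subseteq> closed_ball V \<gamma>"
      using Cons.prems rindep_closed by (auto simp: rindep_Cons_iff[OF \<gamma>])
    have S: "?S \<subseteq> carrier (ball_quot V \<gamma>)" using vs by (auto simp: carrier_ball_quot)
    have nin: "residue \<gamma> w \<notin> Q.span ?S"
      using Cons.prems unfolding residue_in_span_iff[OF \<gamma> r(2) vs] rindep_Cons_iff[OF \<gamma>] by blast
    then have "residue \<gamma> w \<notin> ?S" using Q.in_own_span[OF S] by auto
    moreover from this have "\<not> Q.lin_dep (?S \<union> {residue \<gamma> w})"
      using nin Q.lin_dep_iff_in_span[OF S] Cons.IH[OF r(1)] r(2) by (auto simp: carrier_ball_quot)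
    ultimately show ?case using Cons.IH[OF r(1)] by simp
  }
qed

text \<open>An independent family has as many members as the dimension exactly if it spans, that is,
  if no residue outside its span is left to extend it. This turns colours into an extension
  property. At \<infinity> both balls are zero, so that the empty family is maximal there.\<close>

lemma dim_colour_iff_maximal:
  assumes \<gamma>: "\<gamma> \<in> carrier G" and r: "rindep V \<gamma> vs"
  shows "\<gamma> \<in> dim_colour V (length vs) \<longleftrightarrow> \<not> (\<exists>w. rindep V \<gamma> (w # vs))"
proof -
  interpret Q: vectorspace K "ball_quot V \<gamma>" by (rule vectorspace_ball_quot[OF \<gamma>])
  let ?S = "residue \<gamma> ` set vs"
  note vs = rindep_closed[OF r]
  have S: "?S \<subseteq> carrier (ball_quot V \<gamma>)" using vs by (auto simp: carrier_ball_quot)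
  have "\<gamma> \<in> dim_colour V (length vs) \<longleftrightarrow> Q.fin_dim \<and> Q.dim = card ?S"
    using \<gamma> rindep_imp_lin_indpt[OF \<gamma> r] by (simp add: dim_colour_def)
  also have "\<dots> \<longleftrightarrow> Q.span ?S = carrier (ball_quot V \<gamma>)"
    using rindep_imp_lin_indpt[OF \<gamma> r] S by (intro Q.fin_dim_card_iff_span) auto
  also have "\<dots> \<longleftrightarrow> (\<forall>w\<in>closed_ball V \<gamma>. residue \<gamma> w \<in> Q.span ?S)"
    using Q.span_is_subset2[OF S] by (auto simp: carrier_ball_quot)
  also have "\<dots> \<longleftrightarrow> \<not> (\<exists>w. rindep V \<gamma> (w # vs))"
  proof -
    have "residue \<gamma> w \<in> Q.span ?S \<longleftrightarrow> \<not> rindep V \<gamma> (w # vs)" if "w \<in> closed_ball V \<gamma>" for w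
      using r that unfolding rindep_Cons_iff[OF \<gamma>] residue_in_span_iff[OF \<gamma> that vs] by blast
    moreover have "w \<in> closed_ball V \<gamma>" if "rindep V \<gamma> (w # vs)" for w
      using rindep_closed[OF that] by simp
    ultimately show ?thesis by blast
  qed
  finally show ?thesis .
qed

lemma dim_colour_unique: "\<gamma> \<in> dim_colour V m \<Longrightarrow> \<gamma> \<in> dim_colour V n \<Longrightarrow> m = n"
  by (simp add: dim_colour_def)

text \<open>The form of a colour that can be written with the \<open>W_n\<close>. If \<gamma> has
  colour \<open>n\<close>, a family of length other than \<open>n\<close> is not maximal because the
  colour is unique; growth from the empty list thus reaches length \<open>n\<close>, where it
  stops.\<close>

lemma dim_colour_iff_rindep:
  assumes \<gamma>: "\<gamma> \<in> carrier G"
  shows "\<gamma> \<in> dim_colour V n \<longleftrightarrow>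
    (\<exists>vs. length vs = n \<and> rindep V \<gamma> vs) \<and> \<not> (\<exists>vs. length vs = Suc n \<and> rindep V \<gamma> vs)"
proof
  assume n: "\<gamma> \<in> dim_colour V n"
  have "\<exists>vs. length vs = r \<and> rindep V \<gamma> vs" if "r \<le> n" for r
    using that
  proof (induction r)
    case (Suc r)
    then obtain vs where vs: "length vs = r" "rindep V \<gamma> vs" by auto
    have "\<gamma> \<notin> dim_colour V r" using Suc.prems n dim_colour_unique[of \<gamma> r n] by auto
    then obtain w where "rindep V \<gamma> (w # vs)" using dim_colour_iff_maximal[OF \<gamma> vs(2)] vs(1) by auto
    then show ?case using vs by (intro exI[of _ "w # vs"]) auto
  qed auto
  moreover have False if "length vs = Suc n" "rindep V \<gamma> vs" for vs
  proof -
    obtain w ws where ws: "vs = w # ws" "length ws = n" using \<open>length vs = Suc n\<close> by (auto simp: length_Suc_conv)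
    have "rindep V \<gamma> ws" using that ws by (auto simp: rindep_Cons_iff[OF \<gamma>])
    then show False using dim_colour_iff_maximal[OF \<gamma>, of ws] n ws that by auto
  qed
  ultimately show "(\<exists>vs. length vs = n \<and> rindep V \<gamma> vs) \<and> \<not> (\<exists>vs. length vs = Suc n \<and> rindep V \<gamma> vs)"
    by blast
next
  assume "(\<exists>vs. length vs = n \<and> rindep V \<gamma> vs) \<and> \<not> (\<exists>vs. length vs = Suc n \<and> rindep V \<gamma> vs)"
  then obtain vs where vs: "length vs = n" "rindep V \<gamma> vs" and no: "\<And>us. length us = Suc n \<Longrightarrow> \<not> rindep V \<gamma> us"
    by auto
  then have "\<not> rindep V \<gamma> (w # vs)" for w by (intro no) simp
  then show "\<gamma> \<in> dim_colour V n" using dim_colour_iff_maximal[OF \<gamma> vs(2)] vs(1) by auto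
qed

text \<open>A member of larger value, or zero, would be a combination with a coefficient one that
  lies in the open ball. A member at \<gamma> = \<infinity> would be zero as well.\<close>

lemma rindep_val:
  assumes \<gamma>: "\<gamma> \<in> carrier G" and r: "rindep V \<gamma> vs" and v: "v \<in> set vs"
  shows "val V v = \<gamma> \<and> v \<noteq> \<zero>\<^bsub>M\<^esub>"
proof -
  have vc: "v \<in> closed_ball V \<gamma>" and c: "set vs \<subseteq> carrier M" using rindep_closed[OF r] v closed_ballD by auto
  obtain ks where "length ks = length vs" "set ks \<subseteq> carrier K" "\<one>\<^bsub>K\<^esub> \<in> set ks" "lcomb V ks vs = v"
    using lcomb_unit[OF v c] by auto
  then have "v \<notin> open_ball V \<gamma>"
    using rindepD[OF r, of ks] vs.zero_not_one by (metis singletonD subsetD)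
  then have "v \<noteq> \<zero>\<^bsub>M\<^esub>" "\<gamma> \<noteq> infty V \<Longrightarrow> \<not> \<gamma> <\<^sub>v val V v"
    using open_ball_zero[OF \<gamma>] vc closed_ballD by (auto simp: open_ball_iff[OF \<gamma>])
  moreover have "\<gamma> \<noteq> infty V"
  proof
    assume "\<gamma> = infty V"
    then have "val V v = infty V"
      using vc closed_ballD[OF vc] by (simp add: ord.le_antisym infty_last infty_closed)
    then show False using \<open>v \<noteq> \<zero>\<^bsub>M\<^esub>\<close> closed_ballD[OF vc] by (simp add: val_eq_infty_iff)
  qed
  ultimately show ?thesis using closed_ballD[OF vc] by (auto simp: lt_iff)
qed

text \<open>The link to the language: for a nonempty list, \<open>W_n\<close> is residual
  independence at the common value of its members. That value is not \<infinity> because the members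
  are nonzero.\<close>

lemma rindep_iff_W_holds:
  assumes \<gamma>: "\<gamma> \<in> carrier G" and c: "set vs \<subseteq> carrier M" and ne: "vs \<noteq> []"
  shows "rindep V \<gamma> vs \<longleftrightarrow> W_holds V vs \<and> val V (hd vs) = \<gamma>"
proof -
  have *: "lin_comb V ks vs = lcomb V ks vs" if "length ks = length vs" "set ks \<subseteq> carrier K" for ks
    using that c by (rule lin_comb_eq_lcomb)
  have hd: "hd vs \<in> set vs" using ne by simp
  show ?thesis
  proof
    assume r: "rindep V \<gamma> vs"
    note val = rindep_val[OF \<gamma> r]
    have "\<gamma> \<noteq> infty V" using val[OF hd] c hd val_eq_infty_iff by auto
    then have "\<forall>k\<in>set ks. k = \<zero>\<^bsub>K\<^esub>"
      if "length ks = length vs" "set ks \<subseteq> carrier K" "val V (hd vs) <\<^sub>v val V (lin_comb V ks vs)" for ks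
      using rindepD[OF r that(1,2)] that * val[OF hd] c by (auto simp: open_ball_iff[OF \<gamma>])
    then show "W_holds V vs \<and> val V (hd vs) = \<gamma>"
      using val hd by (auto simp: W_holds_def)
  next
    assume W: "W_holds V vs \<and> val V (hd vs) = \<gamma>"
    then have "hd vs \<noteq> \<zero>\<^bsub>M\<^esub>" using hd by (auto simp: W_holds_def)
    then have "\<gamma> \<noteq> infty V" using W hd c val_eq_infty_iff[of "hd vs"] by auto
    moreover have "set vs \<subseteq> closed_ball V \<gamma>"
      using W c \<gamma> by (auto simp: W_holds_def closed_ball_def)
    ultimately show "rindep V \<gamma> vs"
      using W * unfolding rindep_def W_holds_def by (auto simp: open_ball_iff[OF \<gamma>])
  qed
qed

text \<open>A combination of members of value \<gamma> with a nonzero coefficient, padded by zeros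
  to the whole family, has value at most \<gamma> and so stays outside the open ball.\<close>

lemma rindep_filter:
  assumes bs: "vindep V bs" and \<gamma>: "\<gamma> \<in> carrier G"
  shows "rindep V \<gamma> (filter (\<lambda>b. val V b = \<gamma>) bs)"
  unfolding rindep_def
proof (intro conjI allI impI, goal_cases)
  case 1
  then show ?case using vindep_closed[OF bs] \<gamma> by (auto simp: closed_ball_def)
next
  case (2 ks)
  note bsc = vindep_closed[OF bs]
  let ?fs = "filter (\<lambda>b. val V b = \<gamma>) bs"
  obtain ls where ls: "length ls = length bs" "set ls \<subseteq> carrier K" "lcomb V ls bs = lcomb V ks ?fs"
      "set (zip ks ?fs) \<subseteq> set (zip ls bs)"
    using lcomb_extend[of ks "\<lambda>b. val V b = \<gamma>" bs] 2 bsc by auto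
  show ?case
  proof (rule ccontr)
    assume "\<not> set ks \<subseteq> {\<zero>\<^bsub>K\<^esub>}"
    then obtain k where "k \<in> set ks" "k \<noteq> \<zero>\<^bsub>K\<^esub>" by blast
    then obtain i where i: "i < length ks" "ks ! i \<noteq> \<zero>\<^bsub>K\<^esub>" by (metis in_set_conv_nth)
    then have z: "(ks ! i, ?fs ! i) \<in> set (zip ks ?fs)" using 2 by (auto simp: in_set_zip)
    then have f: "?fs ! i \<in> set ?fs" by (rule set_zip_rightD)
    then have "val V (?fs ! i) = \<gamma>" "?fs ! i \<in> set bs" by auto
    then have "\<gamma> \<noteq> infty V" using bs bsc val_eq_infty_iff[of "?fs ! i"] by (auto simp: vindep_def)
    moreover have "val V (lcomb V ls bs) \<le>\<^sub>v \<gamma>"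
      using vindepD[OF bs ls(1,2) subsetD[OF ls(4) z] i(2)] \<open>val V (?fs ! i) = \<gamma>\<close> by simp
    moreover have "lcomb V ls bs \<in> open_ball V \<gamma>" using 2 ls(3) by simp
    moreover have "val V (lcomb V ls bs) \<in> carrier G" by (intro val_closed lcomb_closed ls(2) bsc)
    ultimately show False
      using not_lt_iff[OF \<gamma>, of "val V (lcomb V ls bs)"] open_ball_iff[OF \<gamma>] by blast
  qed
qed

text \<open>
  Only the members of \<open>bs\<close> with the value of \<open>w\<close> matter: in a combination of larger value the terms
  below \<open>val w\<close> vanish and those above it are negligible.
\<close>

lemma vindep_Cons:
  assumes bs: "vindep V bs" and w: "w \<in> carrier M" "w \<noteq> \<zero>\<^bsub>M\<^esub>"
    and r: "rindep V (val V w) (w # filter (\<lambda>b. val V b = val V w) bs)"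
  shows "vindep V (w # bs)"
proof (rule vindep_extend[OF bs w])
  fix ks assume ks: "length ks = length bs" "set ks \<subseteq> carrier K"
  note bsc = vindep_closed[OF bs]
  let ?P = "\<lambda>b. val V b = val V w"
  let ?a = "lcomb V ks bs"
  have a: "?a \<in> carrier M" using ks bsc by simp
  have fin: "val V w \<noteq> infty V" using w by (simp add: val_eq_infty_iff)
  show "val V (w \<oplus>\<^bsub>M\<^esub> ?a) \<le>\<^sub>v val V w"
  proof (rule ccontr)
    assume "\<not> val V (w \<oplus>\<^bsub>M\<^esub> ?a) \<le>\<^sub>v val V w"
    then have gt: "val V w <\<^sub>v val V (w \<oplus>\<^bsub>M\<^esub> ?a)"
      using not_lt_iff[of "val V w" "val V (w \<oplus>\<^bsub>M\<^esub> ?a)"] w a by auto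
    have "?a = (w \<oplus>\<^bsub>M\<^esub> ?a) \<ominus>\<^bsub>M\<^esub> w" using w a by (simp add: add_diff_cancel')
    then have wa: "val V w \<le>\<^sub>v val V ?a"
      using val_diff_ge[of "val V w" "w \<oplus>\<^bsub>M\<^esub> ?a" w] gt w a by (simp add: lt_iff)
    let ?s1 = "select ?P ks bs" and ?f1 = "filter ?P bs"
    let ?s2 = "select (\<lambda>b. \<not> ?P b) ks bs" and ?f2 = "filter (\<lambda>b. \<not> ?P b) bs"
    note sel1 = select_facts[OF ks(1), of ?P]
    note sel2 = select_facts[OF ks(1), of "\<lambda>b. \<not> ?P b"]
    have split: "?a = lcomb V ?s1 ?f1 \<oplus>\<^bsub>M\<^esub> lcomb V ?s2 ?f2"
      by (rule lcomb_split[OF ks bsc])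
    have s1: "set ?s1 \<subseteq> carrier K" and s2: "set ?s2 \<subseteq> carrier K" using sel1 sel2 ks by blast+
    have f1: "set ?f1 \<subseteq> carrier M" and f2: "set ?f2 \<subseteq> carrier M" using bsc by auto
    have a1: "lcomb V ?s1 ?f1 \<in> carrier M" and a2: "lcomb V ?s2 ?f2 \<in> carrier M"
      using s1 s2 f1 f2 by auto
    have gt2: "val V w <\<^sub>v val V (lcomb V ?s2 ?f2)"
    proof (rule val_lcomb_gt[OF sel2(1) s2 f2 val_closed[OF w(1)] fin], clarify)
      fix k b assume kb: "(k, b) \<in> set (zip ?s2 ?f2)" "k \<noteq> \<zero>\<^bsub>K\<^esub>"
      then have kb': "(k, b) \<in> set (zip ks bs)" "\<not> ?P b" unfolding sel2(3) by auto
      then have "b \<in> carrier M" using bsc by (auto dest: set_zip_rightD)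
      \<comment> \<open>The value of the combination bounds from below the value of every member
        occurring in it, by independence of \<open>bs\<close>; equality with the value of
        \<open>w\<close> is excluded in this half of the split.\<close>
      moreover have "val V w \<le>\<^sub>v val V b"
        using ord.le_trans[OF wa vindepD[OF bs ks kb'(1) kb(2)]] w a \<open>b \<in> carrier M\<close> by simp
      ultimately show "val V w <\<^sub>v val V b" using kb' by (auto simp: lt_iff)
    qed
    have "w \<oplus>\<^bsub>M\<^esub> lcomb V ?s1 ?f1 = (w \<oplus>\<^bsub>M\<^esub> ?a) \<ominus>\<^bsub>M\<^esub> lcomb V ?s2 ?f2"
      unfolding split using w a1 a2 by (simp add: add_diff_cancel flip: vs.M.a_assoc)
    then have "val V w <\<^sub>v val V (w \<oplus>\<^bsub>M\<^esub> lcomb V ?s1 ?f1)"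
      using val_diff_gt[OF val_closed[OF w(1)] _ a2 gt gt2] w a by simp
    then have "lcomb V (\<one>\<^bsub>K\<^esub> # ?s1) (w # ?f1) \<in> open_ball V (val V w)"
      using w a1 fin by (simp add: open_ball_iff)
    then have "\<one>\<^bsub>K\<^esub> = \<zero>\<^bsub>K\<^esub>"
      using rindepD[OF r, of "\<one>\<^bsub>K\<^esub> # ?s1"] sel1(1) s1 by auto
    then show False by simp
  qed
qed

text \<open>The condition at \<gamma> concerns only the members of value \<gamma>: filtering
  \<open>w # bs\<close> gives \<open>w\<close> in front of them, and \<open>vindep_Cons\<close> goes
  back. An infinite-dimensional quotient has no colour, which rightly makes extension always
  possible there.\<close>

lemma vindep_extensible_iff:
  assumes bs: "vindep V bs" and \<gamma>: "\<gamma> \<in> carrier G"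
  shows "(\<exists>w\<in>carrier M. val V w = \<gamma> \<and> vindep V (w # bs)) \<longleftrightarrow>
    \<gamma> \<notin> dim_colour V (length (filter (\<lambda>b. val V b = \<gamma>) bs))"
proof -
  let ?fs = "filter (\<lambda>b. val V b = \<gamma>) bs"
  have "(\<exists>w\<in>carrier M. val V w = \<gamma> \<and> vindep V (w # bs)) \<longleftrightarrow> (\<exists>w. rindep V \<gamma> (w # ?fs))"
  proof
    assume "\<exists>w\<in>carrier M. val V w = \<gamma> \<and> vindep V (w # bs)"
    then obtain w where "w \<in> carrier M" "val V w = \<gamma>" "vindep V (w # bs)" by auto
    then show "\<exists>w. rindep V \<gamma> (w # ?fs)"
      using rindep_filter[of "w # bs" \<gamma>] \<gamma> by auto
  next
    assume "\<exists>w. rindep V \<gamma> (w # ?fs)"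
    then obtain w where r: "rindep V \<gamma> (w # ?fs)" by auto
    then have w: "val V w = \<gamma>" "w \<noteq> \<zero>\<^bsub>M\<^esub>" "w \<in> carrier M"
      using rindep_val[OF \<gamma> r, of w] rindep_closed[OF r] closed_ballD by auto
    then show "\<exists>w\<in>carrier M. val V w = \<gamma> \<and> vindep V (w # bs)"
      using vindep_Cons[OF bs w(3,2)] r by auto
  qed
  then show ?thesis
    using dim_colour_iff_maximal[OF \<gamma> rindep_filter[OF bs \<gamma>]] by simp
qed

end


section \<open>Definable functions\<close>

lemma validD:
  "valid p \<Longrightarrow> valued_vector_space (space p)" "valid p \<Longrightarrow> fld p n \<in> carrier (Fp p)"
  "valid p \<Longrightarrow> vlu p n \<in> carrier (Gp p)"
  by (auto simp: valid_def)

lemma fun_type_L_field [simp]: "fun_type L_field = ffun_type"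
  by (simp add: L_field_def)

lemma has_sort_field [intro]:
  "has_sort L_field (Var () i) ()"
  "has_sort L_field a () \<Longrightarrow> has_sort L_field b () \<Longrightarrow> has_sort L_field (Fn FAdd [a, b]) ()"
  "has_sort L_field a () \<Longrightarrow> has_sort L_field b () \<Longrightarrow> has_sort L_field (Fn FMul [a, b]) ()"
  "has_sort L_field (Fn FZero []) ()" "has_sort L_field (Fn FOne []) ()"
  by (rule has_sort_Var, (rule has_sort_Fn, simp, simp)+)

lemma has_sort_coloured [intro]: "has_sort L_coloured_order (Var () i) ()"
  by (rule has_sort.intros)

lemma dpred_fld_eq: "dpred (\<lambda>p. fld p i = fld p j)"
  by (rule dpred_cong[OF dpred_fld[of "Eq (Var () i) (Var () j)"]]) (auto simp: sat_fld_def)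

lemma dpred_fld_add: "dpred (\<lambda>p. fld p i = fld p j \<oplus>\<^bsub>Fp p\<^esub> fld p k)"
  by (rule dpred_cong[OF dpred_fld[of "Eq (Var () i) (Fn FAdd [Var () j, Var () k])"]])
    (auto simp: sat_fld_def field_struct_def)

lemma dpred_fld_mult: "dpred (\<lambda>p. fld p i = fld p j \<otimes>\<^bsub>Fp p\<^esub> fld p k)"
  by (rule dpred_cong[OF dpred_fld[of "Eq (Var () i) (Fn FMul [Var () j, Var () k])"]])
    (auto simp: sat_fld_def field_struct_def)

lemma dpred_fld_zero: "dpred (\<lambda>p. fld p i = \<zero>\<^bsub>Fp p\<^esub>)"
  by (rule dpred_cong[OF dpred_fld[of "Eq (Var () i) (Fn FZero [])"]])
    (auto simp: sat_fld_def field_struct_def)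

lemma dpred_fld_one: "dpred (\<lambda>p. fld p i = \<one>\<^bsub>Fp p\<^esub>)"
  by (rule dpred_cong[OF dpred_fld[of "Eq (Var () i) (Fn FOne [])"]])
    (auto simp: sat_fld_def field_struct_def)

lemma dpred_vlu_eq: "dpred (\<lambda>p. vlu p i = vlu p j)"
  by (rule dpred_cong[OF dpred_vlu[of "Eq (Var () i) (Var () j)"]]) (auto simp: sat_vlu_def)

lemma dpred_vlu_less: "dpred (\<lambda>p. vlu p i \<sqsubset>\<^bsub>Gp p\<^esub> vlu p j)"
  by (rule dpred_cong[OF dpred_vlu[of "Rel CLess [Var () i, Var () j]"]])
    (auto simp: sat_vlu_def coloured_struct_def L_coloured_order_def intro: has_sort.intros)

lemma dpred_vlu_colour: "dpred (\<lambda>p. vlu p i \<in> dim_colour (space p) n)"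
  by (rule dpred_cong[OF dpred_vlu[of "Rel (Colour n) [Var () i]"]])
    (auto simp: sat_vlu_def coloured_struct_def L_coloured_order_def intro: has_sort.intros)

text \<open>Definability through the graph, with the value at index 0 and the arguments shifted. No
  term for the function is required, which admits functions given by a description.\<close>

definition dfld :: "(('k, 'v, 'g) point \<Rightarrow> 'k) \<Rightarrow> bool" where
  "dfld f \<longleftrightarrow> (\<forall>p. valid p \<longrightarrow> f p \<in> carrier (Fp p)) \<and> dpred (\<lambda>p. fld p 0 = f (pop_fld p))"

definition dvlu :: "(('k, 'v, 'g) point \<Rightarrow> 'g) \<Rightarrow> bool" where
  "dvlu f \<longleftrightarrow> (\<forall>p. valid p \<longrightarrow> f p \<in> carrier (Gp p)) \<and> dpred (\<lambda>p. vlu p 0 = f (pop_vlu p))"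

lemma reindex_reindex: "reindex \<rho> \<sigma> (reindex \<rho>' \<sigma>' p) = reindex (\<rho>' \<circ> \<rho>) (\<sigma>' \<circ> \<sigma>) p"
  by (simp add: reindex_def o_assoc)

lemma dfld_closed: "dfld f \<Longrightarrow> valid p \<Longrightarrow> f p \<in> carrier (Fp p)"
  by (simp add: dfld_def)

lemma dvlu_closed: "dvlu f \<Longrightarrow> valid p \<Longrightarrow> f p \<in> carrier (Gp p)"
  by (simp add: dvlu_def)

lemma dfld_reindex:
  assumes "dfld f" shows "dfld (\<lambda>p. f (reindex \<rho> \<sigma> p))"
proof -
  have *: "dpred (\<lambda>p. fld p 0 = f (pop_fld p))" using assms by (simp add: dfld_def)
  have "f (reindex \<rho> \<sigma> p) \<in> carrier (Fp p)" if "valid p" for p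
    using dfld_closed[OF assms valid_reindex[OF that]] by simp
  \<comment> \<open>In the graph, index 0 carries the value of the function and stays in place; only
    the shifted arguments are renamed.\<close>
  moreover have "case_nat 0 (Suc \<circ> \<rho>) \<circ> Suc = Suc \<circ> \<rho>" by auto
  ultimately show ?thesis
    using dpred_reindex[OF *, of "case_nat 0 (Suc \<circ> \<rho>)" \<sigma>] assms
    by (simp add: dfld_def reindex_reindex)
qed

lemma dvlu_reindex:
  assumes "dvlu f" shows "dvlu (\<lambda>p. f (reindex \<rho> \<sigma> p))"
proof -
  have *: "dpred (\<lambda>p. vlu p 0 = f (pop_vlu p))" using assms by (simp add: dvlu_def)
  have "f (reindex \<rho> \<sigma> p) \<in> carrier (Gp p)" if "valid p" for p
    using dvlu_closed[OF assms valid_reindex[OF that]] by simp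
  moreover have "case_nat 0 (Suc \<circ> \<sigma>) \<circ> Suc = Suc \<circ> \<sigma>" by auto
  ultimately show ?thesis
    using dpred_reindex[OF *, of \<rho> "case_nat 0 (Suc \<circ> \<sigma>)"] assms
    by (simp add: dvlu_def reindex_reindex)
qed

text \<open>Substitution without terms: there is an element that equals the value of
  \<open>f\<close> and satisfies \<open>Q\<close>.\<close>

lemma dpred_subst_fld:
  assumes "dfld f" "dpred Q" shows "dpred (\<lambda>p. Q (push_fld (f p) p))"
  by (rule dpred_cong[OF dpred_ex_fld[OF dpred_conj[of "\<lambda>p. fld p 0 = f (pop_fld p)", OF _ assms(2)]]])
    (use assms(1) in \<open>auto simp: dfld_def\<close>)

lemma dpred_subst_vlu:
  assumes "dvlu f" "dpred Q" shows "dpred (\<lambda>p. Q (push_vlu (f p) p))"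
  by (rule dpred_cong[OF dpred_ex_vlu[OF dpred_conj[of "\<lambda>p. vlu p 0 = f (pop_vlu p)", OF _ assms(2)]]])
    (use assms(1) in \<open>auto simp: dvlu_def\<close>)

lemma dpred_eq_fld: "dfld f \<Longrightarrow> dfld g \<Longrightarrow> dpred (\<lambda>p. f p = g p)"
  using dpred_subst_fld[of f "\<lambda>p. fld p 0 = g (pop_fld p)"] by (simp add: dfld_def)

lemma dpred_eq_vlu: "dvlu f \<Longrightarrow> dvlu g \<Longrightarrow> dpred (\<lambda>p. f p = g p)"
  using dpred_subst_vlu[of f "\<lambda>p. vlu p 0 = g (pop_vlu p)"] by (simp add: dvlu_def)

lemma dpred_less:
  assumes "dvlu f" "dvlu g" shows "dpred (\<lambda>p. f p \<sqsubset>\<^bsub>Gp p\<^esub> g p)"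
  \<comment> \<open>The value of \<open>g\<close> is pushed first. It moves to index 1 when the
    value of \<open>f\<close>, computed from the popped assignment, is pushed to index 0.\<close>
  using dpred_subst_vlu[OF assms(2) dpred_subst_vlu[OF dvlu_reindex[OF assms(1), of id Suc] dpred_vlu_less[of 0 1]]]
  by simp

lemma dpred_colour: "dvlu f \<Longrightarrow> dpred (\<lambda>p. f p \<in> dim_colour (space p) n)"
  using dpred_subst_vlu[OF _ dpred_vlu_colour[of 0 n], of f] by simp

lemma dfld_fld: "dfld (\<lambda>p. fld p i)"
  using dpred_fld_eq[of 0 "Suc i"] by (auto simp: dfld_def validD)

lemma dvlu_vlu: "dvlu (\<lambda>p. vlu p i)"
  using dpred_vlu_eq[of 0 "Suc i"] by (auto simp: dvlu_def validD)

text \<open>The operation \<open>h\<close> takes the space as an argument because the field varies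
  with it. Both operands are pushed in front of the result, which explains the index 2 and the
  double shift of \<open>f\<close>.\<close>

lemma dfld_binop:
  assumes op: "dpred (\<lambda>p. fld p 2 = h (space p) (fld p 0) (fld p 1))"
    and closed: "\<And>p a b. valid p \<Longrightarrow> a \<in> carrier (Fp p) \<Longrightarrow> b \<in> carrier (Fp p) \<Longrightarrow> h (space p) a b \<in> carrier (Fp p)"
    and f: "dfld f" and g: "dfld g"
  shows "dfld (\<lambda>p. h (space p) (f p) (g p))"
  unfolding dfld_def
proof (intro conjI allI impI closed dfld_closed f g)
  have "dpred (\<lambda>p. fld p 1 = h (space p) (f (reindex (\<lambda>n. Suc (Suc n)) id p)) (fld p 0))"
    using dpred_subst_fld[OF dfld_reindex[OF f, of "\<lambda>n. Suc (Suc n)" id] op]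
    by (simp add: numeral_2_eq_2)
  from dpred_subst_fld[OF dfld_reindex[OF g, of Suc id] this]
  show "dpred (\<lambda>p. fld p 0 = h (space (pop_fld p)) (f (pop_fld p)) (g (pop_fld p)))"
  proof (rule dpred_cong)
    fix p :: "('a, 'b, 'c) point"
    have "reindex (\<lambda>n. Suc (Suc n)) id (push_fld k p) = pop_fld p" for k
      by (simp add: reindex_def o_def)
    then show "(fld (push_fld (g (pop_fld p)) p) 1 =
         h (space (push_fld (g (pop_fld p)) p)) (f (reindex (\<lambda>n. Suc (Suc n)) id (push_fld (g (pop_fld p)) p)))
          (fld (push_fld (g (pop_fld p)) p) 0)) \<longleftrightarrow>
        (fld p 0 = h (space (pop_fld p)) (f (pop_fld p)) (g (pop_fld p)))"
      by simp
  qed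
qed

lemma valid_ring: "valid p \<Longrightarrow> ring (Fp p)"
  using validD(1)[of p] valued_vector_space.vectorspace[of "space p"]
  by (simp add: vectorspace_def module_def cring_def)

lemma dfld_add: "dfld f \<Longrightarrow> dfld g \<Longrightarrow> dfld (\<lambda>p. f p \<oplus>\<^bsub>Fp p\<^esub> g p)"
  by (rule dfld_binop[where h = "\<lambda>U a b. a \<oplus>\<^bsub>scalars U\<^esub> b", OF dpred_fld_add]) (auto intro: ring.ring_simprules valid_ring)

lemma dfld_mult: "dfld f \<Longrightarrow> dfld g \<Longrightarrow> dfld (\<lambda>p. f p \<otimes>\<^bsub>Fp p\<^esub> g p)"
  by (rule dfld_binop[where h = "\<lambda>U a b. a \<otimes>\<^bsub>scalars U\<^esub> b", OF dpred_fld_mult]) (auto intro: ring.ring_simprules valid_ring)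

lemma dfld_zero: "dfld (\<lambda>p. \<zero>\<^bsub>Fp p\<^esub>)"
  using dpred_fld_zero[of 0] by (auto simp: dfld_def intro: ring.ring_simprules valid_ring)

lemma dfld_one: "dfld (\<lambda>p. \<one>\<^bsub>Fp p\<^esub>)"
  using dpred_fld_one[of 0] by (auto simp: dfld_def intro: ring.ring_simprules valid_ring)

text \<open>The language of fields has no symbol for negatives, so minus one is defined as the
  solution of \<open>x + 1 = 0\<close>.\<close>

lemma dfld_neg_one: "dfld (\<lambda>p :: ('a, 'b, 'c) point. \<ominus>\<^bsub>Fp p\<^esub> \<one>\<^bsub>Fp p\<^esub>)"
  unfolding dfld_def
proof (intro conjI allI impI)
  fix p :: "('a, 'b, 'c) point" assume "valid p"
  then interpret ring "Fp p" by (rule valid_ring)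
  show "\<ominus>\<^bsub>Fp p\<^esub> \<one>\<^bsub>Fp p\<^esub> \<in> carrier (Fp p)" by simp
next
  show "dpred (\<lambda>p :: ('a, 'b, 'c) point. fld p 0 = \<ominus>\<^bsub>Fp (pop_fld p)\<^esub> \<one>\<^bsub>Fp (pop_fld p)\<^esub>)"
  proof (rule dpred_cong[OF dpred_eq_fld[OF dfld_add[OF dfld_fld[of 0] dfld_one] dfld_zero]])
    fix p :: "('a, 'b, 'c) point" assume p: "valid p"
    then interpret ring "Fp p" by (rule valid_ring)
    show "fld p 0 \<oplus>\<^bsub>Fp p\<^esub> \<one>\<^bsub>Fp p\<^esub> = \<zero>\<^bsub>Fp p\<^esub> \<longleftrightarrow> fld p 0 = \<ominus>\<^bsub>Fp (pop_fld p)\<^esub> \<one>\<^bsub>Fp (pop_fld p)\<^esub>"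
      using validD(2)[OF p, of 0] by (auto simp: l_neg intro: minus_equality[symmetric])
  qed
qed

text \<open>Coloured orders have no constant for \<infinity>, but it is definable as the element
  with nothing above it.\<close>

lemma dvlu_infty: "dvlu (\<lambda>p :: ('a, 'b, 'c) point. infty (space p))"
  unfolding dvlu_def
proof (intro conjI allI impI)
  fix p :: "('a, 'b, 'c) point" assume "valid p"
  then show "infty (space p) \<in> carrier (Gp p)"
    by (rule valued_vector_space.infty_closed[OF validD(1)])
next
  show "dpred (\<lambda>p :: ('a, 'b, 'c) point. vlu p 0 = infty (space (pop_vlu p)))"
  proof (rule dpred_cong[OF dpred_not[OF dpred_ex_vlu[OF dpred_vlu_less[of 1 0]]]])
    fix p :: "('a, 'b, 'c) point" assume p: "valid p"
    then interpret valued_vector_space "space p" by (rule validD)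
    show "\<not> (\<exists>g\<in>carrier (Gp p). vlu (push_vlu g p) 1 \<sqsubset>\<^bsub>Gp (push_vlu g p)\<^esub> vlu (push_vlu g p) 0) \<longleftrightarrow>
        vlu p 0 = infty (space (pop_vlu p))"
      using validD(3)[OF p, of 0] infty_closed lt_infty lt_imp_neq_infty by auto
  qed
qed

lemma dvlu_if:
  assumes P: "dpred P" and f: "dvlu f" and g: "dvlu g"
  shows "dvlu (\<lambda>p. if P p then f p else g p)"
  unfolding dvlu_def
proof (intro conjI allI impI)
  show "dpred (\<lambda>p. vlu p 0 = (if P (pop_vlu p) then f (pop_vlu p) else g (pop_vlu p)))"
  proof (rule dpred_cong)
    show "dpred (\<lambda>p. (P (pop_vlu p) \<and> vlu p 0 = f (pop_vlu p)) \<or> (\<not> P (pop_vlu p) \<and> vlu p 0 = g (pop_vlu p)))"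
      using f g by (intro dpred_disj dpred_conj dpred_not dpred_reindex[OF P]) (auto simp: dvlu_def)
  qed auto
qed (use f g in \<open>auto simp: dvlu_closed\<close>)

text \<open>A definable relation yields a total definable function, with default zero wherever there
  is no unique solution; unique solvability is itself definable.\<close>

lemma dfld_the:
  assumes D: "dpred D"
  shows "dfld (\<lambda>p. if \<exists>!k. k \<in> carrier (Fp p) \<and> D (push_fld k p)
    then THE k. k \<in> carrier (Fp p) \<and> D (push_fld k p) else \<zero>\<^bsub>Fp p\<^esub>)"
proof -
  define E where "E p \<longleftrightarrow> (\<exists>!k. k \<in> carrier (Fp p) \<and> D (push_fld k p))" for p
  define t where "t p = (if E p then THE k. k \<in> carrier (Fp p) \<and> D (push_fld k p) else \<zero>\<^bsub>Fp p\<^esub>)" for p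
  have E: "dpred E"
  proof (rule dpred_cong)
    define Q where "Q p \<longleftrightarrow> D p \<and> \<not> (\<exists>k\<in>carrier (Fp p). D (push_fld k (pop_fld p)) \<and> k \<noteq> fld p 0)" for p
    \<comment> \<open>The rival \<open>k\<close> is pushed in front of the candidate, which moves to
      index 1. The renaming lets \<open>D\<close> read the rival and skip the candidate.\<close>
    have "dpred (\<lambda>p. \<exists>k\<in>carrier (Fp p). (D (reindex (case_nat 0 (\<lambda>n. Suc (Suc n))) id (push_fld k p)) \<and>
        fld (push_fld k p) 0 \<noteq> fld (push_fld k p) 1))"
      by (intro dpred_ex_fld dpred_conj dpred_not dpred_fld_eq dpred_reindex D)
    moreover have "reindex (case_nat 0 (\<lambda>n. Suc (Suc n))) id (push_fld k p) = push_fld k (pop_fld p)"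
      for k and p :: "('a, 'b, 'c) point"
      by (auto simp: reindex_def push_fld_def fun_eq_iff split: nat.split)
    ultimately have "dpred Q"
      unfolding Q_def by (intro dpred_conj dpred_not D) simp
    then show "dpred (\<lambda>p. \<exists>k\<in>carrier (Fp p). Q (push_fld k p))" by (rule dpred_ex_fld)
    show "(\<exists>k\<in>carrier (Fp p). Q (push_fld k p)) \<longleftrightarrow> E p" for p
      by (auto simp: Q_def E_def)
  qed
  have "dpred (\<lambda>p. (E (pop_fld p) \<and> D p) \<or> (\<not> E (pop_fld p) \<and> fld p 0 = \<zero>\<^bsub>Fp p\<^esub>))"
    by (intro dpred_disj dpred_conj dpred_not dpred_fld_zero dpred_reindex E D)
  then have "dpred (\<lambda>p. fld p 0 = t (pop_fld p))"
  proof (rule dpred_cong)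
    fix p :: "('a, 'b, 'c) point" assume p: "valid p"
    have pp: "push_fld (fld p 0) (pop_fld p) = p"
      by (cases p) (auto simp: push_fld_def fun_eq_iff split: nat.split)
    show "(E (pop_fld p) \<and> D p) \<or> (\<not> E (pop_fld p) \<and> fld p 0 = \<zero>\<^bsub>Fp p\<^esub>) \<longleftrightarrow> fld p 0 = t (pop_fld p)"
    proof (cases "E (pop_fld p)")
      case True
      then have ex: "\<exists>!k. k \<in> carrier (Fp p) \<and> D (push_fld k (pop_fld p))" by (simp add: E_def)
      have t: "t (pop_fld p) = (THE k. k \<in> carrier (Fp p) \<and> D (push_fld k (pop_fld p)))"
        using True by (simp add: t_def)
      have "D p \<longleftrightarrow> fld p 0 = t (pop_fld p)"
      proof
        assume "D p"
        then have "fld p 0 \<in> carrier (Fp p) \<and> D (push_fld (fld p 0) (pop_fld p))"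
          using validD(2)[OF p] by (simp add: pp)
        then show "fld p 0 = t (pop_fld p)" unfolding t by (rule the1_equality[OF ex, symmetric])
      next
        assume "fld p 0 = t (pop_fld p)"
        then show "D p" using theI'[OF ex] pp unfolding t by simp
      qed
      then show ?thesis using True by simp
    qed (simp add: t_def)
  qed
  moreover have "t p \<in> carrier (Fp p)" if "valid p" for p
  proof (cases "E p")
    case True
    then show ?thesis using theI'[of "\<lambda>k. k \<in> carrier (Fp p) \<and> D (push_fld k p)"]
      unfolding t_def by (simp add: E_def)
  qed (auto simp: t_def intro: ring.ring_simprules valid_ring that)
  ultimately have "dfld t" by (simp add: dfld_def)
  then show ?thesis by (simp add: t_def[abs_def] E_def)
qed

section \<open>Blocks of field variables, and counting equal values\<close>

definition push_flds :: "'k list \<Rightarrow> ('k, 'v, 'g) point \<Rightarrow> ('k, 'v, 'g) point" where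
  "push_flds ks p = Point (space p) (\<lambda>i. if i < length ks then ks ! i else fld p (i - length ks)) (vlu p)"

abbreviation pop_flds :: "nat \<Rightarrow> ('k, 'v, 'g) point \<Rightarrow> ('k, 'v, 'g) point" where
  "pop_flds n \<equiv> reindex (\<lambda>i. i + n) id"

lemma push_flds_sel [simp]: "space (push_flds ks p) = space p" "vlu (push_flds ks p) = vlu p"
  by (auto simp: push_flds_def)

lemma pop_push_flds [simp]: "length ks = n \<Longrightarrow> pop_flds n (push_flds ks p) = p"
  by (cases p) (auto simp: reindex_def push_flds_def fun_eq_iff)

lemma map_fld_push_flds [simp]: "length ks = n \<Longrightarrow> map (fld (push_flds ks p)) [0..<n] = ks"
  by (auto simp: push_flds_def intro: nth_equalityI)

lemma valid_push_flds [simp]: "valid p \<Longrightarrow> set ks \<subseteq> carrier (Fp p) \<Longrightarrow> valid (push_flds ks p)"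
  by (auto simp: valid_def push_flds_def)

lemma push_flds_Cons: "push_flds (k # ks) p = push_fld k (push_flds ks p)"
  by (auto simp: push_flds_def push_fld_def fun_eq_iff split: nat.split)

lemma push_flds_Nil [simp]: "push_flds [] p = p"
  by (cases p) (simp add: push_flds_def)

lemma dpred_ex_flds:
  "dpred Q \<Longrightarrow> dpred (\<lambda>p. \<exists>ks. length ks = n \<and> set ks \<subseteq> carrier (Fp p) \<and> Q (push_flds ks p))"
proof (induction n arbitrary: Q)
  case (Suc n)
  show ?case
  proof (rule dpred_cong[OF Suc.IH[OF dpred_ex_fld[OF Suc.prems]]])
    fix p :: "('a, 'b, 'c) point"
    show "(\<exists>ks. length ks = n \<and> set ks \<subseteq> carrier (Fp p) \<and>
          (\<exists>k\<in>carrier (Fp (push_flds ks p)). Q (push_fld k (push_flds ks p)))) \<longleftrightarrow>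
        (\<exists>ks. length ks = Suc n \<and> set ks \<subseteq> carrier (Fp p) \<and> Q (push_flds ks p))"
      by (fastforce simp: length_Suc_conv push_flds_Cons)
  qed
qed simp

lemma dpred_count:
  assumes h: "dvlu h"
  shows "\<forall>g\<in>set gs. dvlu g \<Longrightarrow> dpred (\<lambda>p. length (filter (\<lambda>g. g p = h p) gs) = r)"
proof (induction gs arbitrary: r)
  case Nil
  then show ?case by (simp add: dpred_const)
next
  case (Cons g gs)
  have eq: "dpred (\<lambda>p. g p = h p)" using Cons.prems h by (auto intro: dpred_eq_vlu)
  have IH: "dpred (\<lambda>p. length (filter (\<lambda>g. g p = h p) gs) = r)" for r using Cons by simp
  \<comment> \<open>If \<open>g\<close> counts, the rest must contribute \<open>r - 1\<close>. This
    is truncated subtraction, so \<open>r \<noteq> 0\<close> has to be required separately.\<close>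
  show ?case
    by (rule dpred_cong[OF dpred_disj[OF dpred_conj[OF eq dpred_conj[OF dpred_const[of "r \<noteq> 0"] IH[of "r - 1"]]]
            dpred_conj[OF dpred_not[OF eq] IH[of r]]]]) auto
qed

text \<open>There is one colour predicate for each fixed number, whereas the count varies with the
  point. Since the count is at most the length of \<open>gs\<close>, a finite conjunction over all
  its possible values expresses the condition.\<close>

lemma dpred_not_saturated:
  assumes h: "dvlu h" and gs: "\<forall>g\<in>set gs. dvlu g"
  shows "dpred (\<lambda>p. h p \<notin> dim_colour (space p) (length (filter (\<lambda>g. g p = h p) gs)))"
proof -
  have "dpred (\<lambda>p. \<forall>r\<in>{..length gs}. length (filter (\<lambda>g. g p = h p) gs) = r \<longrightarrow> h p \<notin> dim_colour (space p) r)"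
    by (intro dpred_Ball dpred_imp dpred_not dpred_colour dpred_count h gs finite_atMost)
  then show ?thesis by (rule dpred_cong) (use length_filter_le in auto)
qed


section \<open>Vectors over a valuation independent family\<close>

text \<open>The minimum of the values at nonzero coefficients, \<infinity> if there are none. It is
  computed by comparisons alone, so that definability follows by recursion along the lists.\<close>

fun min_val :: "('k, 'v, 'g) valued_space \<Rightarrow> 'k list \<Rightarrow> 'g list \<Rightarrow> 'g" where
  "min_val V (k # ks) (g # gs) =
     (if k \<noteq> \<zero>\<^bsub>scalars V\<^esub> \<and> g \<sqsubset>\<^bsub>value_set V\<^esub> min_val V ks gs then g else min_val V ks gs)"
| "min_val V _ _ = infty V"

context valued_vector_space
begin

lemma min_val_facts:
  "length ks = length bs \<Longrightarrow> set bs \<subseteq> carrier M \<Longrightarrow>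
    min_val V ks (map (val V) bs) \<in> carrier G \<and>
    (\<forall>(k, b) \<in> set (zip ks bs). k \<noteq> \<zero>\<^bsub>K\<^esub> \<longrightarrow> min_val V ks (map (val V) bs) \<le>\<^sub>v val V b) \<and>
    (min_val V ks (map (val V) bs) = infty V \<or>
      (\<exists>(k, b) \<in> set (zip ks bs). k \<noteq> \<zero>\<^bsub>K\<^esub> \<and> min_val V ks (map (val V) bs) = val V b))"
proof (induction ks bs rule: list_induct2)
  case Nil
  then show ?case by (simp add: infty_closed)
next
  case (Cons k ks b bs)
  let ?m = "min_val V ks (map (val V) bs)"
  have IH: "?m \<in> carrier G" "\<And>l c. (l, c) \<in> set (zip ks bs) \<Longrightarrow> l \<noteq> \<zero>\<^bsub>K\<^esub> \<Longrightarrow> ?m \<le>\<^sub>v val V c"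
    and IH': "?m = infty V \<or> (\<exists>(l, c) \<in> set (zip ks bs). l \<noteq> \<zero>\<^bsub>K\<^esub> \<and> ?m = val V c)"
    using Cons by auto
  have b: "val V b \<in> carrier G" and bs: "set bs \<subseteq> carrier M" using Cons.prems by auto
  show ?case
  proof (cases "k \<noteq> \<zero>\<^bsub>K\<^esub> \<and> val V b <\<^sub>v ?m")
    case True
    have "val V b \<le>\<^sub>v val V c" if "(l, c) \<in> set (zip ks bs)" "l \<noteq> \<zero>\<^bsub>K\<^esub>" for l c
    proof -
      have "c \<in> carrier M" using that bs by (auto dest: set_zip_rightD)
      then show ?thesis using ord.le_trans[of "val V b" ?m "val V c"] IH(2)[OF that] True b IH(1) by (simp add: lt_iff)
    qed
    then show ?thesis using True b by auto
  next
    case False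
    then have "k \<noteq> \<zero>\<^bsub>K\<^esub> \<Longrightarrow> ?m \<le>\<^sub>v val V b" using not_lt_iff[OF b IH(1)] by auto
    then show ?thesis using False IH IH' by auto
  qed
qed

text \<open>The lower bound holds for every family. For the upper bound, independence is applied to
  a term where the minimum is attained.\<close>

lemma val_lcomb:
  assumes bs: "vindep V bs" and ks: "length ks = length bs" "set ks \<subseteq> carrier K"
  shows "val V (lcomb V ks bs) = min_val V ks (map (val V) bs)"
proof -
  note bsc = vindep_closed[OF bs]
  note facts = min_val_facts[OF ks(1) bsc]
  let ?m = "min_val V ks (map (val V) bs)"
  show ?thesis
  proof (rule ord.le_antisym)
    show "?m \<le>\<^sub>v val V (lcomb V ks bs)" using facts by (intro val_lcomb_ge ks bsc) auto
    consider "?m = infty V" | k b where "(k, b) \<in> set (zip ks bs)" "k \<noteq> \<zero>\<^bsub>K\<^esub>" "?m = val V b"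
      using facts by auto
    then show "val V (lcomb V ks bs) \<le>\<^sub>v ?m"
    proof cases
      case 1
      then show ?thesis using ks bsc by (simp add: infty_last)
    next
      case 2
      then show ?thesis using vindepD[OF bs ks] by simp
    qed
  qed (use facts ks bsc in auto)
qed

end

text \<open>
  \<open>bs\<close> is a valuation independent family with the values \<open>gs\<close>. Predicates and functions are
  definable relative to \<open>gs\<close> if they do not depend on the choice of \<open>bs\<close>; vectors are given by their
  coefficients.
\<close>

definition model :: "(('k, 'v, 'g) point \<Rightarrow> 'g) list \<Rightarrow> ('k, 'v, 'g) point \<Rightarrow> 'v list \<Rightarrow> bool" where
  "model gs p bs \<longleftrightarrow> valid p \<and> vindep (space p) bs \<and> map (val (space p)) bs = map (\<lambda>g. g p) gs"

definition relative :: "(('k, 'v, 'g) point \<Rightarrow> 'g) list \<Rightarrow> ((('k, 'v, 'g) point \<Rightarrow> 'x) \<Rightarrow> bool) \<Rightarrow>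
    (('k, 'v, 'g) point \<Rightarrow> 'v list \<Rightarrow> 'x) \<Rightarrow> bool" where
  "relative gs A f \<longleftrightarrow> (\<exists>d. A d \<and> (\<forall>p bs. model gs p bs \<longrightarrow> f p bs = d p))"

abbreviation "rpred gs \<equiv> relative gs dpred"
abbreviation "rfld gs \<equiv> relative gs dfld"
abbreviation "rvlu gs \<equiv> relative gs dvlu"

definition rvec ::
    "(('k, 'v, 'g) point \<Rightarrow> 'g) list \<Rightarrow> (('k, 'v, 'g) point \<Rightarrow> 'v list \<Rightarrow> 'v) \<Rightarrow> bool" where
  "rvec gs f \<longleftrightarrow> (\<exists>cs. length cs = length gs \<and> (\<forall>c\<in>set cs. dfld c) \<and>
     (\<forall>p bs. model gs p bs \<longrightarrow> f p bs = lcomb (space p) (map (\<lambda>c. c p) cs) bs))"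

lemma modelD:
  assumes "model gs p bs"
  shows "valid p" "valued_vector_space (space p)" "vindep (space p) bs" "length bs = length gs"
    "set bs \<subseteq> carrier (vectors (space p))"
proof -
  show *: "valid p" "valued_vector_space (space p)" "vindep (space p) bs"
    using assms by (auto simp: model_def valid_def)
  show "length bs = length gs"
    using assms unfolding model_def by (metis length_map)
  show "set bs \<subseteq> carrier (vectors (space p))"
    by (rule valued_vector_space.vindep_closed[OF *(2,3)])
qed

section \<open>Closure properties of relative definability\<close>

lemma relative_cong:
  "relative gs A f \<Longrightarrow> (\<And>p bs. model gs p bs \<Longrightarrow> f p bs = g p bs) \<Longrightarrow> relative gs A g"
  unfolding relative_def by (elim exE) (rule exI, auto)

lemma relative_const: "A d \<Longrightarrow> relative gs A (\<lambda>p bs. d p)"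
  unfolding relative_def by blast

lemmas rfld_const = relative_const[of dfld]
lemmas rvlu_const = relative_const[of dvlu]

lemma relative_map:
  assumes "\<And>d. A d \<Longrightarrow> B (\<lambda>p. h p (d p))" "relative gs A f"
  shows "relative gs B (\<lambda>p bs. h p (f p bs))"
proof -
  obtain d where "A d" "\<forall>p bs. model gs p bs \<longrightarrow> f p bs = d p"
    using assms(2) unfolding relative_def by (elim exE conjE)
  then show ?thesis
    unfolding relative_def by (intro exI[of _ "\<lambda>p. h p (d p)"]) (auto intro: assms(1))
qed

lemma relative_map2:
  assumes "\<And>d e. A d \<Longrightarrow> B e \<Longrightarrow> C (\<lambda>p. h p (d p) (e p))" "relative gs A f" "relative gs B g"
  shows "relative gs C (\<lambda>p bs. h p (f p bs) (g p bs))"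
proof -
  obtain d where "A d" "\<forall>p bs. model gs p bs \<longrightarrow> f p bs = d p"
    using assms(2) unfolding relative_def by (elim exE conjE)
  moreover obtain e where "B e" "\<forall>p bs. model gs p bs \<longrightarrow> g p bs = e p"
    using assms(3) unfolding relative_def by (elim exE conjE)
  ultimately show ?thesis
    unfolding relative_def by (intro exI[of _ "\<lambda>p. h p (d p) (e p)"]) (auto intro: assms(1))
qed

lemma rvec_cong: "rvec gs f \<Longrightarrow> (\<And>p bs. model gs p bs \<Longrightarrow> f p bs = g p bs) \<Longrightarrow> rvec gs g"
  unfolding rvec_def by (elim exE) (rule exI, auto)

lemma rpred_not: "rpred gs P \<Longrightarrow> rpred gs (\<lambda>p bs. \<not> P p bs)"
  by (rule relative_map[of dpred dpred "\<lambda>p. Not"]) (rule dpred_not)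

lemma rpred_conj: "rpred gs P \<Longrightarrow> rpred gs Q \<Longrightarrow> rpred gs (\<lambda>p bs. P p bs \<and> Q p bs)"
  by (rule relative_map2[of dpred dpred dpred "\<lambda>p. (\<and>)"]) (rule dpred_conj)

lemma rpred_disj: "rpred gs P \<Longrightarrow> rpred gs Q \<Longrightarrow> rpred gs (\<lambda>p bs. P p bs \<or> Q p bs)"
  by (rule relative_map2[of dpred dpred dpred "\<lambda>p. (\<or>)"]) (rule dpred_disj)

lemma rpred_Ball_set:
  "(\<And>a. a \<in> set as \<Longrightarrow> rpred gs (P a)) \<Longrightarrow> rpred gs (\<lambda>p bs. \<forall>a\<in>set as. P a p bs)"
proof (induction as)
  case Nil
  show ?case by (simp add: relative_const dpred_const)
next
  case (Cons a as)
  have "rpred gs (\<lambda>p bs. P a p bs \<and> (\<forall>a\<in>set as. P a p bs))"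
    by (intro rpred_conj Cons.IH Cons.prems) auto
  then show ?case by simp
qed

lemma rpred_eq_fld: "rfld gs f \<Longrightarrow> rfld gs g \<Longrightarrow> rpred gs (\<lambda>p bs. f p bs = g p bs)"
  by (rule relative_map2[of dfld dfld dpred "\<lambda>p. (=)"]) (rule dpred_eq_fld)

lemma rpred_eq_vlu: "rvlu gs f \<Longrightarrow> rvlu gs g \<Longrightarrow> rpred gs (\<lambda>p bs. f p bs = g p bs)"
  by (rule relative_map2[of dvlu dvlu dpred "\<lambda>p. (=)"]) (rule dpred_eq_vlu)

lemma rpred_less: "rvlu gs f \<Longrightarrow> rvlu gs g \<Longrightarrow> rpred gs (\<lambda>p bs. f p bs \<sqsubset>\<^bsub>Gp p\<^esub> g p bs)"
  by (rule relative_map2[of dvlu dvlu dpred "\<lambda>p. (\<sqsubset>\<^bsub>Gp p\<^esub>)"]) (rule dpred_less)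

lemma rfld_add: "rfld gs f \<Longrightarrow> rfld gs g \<Longrightarrow> rfld gs (\<lambda>p bs. f p bs \<oplus>\<^bsub>Fp p\<^esub> g p bs)"
  by (rule relative_map2[of dfld dfld dfld "\<lambda>p. (\<oplus>\<^bsub>Fp p\<^esub>)"]) (rule dfld_add)

lemma rfld_mult: "rfld gs f \<Longrightarrow> rfld gs g \<Longrightarrow> rfld gs (\<lambda>p bs. f p bs \<otimes>\<^bsub>Fp p\<^esub> g p bs)"
  by (rule relative_map2[of dfld dfld dfld "\<lambda>p. (\<otimes>\<^bsub>Fp p\<^esub>)"]) (rule dfld_mult)

lemma coeffs_closed: "\<forall>c\<in>set cs. dfld c \<Longrightarrow> valid p \<Longrightarrow> set (map (\<lambda>c. c p) cs) \<subseteq> carrier (Fp p)"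
  by (auto intro: dfld_closed)

lemma rvec_closed:
  assumes "rvec gs f" "model gs p bs" shows "f p bs \<in> carrier (vectors (space p))"
proof -
  interpret valued_vector_space "space p" by (rule modelD(2)[OF assms(2)])
  show ?thesis
    using assms coeffs_closed[OF _ modelD(1)[OF assms(2)]] modelD(5)[OF assms(2)]
    unfolding rvec_def by auto
qed

lemma rvec_zero: "rvec gs (\<lambda>p bs. \<zero>\<^bsub>vectors (space p)\<^esub>)"
  unfolding rvec_def
proof (intro exI[of _ "replicate (length gs) (\<lambda>p. \<zero>\<^bsub>Fp p\<^esub>)"] conjI allI impI)
  fix p :: "('a, 'b, 'c) point" and bs assume m: "model gs p bs"
  interpret valued_vector_space "space p" by (rule modelD(2)[OF m])
  show "\<zero>\<^bsub>vectors (space p)\<^esub> = lcomb (space p) (map (\<lambda>c. c p) (replicate (length gs) (\<lambda>p. \<zero>\<^bsub>Fp p\<^esub>))) bs"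
    using modelD(5)[OF m] by (subst lcomb_zero) auto
qed (auto intro: dfld_zero)

lemma map_map2_eval: "map (\<lambda>c. c p) (map2 (\<lambda>c d p. h p (c p) (d p)) cs ds) = map2 (h p) (map (\<lambda>c. c p) cs) (map (\<lambda>c. c p) ds)"
  by (induction cs ds rule: list_induct2') auto

lemma rvec_add:
  assumes "rvec gs f" "rvec gs g" shows "rvec gs (\<lambda>p bs. f p bs \<oplus>\<^bsub>vectors (space p)\<^esub> g p bs)"
proof -
  obtain cs where cs: "length cs = length gs" "\<forall>c\<in>set cs. dfld c"
      "\<And>p bs. model gs p bs \<Longrightarrow> f p bs = lcomb (space p) (map (\<lambda>c. c p) cs) bs"
    using assms(1) unfolding rvec_def by blast
  obtain ds where ds: "length ds = length gs" "\<forall>c\<in>set ds. dfld c"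
      "\<And>p bs. model gs p bs \<Longrightarrow> g p bs = lcomb (space p) (map (\<lambda>c. c p) ds) bs"
    using assms(2) unfolding rvec_def by blast
  let ?es = "map2 (\<lambda>c d p. c p \<oplus>\<^bsub>Fp p\<^esub> d p) cs ds"
  show ?thesis
    unfolding rvec_def
  proof (intro exI[of _ ?es] conjI allI impI)
    show "length ?es = length gs" using cs ds by simp
    show "\<forall>c\<in>set ?es. dfld c"
      using cs(2) ds(2) by (auto intro!: dfld_add dest: set_zip_leftD set_zip_rightD)
    fix p bs assume m: "model gs p bs"
    interpret valued_vector_space "space p" by (rule modelD(2)[OF m])
    show "f p bs \<oplus>\<^bsub>vectors (space p)\<^esub> g p bs = lcomb (space p) (map (\<lambda>c. c p) ?es) bs"
      unfolding cs(3)[OF m] ds(3)[OF m] map_map2_eval[of p "\<lambda>p. (\<oplus>\<^bsub>Fp p\<^esub>)"]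
      using coeffs_closed[OF cs(2) modelD(1)[OF m]] coeffs_closed[OF ds(2) modelD(1)[OF m]] modelD(5)[OF m] cs(1) ds(1)
      by (intro lcomb_add[symmetric]) auto
  qed
qed

lemma rvec_smult:
  assumes "rfld gs k" "rvec gs f" shows "rvec gs (\<lambda>p bs. k p bs \<odot>\<^bsub>vectors (space p)\<^esub> f p bs)"
proof -
  obtain d where d: "dfld d" "\<And>p bs. model gs p bs \<Longrightarrow> k p bs = d p"
    using assms(1) unfolding relative_def by blast
  obtain cs where cs: "length cs = length gs" "\<forall>c\<in>set cs. dfld c"
      "\<And>p bs. model gs p bs \<Longrightarrow> f p bs = lcomb (space p) (map (\<lambda>c. c p) cs) bs"
    using assms(2) unfolding rvec_def by blast
  let ?es = "map (\<lambda>c p. d p \<otimes>\<^bsub>Fp p\<^esub> c p) cs"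
  show ?thesis
    unfolding rvec_def
  proof (intro exI[of _ ?es] conjI allI impI)
    show "length ?es = length gs" using cs by simp
    show "\<forall>c\<in>set ?es. dfld c" using cs(2) d(1) by (auto intro!: dfld_mult)
    fix p bs assume m: "model gs p bs"
    interpret valued_vector_space "space p" by (rule modelD(2)[OF m])
    have "map (\<lambda>c. c p) ?es = map ((\<otimes>\<^bsub>Fp p\<^esub>) (d p)) (map (\<lambda>c. c p) cs)" by simp
    then show "k p bs \<odot>\<^bsub>vectors (space p)\<^esub> f p bs = lcomb (space p) (map (\<lambda>c. c p) ?es) bs"
      unfolding cs(3)[OF m] d(2)[OF m]
      using coeffs_closed[OF cs(2) modelD(1)[OF m]] modelD(5)[OF m] dfld_closed[OF d(1) modelD(1)[OF m]]
      by (simp only: lcomb_smult)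
  qed
qed

lemma rvec_diff:
  assumes "rvec gs f" "rvec gs g" shows "rvec gs (\<lambda>p bs. f p bs \<ominus>\<^bsub>vectors (space p)\<^esub> g p bs)"
proof (rule rvec_cong[OF rvec_add[OF assms(1) rvec_smult[OF rfld_const[OF dfld_neg_one] assms(2)]]])
  fix p bs assume m: "model gs p bs"
  interpret valued_vector_space "space p" by (rule modelD(2)[OF m])
  show "f p bs \<oplus>\<^bsub>vectors (space p)\<^esub> (\<ominus>\<^bsub>Fp p\<^esub> \<one>\<^bsub>Fp p\<^esub>) \<odot>\<^bsub>vectors (space p)\<^esub> g p bs = f p bs \<ominus>\<^bsub>vectors (space p)\<^esub> g p bs"
    using rvec_closed[OF assms(2) m] by (simp add: vs.M.minus_eq neg_eq_smult)
qed

lemma rvec_lcomb: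
  "\<forall>k\<in>set ks. rfld gs k \<Longrightarrow> \<forall>f\<in>set fs. rvec gs f \<Longrightarrow>
    rvec gs (\<lambda>p bs. lcomb (space p) (map (\<lambda>k. k p bs) ks) (map (\<lambda>f. f p bs) fs))"
  by (induction ks fs rule: list_induct2') (auto intro: rvec_zero rvec_add rvec_smult)

lemma dvlu_min_val:
  "\<forall>c\<in>set cs. dfld c \<Longrightarrow> \<forall>g\<in>set gs. dvlu g \<Longrightarrow>
    dvlu (\<lambda>p. min_val (space p) (map (\<lambda>c. c p) cs) (map (\<lambda>g. g p) gs))"
proof (induction cs gs rule: list_induct2')
  case (4 c cs g gs)
  then have "dvlu (\<lambda>p. min_val (space p) (map (\<lambda>c. c p) cs) (map (\<lambda>g. g p) gs))" by auto
  with 4 show ?case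
    by (auto intro!: dvlu_if dpred_conj dpred_not dpred_eq_fld dfld_zero dpred_less)
qed (auto intro: dvlu_infty)

text \<open>By \<open>val_lcomb\<close> the value of a vector is read off from its coefficients and
  the list \<open>gs\<close>, whichever family with these values represents it.\<close>

lemma rvlu_val:
  assumes gs: "\<forall>g\<in>set gs. dvlu g" and f: "rvec gs f"
  shows "rvlu gs (\<lambda>p bs. val (space p) (f p bs))"
proof -
  obtain cs where cs: "length cs = length gs" "\<forall>c\<in>set cs. dfld c"
      "\<And>p bs. model gs p bs \<Longrightarrow> f p bs = lcomb (space p) (map (\<lambda>c. c p) cs) bs"
    using f unfolding rvec_def by blast
  show ?thesis
    unfolding relative_def
  proof (intro exI conjI allI impI)
    show "dvlu (\<lambda>p. min_val (space p) (map (\<lambda>c. c p) cs) (map (\<lambda>g. g p) gs))"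
      by (rule dvlu_min_val[OF cs(2) gs])
    fix p bs assume m: "model gs p bs"
    interpret valued_vector_space "space p" by (rule modelD(2)[OF m])
    have "map (val (space p)) bs = map (\<lambda>g. g p) gs" using m by (simp add: model_def)
    then show "val (space p) (f p bs) = min_val (space p) (map (\<lambda>c. c p) cs) (map (\<lambda>g. g p) gs)"
      using val_lcomb[OF modelD(3)[OF m], of "map (\<lambda>c. c p) cs"] coeffs_closed[OF cs(2) modelD(1)[OF m]]
        cs(1) modelD(4)[OF m] by (simp add: cs(3)[OF m])
  qed
qed

text \<open>Equality is rephrased as the difference having value \<infinity>, which reduces it to
  equality of definable values.\<close>

lemma rpred_eq_vec:
  assumes gs: "\<forall>g\<in>set gs. dvlu g" and f: "rvec gs f" and g: "rvec gs g"
  shows "rpred gs (\<lambda>p bs. f p bs = g p bs)"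
proof (rule relative_cong[OF rpred_eq_vlu[OF rvlu_val[OF gs rvec_diff[OF f g]] rvlu_const[OF dvlu_infty]]])
  fix p bs assume m: "model gs p bs"
  interpret valued_vector_space "space p" by (rule modelD(2)[OF m])
  show "val (space p) (f p bs \<ominus>\<^bsub>vectors (space p)\<^esub> g p bs) = infty (space p) \<longleftrightarrow> f p bs = g p bs"
    using rvec_closed[OF f m] rvec_closed[OF g m] by (simp add: val_eq_infty_iff diff_eq_zero_iff)
qed

text \<open>Under a quantifier new variables occupy the low indices, so the value functions must be
  read on the old part of the assignment in order to describe the same family as before.\<close>

abbreviation shift_vlus ::
    "(nat \<Rightarrow> nat) \<Rightarrow> (nat \<Rightarrow> nat) \<Rightarrow> (('k, 'v, 'g) point \<Rightarrow> 'g) list \<Rightarrow> (('k, 'v, 'g) point \<Rightarrow> 'g) list" where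
  "shift_vlus \<rho> \<sigma> gs \<equiv> map (\<lambda>g p. g (reindex \<rho> \<sigma> p)) gs"

lemma dvlu_shift: "\<forall>g\<in>set gs. dvlu g \<Longrightarrow> \<forall>g\<in>set (shift_vlus \<rho> \<sigma> gs). dvlu g"
  by (auto intro: dvlu_reindex)

lemma model_reindex: "model (shift_vlus \<rho> \<sigma> gs) p bs \<Longrightarrow> model gs (reindex \<rho> \<sigma> p) bs"
  by (auto simp: model_def)

lemma relative_reindex:
  assumes "\<And>d. A d \<Longrightarrow> A (\<lambda>p. d (reindex \<rho> \<sigma> p))" "relative gs A f"
  shows "relative (shift_vlus \<rho> \<sigma> gs) A (\<lambda>p bs. f (reindex \<rho> \<sigma> p) bs)"
proof -
  obtain d where "A d" "\<forall>p bs. model gs p bs \<longrightarrow> f p bs = d p"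
    using assms(2) unfolding relative_def by (elim exE conjE)
  then show ?thesis
    unfolding relative_def
    by (intro exI[of _ "\<lambda>p. d (reindex \<rho> \<sigma> p)"] conjI allI impI) (auto intro: assms(1) dest: model_reindex)
qed

lemma rfld_reindex: "rfld gs f \<Longrightarrow> rfld (shift_vlus \<rho> \<sigma> gs) (\<lambda>p bs. f (reindex \<rho> \<sigma> p) bs)"
  by (rule relative_reindex) (rule dfld_reindex)

lemma rvlu_reindex: "rvlu gs f \<Longrightarrow> rvlu (shift_vlus \<rho> \<sigma> gs) (\<lambda>p bs. f (reindex \<rho> \<sigma> p) bs)"
  by (rule relative_reindex) (rule dvlu_reindex)

lemma rvec_reindex:
  assumes "rvec gs f" shows "rvec (shift_vlus \<rho> \<sigma> gs) (\<lambda>p bs. f (reindex \<rho> \<sigma> p) bs)"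
proof -
  obtain cs where cs: "length cs = length gs" "\<forall>c\<in>set cs. dfld c"
      "\<And>p bs. model gs p bs \<Longrightarrow> f p bs = lcomb (space p) (map (\<lambda>c. c p) cs) bs"
    using assms unfolding rvec_def by blast
  show ?thesis
    unfolding rvec_def
  proof (intro exI[of _ "map (\<lambda>c p. c (reindex \<rho> \<sigma> p)) cs"] conjI allI impI)
    fix p bs assume "model (shift_vlus \<rho> \<sigma> gs) p bs"
    from cs(3)[OF model_reindex[OF this]]
    show "f (reindex \<rho> \<sigma> p) bs = lcomb (space p) (map (\<lambda>c. c p) (map (\<lambda>c p. c (reindex \<rho> \<sigma> p)) cs)) bs"
      by (simp add: o_def)
  qed (use cs in \<open>auto intro: dfld_reindex\<close>)
qed

lemma rvec_reindex_list:
  "\<forall>f\<in>set fs. rvec gs f \<Longrightarrow> \<forall>f\<in>set (map (\<lambda>f p bs. f (reindex \<rho> \<sigma> p) bs) fs). rvec (shift_vlus \<rho> \<sigma> gs) f"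
  by (auto intro: rvec_reindex)

text \<open>The witnesses occupy the first \<open>n\<close> field variables, while \<open>Q\<close>
  and the value functions read the assignment behind them. The family \<open>bs\<close> is
  unaffected, as pushing scalars does not change its values.\<close>

lemma rpred_ex_flds:
  assumes "rpred (shift_vlus (\<lambda>i. i + n) id gs) (\<lambda>p bs. Q (pop_flds n p) bs (map (fld p) [0..<n]))"
  shows "rpred gs (\<lambda>p bs. \<exists>ks. length ks = n \<and> set ks \<subseteq> carrier (Fp p) \<and> Q p bs ks)"
proof -
  obtain D where D: "dpred D" "\<And>p bs. model (shift_vlus (\<lambda>i. i + n) id gs) p bs \<Longrightarrow>
      Q (pop_flds n p) bs (map (fld p) [0..<n]) \<longleftrightarrow> D p"
    using assms unfolding relative_def by blast
  have "Q p bs ks \<longleftrightarrow> D (push_flds ks p)"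
    if "model gs p bs" "length ks = n" "set ks \<subseteq> carrier (Fp p)" for p bs ks
    using D(2)[of "push_flds ks p" bs] that by (simp add: model_def o_def)
  then show ?thesis
    unfolding relative_def using dpred_ex_flds[OF D(1), of n] by (intro exI conjI) auto
qed

lemma rpred_ex_fld:
  assumes "rpred (shift_vlus Suc id gs) (\<lambda>p bs. Q (pop_fld p) bs (fld p 0))"
  shows "rpred gs (\<lambda>p bs. \<exists>k\<in>carrier (Fp p). Q p bs k)"
proof -
  obtain D where D: "dpred D" "\<And>p bs. model (shift_vlus Suc id gs) p bs \<Longrightarrow> Q (pop_fld p) bs (fld p 0) \<longleftrightarrow> D p"
    using assms unfolding relative_def by blast
  have "Q p bs k \<longleftrightarrow> D (push_fld k p)" if "model gs p bs" "k \<in> carrier (Fp p)" for p bs k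
    using D(2)[of "push_fld k p" bs] that by (simp add: model_def o_def)
  then show ?thesis
    unfolding relative_def using dpred_ex_fld[OF D(1)] by (intro exI conjI) auto
qed

lemma rpred_ex_vlu:
  assumes "rpred (shift_vlus id Suc gs) (\<lambda>p bs. Q (pop_vlu p) bs (vlu p 0))"
  shows "rpred gs (\<lambda>p bs. \<exists>g\<in>carrier (Gp p). Q p bs g)"
proof -
  obtain D where D: "dpred D" "\<And>p bs. model (shift_vlus id Suc gs) p bs \<Longrightarrow> Q (pop_vlu p) bs (vlu p 0) \<longleftrightarrow> D p"
    using assms unfolding relative_def by blast
  have "Q p bs g \<longleftrightarrow> D (push_vlu g p)" if "model gs p bs" "g \<in> carrier (Gp p)" for p bs g
    using D(2)[of "push_vlu g p" bs] that by (simp add: model_def o_def)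
  then show ?thesis
    unfolding relative_def using dpred_ex_vlu[OF D(1)] by (intro exI conjI) auto
qed

text \<open>The defining condition need not be functional at points where no family has the values
  \<open>gs\<close>. Passing through \<open>dfld_the\<close> gives a function that is total and
  closed everywhere and agrees with \<open>f\<close> on all models.\<close>

lemma rfld_graph:
  assumes closed: "\<And>p bs. model gs p bs \<Longrightarrow> f p bs \<in> carrier (Fp p)"
    and graph: "rpred (shift_vlus Suc id gs) (\<lambda>p bs. fld p 0 = f (pop_fld p) bs)"
  shows "rfld gs f"
proof -
  obtain D where D: "dpred D" "\<And>p bs. model (shift_vlus Suc id gs) p bs \<Longrightarrow> fld p 0 = f (pop_fld p) bs \<longleftrightarrow> D p"
    using graph unfolding relative_def by blast
  show ?thesis
    unfolding relative_def
  proof (intro exI conjI allI impI, rule dfld_the[OF D(1)])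
    fix p bs assume m: "model gs p bs"
    have *: "k = f p bs \<longleftrightarrow> D (push_fld k p)" if "k \<in> carrier (Fp p)" for k
      using D(2)[of "push_fld k p" bs] m that by (simp add: model_def o_def)
    then have **: "k \<in> carrier (Fp p) \<and> D (push_fld k p) \<longleftrightarrow> k = f p bs" for k
      using closed[OF m] by auto
    show "f p bs = (if \<exists>!k. k \<in> carrier (Fp p) \<and> D (push_fld k p)
        then THE k. k \<in> carrier (Fp p) \<and> D (push_fld k p) else \<zero>\<^bsub>Fp p\<^esub>)"
      unfolding ** by simp
  qed
qed

text \<open>The coefficient tuples in \<open>W_n\<close> are quantified over the field only, and for
  a given tuple the comparison of values is definable.\<close>

lemma rpred_W_holds:
  assumes gs: "\<forall>g\<in>set gs. dvlu g" and fs: "\<forall>f\<in>set fs. rvec gs f" "fs \<noteq> []"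
  shows "rpred gs (\<lambda>p bs. W_holds (space p) (map (\<lambda>f. f p bs) fs))"
proof -
  let ?n = "length fs" and ?gs = "shift_vlus (\<lambda>i. i + length fs) id gs"
  let ?fs = "map (\<lambda>f p bs. f (pop_flds (length fs) p) bs) fs"
  let ?ks = "map (\<lambda>i p bs. fld p i) [0..<length fs]"
  \<comment> \<open>\<open>Q\<close> describes a tuple refuting independence: it has a nonzero entry
    although the combination has too large a value. \<open>Q'\<close> is the same condition with the
    tuple read from the first field variables.\<close>
  define Q where "Q p bs ks \<longleftrightarrow> val (space p) (hd fs p bs) \<sqsubset>\<^bsub>Gp p\<^esub> val (space p) (lcomb (space p) ks (map (\<lambda>f. f p bs) fs)) \<and>
      \<not> (\<forall>k\<in>set ks. k = \<zero>\<^bsub>Fp p\<^esub>)" for p bs ks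
  define Q' where "Q' p bs \<longleftrightarrow> val (space p) (hd ?fs p bs) \<sqsubset>\<^bsub>Gp p\<^esub>
      val (space p) (lcomb (space p) (map (\<lambda>k. k p bs) ?ks) (map (\<lambda>f. f p bs) ?fs)) \<and>
      \<not> (\<forall>k\<in>set ?ks. k p bs = \<zero>\<^bsub>Fp p\<^esub>)" for p bs
  have fs': "\<forall>f\<in>set ?fs. rvec ?gs f" by (rule rvec_reindex_list[OF fs(1)])
  have ks': "\<forall>k\<in>set ?ks. rfld ?gs k" by (auto intro: rfld_const dfld_fld)
  have hd: "hd ?fs \<in> set ?fs" using fs(2) by (intro hd_in_set) simp
  have "rpred ?gs Q'"
    unfolding Q'_def
    using fs' ks' hd
    by (intro rpred_conj rpred_not rpred_less rvlu_val[OF dvlu_shift[OF gs]] rvec_lcomb rpred_Ball_set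
        rpred_eq_fld rfld_const[OF dfld_zero]) auto
  moreover have "Q' p bs \<longleftrightarrow> Q (pop_flds ?n p) bs (map (fld p) [0..<?n])" for p bs
    using fs(2) by (simp add: Q_def Q'_def o_def hd_map)
  ultimately have "rpred ?gs (\<lambda>p bs. Q (pop_flds ?n p) bs (map (fld p) [0..<?n]))" by (rule relative_cong)
  then have 1: "rpred gs (\<lambda>p bs. \<exists>ks. length ks = ?n \<and> set ks \<subseteq> carrier (Fp p) \<and> Q p bs ks)"
    by (rule rpred_ex_flds)
  have 2: "rpred gs (\<lambda>p bs. \<forall>f\<in>set fs. f p bs \<noteq> \<zero>\<^bsub>vectors (space p)\<^esub> \<and> val (space p) (f p bs) = val (space p) (hd fs p bs))"
    using fs by (intro rpred_Ball_set rpred_conj rpred_not rpred_eq_vec[OF gs] rvec_zero rpred_eq_vlu rvlu_val[OF gs]) auto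
  show ?thesis
  proof (rule relative_cong[OF rpred_conj[OF 2 rpred_not[OF 1]]])
    fix p bs assume m: "model gs p bs"
    interpret valued_vector_space "space p" by (rule modelD(2)[OF m])
    have c: "set (map (\<lambda>f. f p bs) fs) \<subseteq> carrier (vectors (space p))"
      using fs(1) rvec_closed[OF _ m] by auto
    have lin: "lin_comb (space p) ks (map (\<lambda>f. f p bs) fs) = lcomb (space p) ks (map (\<lambda>f. f p bs) fs)"
      if "length ks = ?n" "set ks \<subseteq> carrier (Fp p)" for ks
      using that c by (intro lin_comb_eq_lcomb) auto
    have hd: "hd (map (\<lambda>f. f p bs) fs) = hd fs p bs" using fs(2) by (rule hd_map)
    have "(length ks = length (map (\<lambda>f. f p bs) fs) \<and> set ks \<subseteq> carrier (Fp p) \<and>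
          val (space p) (hd fs p bs) \<sqsubset>\<^bsub>Gp p\<^esub> val (space p) (lin_comb (space p) ks (map (\<lambda>f. f p bs) fs)) \<longrightarrow>
          (\<forall>k\<in>set ks. k = \<zero>\<^bsub>Fp p\<^esub>)) \<longleftrightarrow>
        \<not> (length ks = ?n \<and> set ks \<subseteq> carrier (Fp p) \<and> Q p bs ks)" for ks
      by (cases "length ks = ?n \<and> set ks \<subseteq> carrier (Fp p)") (auto simp: Q_def lin)
    then show "((\<forall>f\<in>set fs. f p bs \<noteq> \<zero>\<^bsub>vectors (space p)\<^esub> \<and> val (space p) (f p bs) = val (space p) (hd fs p bs)) \<and>
        \<not> (\<exists>ks. length ks = ?n \<and> set ks \<subseteq> carrier (Fp p) \<and> Q p bs ks)) \<longleftrightarrow> W_holds (space p) (map (\<lambda>f. f p bs) fs)"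
      unfolding W_holds_def hd by (simp only: not_ex set_map ball_simps)
  qed
qed

lemma is_lam_iff:
  assumes "valued_vector_space V" "v \<in> carrier (vectors V)" "set vs \<subseteq> carrier (vectors V)"
  shows "is_lam V v vs ks \<longleftrightarrow> length ks = length vs \<and> set ks \<subseteq> carrier (scalars V) \<and>
    val V v \<sqsubset>\<^bsub>value_set V\<^esub> val V (lcomb V ks vs \<ominus>\<^bsub>vectors V\<^esub> v)"
  using valued_vector_space.lin_comb_eq_lcomb[OF assms(1) _ _ assms(3)] by (auto simp: is_lam_def)

text \<open>Existence and uniqueness of the tuple in the definition of \<lambda> are quantifiers
  over blocks of scalars, so the graph is a case distinction between definable conditions, the
  second one giving the default zero.\<close>

lemma rpred_lam_graph:
  assumes gs: "\<forall>g\<in>set gs. dvlu g" and fs: "\<forall>f\<in>set fs. rvec gs f" and f: "rvec gs f"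
    and k: "rfld gs k" and i: "1 \<le> i" "i \<le> length fs"
  shows "rpred gs (\<lambda>p bs. k p bs = lam (space p) i (f p bs) (map (\<lambda>f. f p bs) fs))"
proof -
  let ?n = "length fs"
  define L where "L p bs ks \<longleftrightarrow> val (space p) (f p bs) \<sqsubset>\<^bsub>Gp p\<^esub>
      val (space p) (lcomb (space p) ks (map (\<lambda>f. f p bs) fs) \<ominus>\<^bsub>vectors (space p)\<^esub> f p bs)" for p bs ks
  define T where "T p ks \<longleftrightarrow> length ks = ?n \<and> set ks \<subseteq> carrier (Fp p)" for p :: "('a, 'b, 'c) point" and ks
  \<comment> \<open>The renaming is arbitrary because \<open>L\<close> occurs below no quantifier
    block, below one and below two.\<close>
  have L: "rpred (shift_vlus \<rho> \<sigma> gs) (\<lambda>p bs. L (reindex \<rho> \<sigma> p) bs (map (\<lambda>k. k p bs) ks))"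
    if "\<forall>k\<in>set ks. rfld (shift_vlus \<rho> \<sigma> gs) k" for \<rho> \<sigma> ks
  proof -
    let ?fs = "map (\<lambda>f p bs. f (reindex \<rho> \<sigma> p) bs) fs"
    have "rpred (shift_vlus \<rho> \<sigma> gs) (\<lambda>p bs. val (space p) (f (reindex \<rho> \<sigma> p) bs) \<sqsubset>\<^bsub>Gp p\<^esub>
        val (space p) (lcomb (space p) (map (\<lambda>k. k p bs) ks) (map (\<lambda>f. f p bs) ?fs) \<ominus>\<^bsub>vectors (space p)\<^esub> f (reindex \<rho> \<sigma> p) bs))"
      by (intro rpred_less rvlu_val[OF dvlu_shift[OF gs]] rvec_diff rvec_lcomb rvec_reindex[OF f]
          rvec_reindex_list[OF fs] that)
    then show ?thesis by (simp add: L_def o_def)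
  qed
  have ex: "rpred gs (\<lambda>p bs. \<exists>ks. T p ks \<and> (L p bs ks \<and> k p bs = ks ! (i - 1)))"
  proof -
    let ?ks = "map (\<lambda>i p bs. fld p i) [0..<?n]"
    have "rpred (shift_vlus (\<lambda>j. j + ?n) id gs) (\<lambda>p bs. L (pop_flds ?n p) bs (map (\<lambda>k. k p bs) ?ks) \<and> k (pop_flds ?n p) bs = fld p (i - 1))"
      by (intro rpred_conj rpred_eq_fld L rfld_reindex[OF k] rfld_const dfld_fld) (auto intro: rfld_const dfld_fld)
    then have "rpred (shift_vlus (\<lambda>j. j + ?n) id gs) (\<lambda>p bs. L (pop_flds ?n p) bs (map (fld p) [0..<?n]) \<and>
        k (pop_flds ?n p) bs = map (fld p) [0..<?n] ! (i - 1))"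
      using i by (simp add: o_def)
    from rpred_ex_flds[where Q = "\<lambda>p bs ks. L p bs ks \<and> k p bs = ks ! (i - 1)", OF this]
    show ?thesis by (simp add: T_def conj_assoc)
  qed
  have ex1: "rpred gs (\<lambda>p bs. \<exists>ks. T p ks \<and> (L p bs ks \<and> \<not> (\<exists>ls. T p ls \<and> (L p bs ls \<and> \<not> (\<forall>i\<in>set [0..<?n]. ls ! i = ks ! i)))))"
  proof -
    let ?s = "\<lambda>j. j + ?n"
    let ?gs = "shift_vlus ?s id gs"
    let ?ks = "map (\<lambda>i p bs. fld p i) [0..<?n]"
    let ?ls = "map (\<lambda>i p bs. fld p (i + ?n)) [0..<?n]"
    have shift2: "shift_vlus ?s id ?gs = shift_vlus (?s \<circ> ?s) id gs"
      by (simp add: reindex_reindex)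
    \<comment> \<open>Below two blocks the competing tuple occupies the indices below the length of
      \<open>fs\<close>, and the outer tuple the block that follows. Equality of tuples becomes a
      finite conjunction of equalities of entries.\<close>
    have "rpred (shift_vlus (?s \<circ> ?s) id gs) (\<lambda>p bs. L (reindex (?s \<circ> ?s) id p) bs (map (\<lambda>k. k p bs) ?ks) \<and>
        \<not> (\<forall>i\<in>set [0..<?n]. fld p i = fld p (i + ?n)))"
      by (intro rpred_conj rpred_not rpred_Ball_set rpred_eq_fld L rfld_const dfld_fld) (auto intro: rfld_const dfld_fld)
    then have "rpred (shift_vlus ?s id ?gs) (\<lambda>p bs. L (pop_flds ?n (pop_flds ?n p)) bs (map (fld p) [0..<?n]) \<and>
        \<not> (\<forall>i\<in>set [0..<?n]. map (fld p) [0..<?n] ! i = fld (pop_flds ?n p) i))"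
      unfolding shift2
    proof (rule relative_cong)
      fix p :: "('a, 'b, 'c) point" and bs :: "'b list"
      have "pop_flds ?n (pop_flds ?n p) = reindex (?s \<circ> ?s) id p" by (simp add: reindex_reindex)
      moreover have "(\<lambda>k. k p bs) \<circ> (\<lambda>i p bs. fld p i) = fld p" by (simp add: o_def)
      ultimately show "(L (reindex (?s \<circ> ?s) id p) bs (map (\<lambda>k. k p bs) ?ks) \<and> \<not> (\<forall>i\<in>set [0..<?n]. fld p i = fld p (i + ?n))) \<longleftrightarrow>
          (L (pop_flds ?n (pop_flds ?n p)) bs (map (fld p) [0..<?n]) \<and>
            \<not> (\<forall>i\<in>set [0..<?n]. map (fld p) [0..<?n] ! i = fld (pop_flds ?n p) i))"
        by simp
    qed
    from rpred_ex_flds[where Q = "\<lambda>p bs ls. L (pop_flds ?n p) bs ls \<and> \<not> (\<forall>i\<in>set [0..<?n]. ls ! i = fld p i)", OF this]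
    have "rpred ?gs (\<lambda>p bs. \<exists>ls. T p ls \<and> (L (pop_flds ?n p) bs ls \<and> \<not> (\<forall>i\<in>set [0..<?n]. ls ! i = fld p i)))"
      by (simp add: T_def conj_assoc)
    then have "rpred ?gs (\<lambda>p bs. L (pop_flds ?n p) bs (map (\<lambda>k. k p bs) ?ks) \<and>
        \<not> (\<exists>ls. T p ls \<and> (L (pop_flds ?n p) bs ls \<and> \<not> (\<forall>i\<in>set [0..<?n]. ls ! i = fld p i))))"
      by (intro rpred_conj rpred_not L) (auto intro: rfld_const dfld_fld)
    then have "rpred ?gs (\<lambda>p bs. L (pop_flds ?n p) bs (map (fld p) [0..<?n]) \<and>
        \<not> (\<exists>ls. T (pop_flds ?n p) ls \<and> (L (pop_flds ?n p) bs ls \<and> \<not> (\<forall>i\<in>set [0..<?n]. ls ! i = map (fld p) [0..<?n] ! i))))"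
      by (simp add: o_def T_def)
    from rpred_ex_flds[where Q = "\<lambda>p bs ks. L p bs ks \<and>
        \<not> (\<exists>ls. T p ls \<and> (L p bs ls \<and> \<not> (\<forall>i\<in>set [0..<?n]. ls ! i = ks ! i)))", OF this]
    show ?thesis by (simp add: T_def conj_assoc)
  qed
  define C where "C p bs \<longleftrightarrow> W_holds (space p) (map (\<lambda>f. f p bs) fs) \<and> \<not> W_holds (space p) (f p bs # map (\<lambda>f. f p bs) fs) \<and>
      (\<exists>ks. T p ks \<and> (L p bs ks \<and> \<not> (\<exists>ls. T p ls \<and> (L p bs ls \<and> \<not> (\<forall>i\<in>set [0..<?n]. ls ! i = ks ! i)))))" for p bs
  have W2: "rpred gs (\<lambda>p bs. W_holds (space p) (f p bs # map (\<lambda>f. f p bs) fs))"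
    using rpred_W_holds[OF gs, of "f # fs"] f fs by simp
  have C: "rpred gs C"
    unfolding C_def using fs i by (intro rpred_conj rpred_not ex1 W2 rpred_W_holds[OF gs]) auto
  have "rpred gs (\<lambda>p bs. (C p bs \<and> (\<exists>ks. T p ks \<and> (L p bs ks \<and> k p bs = ks ! (i - 1)))) \<or>
      (\<not> C p bs \<and> k p bs = \<zero>\<^bsub>Fp p\<^esub>))"
    by (intro rpred_disj rpred_conj rpred_not C ex rpred_eq_fld k rfld_const dfld_zero)
  then show ?thesis
  proof (rule relative_cong)
    fix p bs assume m: "model gs p bs"
    have c: "set (map (\<lambda>f. f p bs) fs) \<subseteq> carrier (vectors (space p))"
      using fs(1) rvec_closed[OF _ m] by auto
    let ?v = "f p bs" and ?vs = "map (\<lambda>f. f p bs) fs"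
    have TL: "is_lam (space p) ?v ?vs ks \<longleftrightarrow> T p ks \<and> L p bs ks" for ks
      by (auto simp: is_lam_iff[OF modelD(2)[OF m] rvec_closed[OF f m] c] T_def L_def)
    have eq: "(\<forall>i\<in>set [0..<?n]. ls ! i = ks ! i) \<longleftrightarrow> ls = ks" if "T p ls" "T p ks" for ls ks
      using that by (auto simp: T_def intro: nth_equalityI)
    have "(\<exists>ks. T p ks \<and> (L p bs ks \<and> \<not> (\<exists>ls. T p ls \<and> (L p bs ls \<and> \<not> (\<forall>i\<in>set [0..<?n]. ls ! i = ks ! i))))) \<longleftrightarrow>
        (\<exists>!ks. is_lam (space p) ?v ?vs ks)"
      unfolding Ex1_def TL
    proof (rule iff_exI)
      fix ks
      show "(T p ks \<and> (L p bs ks \<and> \<not> (\<exists>ls. T p ls \<and> (L p bs ls \<and> \<not> (\<forall>i\<in>set [0..<?n]. ls ! i = ks ! i))))) \<longleftrightarrow>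
          (T p ks \<and> L p bs ks) \<and> (\<forall>ls. T p ls \<and> L p bs ls \<longrightarrow> ls = ks)"
      proof (cases "T p ks")
        case True
        have "\<not> (T p ls \<and> (L p bs ls \<and> \<not> (\<forall>i\<in>set [0..<?n]. ls ! i = ks ! i))) \<longleftrightarrow> (T p ls \<and> L p bs ls \<longrightarrow> ls = ks)" for ls
          using eq[OF _ True, of ls] by argo
        then show ?thesis using True by (simp only: not_ex conj_assoc)
      qed simp
    qed
    then have C_iff: "C p bs \<longleftrightarrow> W_holds (space p) ?vs \<and> \<not> W_holds (space p) (?v # ?vs) \<and> (\<exists>!ks. is_lam (space p) ?v ?vs ks)"
      by (simp add: C_def)
    show "(C p bs \<and> (\<exists>ks. T p ks \<and> (L p bs ks \<and> k p bs = ks ! (i - 1)))) \<or> (\<not> C p bs \<and> k p bs = \<zero>\<^bsub>Fp p\<^esub>) \<longleftrightarrow>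
        k p bs = lam (space p) i ?v ?vs"
    proof (cases "C p bs")
      case True
      then have ex1: "\<exists>!ks. is_lam (space p) ?v ?vs ks" using C_iff by simp
      have "lam (space p) i ?v ?vs = (THE ks. is_lam (space p) ?v ?vs ks) ! (i - 1)"
        using True C_iff by (simp add: lam_def)
      moreover have "(\<exists>ks. is_lam (space p) ?v ?vs ks \<and> k p bs = ks ! (i - 1)) \<longleftrightarrow>
          k p bs = (THE ks. is_lam (space p) ?v ?vs ks) ! (i - 1)"
      proof
        assume "\<exists>ks. is_lam (space p) ?v ?vs ks \<and> k p bs = ks ! (i - 1)"
        then obtain ks where "is_lam (space p) ?v ?vs ks" "k p bs = ks ! (i - 1)" by (elim exE conjE)
        then show "k p bs = (THE ks. is_lam (space p) ?v ?vs ks) ! (i - 1)"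
          by (simp only: the1_equality[OF ex1])
      next
        assume "k p bs = (THE ks. is_lam (space p) ?v ?vs ks) ! (i - 1)"
        then show "\<exists>ks. is_lam (space p) ?v ?vs ks \<and> k p bs = ks ! (i - 1)"
          by (intro exI[of _ "THE ks. is_lam (space p) ?v ?vs ks"] conjI theI'[OF ex1])
      qed
      ultimately show ?thesis using True by (simp add: TL conj_assoc)
    next
      case False
      then have "\<not> (W_holds (space p) ?vs \<and> \<not> W_holds (space p) (?v # ?vs) \<and> (\<exists>!ks. is_lam (space p) ?v ?vs ks))"
        by (simp only: C_iff not_False_eq_True)
      from if_not_P[OF this] have "lam (space p) i ?v ?vs = \<zero>\<^bsub>Fp p\<^esub>" unfolding lam_def .
      then show ?thesis using False by simp
    qed
  qed
qed

lemma lam_closed: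
  assumes "valued_vector_space V" "1 \<le> i" "i \<le> length vs"
  shows "lam V i v vs \<in> carrier (scalars V)"
proof (cases "W_holds V vs \<and> \<not> W_holds V (v # vs) \<and> (\<exists>!ks. is_lam V v vs ks)")
  case True
  define ls where "ls = (THE ks. is_lam V v vs ks)"
  have "is_lam V v vs ls" unfolding ls_def using True by (elim conjE) (rule theI')
  then have "length ls = length vs" "set ls \<subseteq> carrier (scalars V)" by (simp_all add: is_lam_def)
  then have "ls ! (i - 1) \<in> carrier (scalars V)" using assms nth_mem[of "i - 1" ls] by auto
  then show ?thesis unfolding lam_def if_P[OF True] by (simp only: ls_def)
next
  case False
  interpret valued_vector_space V by (rule assms)
  show ?thesis unfolding lam_def if_not_P[OF False] by simp
qed

text \<open>The definable graph with variable 0 in the place of the value determines the function,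
  as \<open>lam_closed\<close> keeps it inside the field also in the default case.\<close>

lemma rfld_lam:
  assumes gs: "\<forall>g\<in>set gs. dvlu g" and fs: "\<forall>f\<in>set fs. rvec gs f" and f: "rvec gs f"
    and i: "1 \<le> i" "i \<le> length fs"
  shows "rfld gs (\<lambda>p bs. lam (space p) i (f p bs) (map (\<lambda>f. f p bs) fs))"
proof (rule rfld_graph)
  show "lam (space p) i (f p bs) (map (\<lambda>f. f p bs) fs) \<in> carrier (Fp p)" if "model gs p bs" for p bs
    using i by (intro lam_closed modelD(2)[OF that]) auto
  have "rpred (shift_vlus Suc id gs) (\<lambda>p bs. fld p 0 = lam (space p) i (f (pop_fld p) bs)
      (map (\<lambda>f. f p bs) (map (\<lambda>f p bs. f (pop_fld p) bs) fs)))"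
    using i by (intro rpred_lam_graph dvlu_shift gs rvec_reindex_list fs rvec_reindex f rfld_const dfld_fld) auto
  then show "rpred (shift_vlus Suc id gs) (\<lambda>p bs. fld p 0 = lam (space (pop_fld p)) i (f (pop_fld p) bs)
      (map (\<lambda>f. f (pop_fld p) bs) fs))"
    by (simp add: o_def)
qed


section \<open>Elimination of vector quantifiers\<close>

text \<open>The notion of definability appropriate to each sort. It refers to the element under its
  constructor, as the definable functions take values in the bare carriers.\<close>

primrec relt :: "(('k, 'v, 'g) point \<Rightarrow> 'g) list \<Rightarrow> vsort \<Rightarrow>
    (('k, 'v, 'g) point \<Rightarrow> 'v list \<Rightarrow> ('k, 'v, 'g) elt) \<Rightarrow> bool" where
  "relt gs VecS = (\<lambda>F. \<exists>f. rvec gs f \<and> (\<forall>p bs. model gs p bs \<longrightarrow> F p bs = Vec (f p bs)))"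
| "relt gs FldS = (\<lambda>F. \<exists>f. rfld gs f \<and> (\<forall>p bs. model gs p bs \<longrightarrow> F p bs = Fld (f p bs)))"
| "relt gs ValS = (\<lambda>F. \<exists>f. rvlu gs f \<and> (\<forall>p bs. model gs p bs \<longrightarrow> F p bs = Vl (f p bs)))"

lemma relt_list:
  "list_all2 (\<lambda>t s. relt gs s (E t)) ts (replicate n VecS) \<Longrightarrow>
    \<exists>fs. length fs = n \<and> (\<forall>f\<in>set fs. rvec gs f) \<and>
      (\<forall>p bs. model gs p bs \<longrightarrow> map (\<lambda>t. E t p bs) ts = map (\<lambda>f. Vec (f p bs)) fs)"
proof (induction ts arbitrary: n)
  case (Cons t ts)
  then obtain m where m: "n = Suc m" "relt gs VecS (E t)" "list_all2 (\<lambda>t s. relt gs s (E t)) ts (replicate m VecS)"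
    by (cases n) auto
  obtain f where f: "rvec gs f" "\<forall>p bs. model gs p bs \<longrightarrow> E t p bs = Vec (f p bs)"
    using m(2) by auto
  obtain fs where fs: "length fs = m" "\<forall>f\<in>set fs. rvec gs f"
      "\<forall>p bs. model gs p bs \<longrightarrow> map (\<lambda>t. E t p bs) ts = map (\<lambda>f. Vec (f p bs)) fs"
    using Cons.IH[OF m(3)] by blast
  show ?case using f fs m(1) by (intro exI[of _ "f # fs"]) auto
qed auto

lemma list_all2_Cons2E:
  assumes "list_all2 P xs (y # ys)" obtains x xs' where "xs = x # xs'" "P x y" "list_all2 P xs' ys"
  using assms by (auto simp: list_all2_Cons2)

lemma relt_eval:
  assumes "has_sort L_W_lam t s" and gs: "\<forall>g\<in>set gs. dvlu g"
    and e: "\<And>s x. relt gs s (\<lambda>p bs. e p bs s x)"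
  shows "relt gs s (\<lambda>p bs. eval_trm (valued_struct (space p)) (e p bs) t)"
  using assms(1)
proof (induction rule: has_sort.induct)
  case (has_sort_Var s x)
  then show ?case using e by simp
next
  case (has_sort_Fn F ss s ts)
  let ?E = "\<lambda>t p bs. eval_trm (valued_struct (space p)) (e p bs) t"
  have ty: "vfun_type F = Some (ss, s)" using has_sort_Fn(1) by (simp add: L_W_lam_def)
  have args: "list_all2 (\<lambda>t s. relt gs s (?E t)) ts ss"
    using has_sort_Fn(2) by (rule list_all2_mono) auto
  have eval: "?E (Fn F ts) p bs = valued_fun (space p) F (map (\<lambda>t. ?E t p bs) ts)" for p bs
    by (simp add: valued_struct_def)
  show ?case
  proof (cases F)
    case VAdd
    then obtain t u where ts: "ts = [t, u]" "relt gs VecS (?E t)" "relt gs VecS (?E u)" and s: "s = VecS"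
      using ty args by (auto elim!: list_all2_Cons2E)
    then obtain f g where "rvec gs f" "\<forall>p bs. model gs p bs \<longrightarrow> ?E t p bs = Vec (f p bs)"
        "rvec gs g" "\<forall>p bs. model gs p bs \<longrightarrow> ?E u p bs = Vec (g p bs)" by auto
    then show ?thesis
      unfolding eval s relt.simps using VAdd ts(1)
      by (intro exI[of _ "\<lambda>p bs. f p bs \<oplus>\<^bsub>vectors (space p)\<^esub> g p bs"]) (auto intro: rvec_add)
  next
    case VZero
    then show ?thesis
      unfolding eval using ty
      by (auto intro!: exI[of _ "\<lambda>p bs. \<zero>\<^bsub>vectors (space p)\<^esub>"] rvec_zero)
  next
    case KAdd
    then obtain t u where ts: "ts = [t, u]" "relt gs FldS (?E t)" "relt gs FldS (?E u)" and s: "s = FldS"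
      using ty args by (auto elim!: list_all2_Cons2E)
    then obtain f g where "rfld gs f" "\<forall>p bs. model gs p bs \<longrightarrow> ?E t p bs = Fld (f p bs)"
        "rfld gs g" "\<forall>p bs. model gs p bs \<longrightarrow> ?E u p bs = Fld (g p bs)" by auto
    then show ?thesis
      unfolding eval s relt.simps using KAdd ts(1)
      by (intro exI[of _ "\<lambda>p bs. f p bs \<oplus>\<^bsub>Fp p\<^esub> g p bs"]) (auto intro: rfld_add)
  next
    case KMul
    then obtain t u where ts: "ts = [t, u]" "relt gs FldS (?E t)" "relt gs FldS (?E u)" and s: "s = FldS"
      using ty args by (auto elim!: list_all2_Cons2E)
    then obtain f g where "rfld gs f" "\<forall>p bs. model gs p bs \<longrightarrow> ?E t p bs = Fld (f p bs)"
        "rfld gs g" "\<forall>p bs. model gs p bs \<longrightarrow> ?E u p bs = Fld (g p bs)" by auto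
    then show ?thesis
      unfolding eval s relt.simps using KMul ts(1)
      by (intro exI[of _ "\<lambda>p bs. f p bs \<otimes>\<^bsub>Fp p\<^esub> g p bs"]) (auto intro: rfld_mult)
  next
    case KZero
    then show ?thesis
      unfolding eval using ty
      by (auto intro!: exI[of _ "\<lambda>p bs. \<zero>\<^bsub>Fp p\<^esub>"] rfld_const dfld_zero)
  next
    case KOne
    then show ?thesis
      unfolding eval using ty
      by (auto intro!: exI[of _ "\<lambda>p bs. \<one>\<^bsub>Fp p\<^esub>"] rfld_const dfld_one)
  next
    case Infty
    then show ?thesis
      unfolding eval using ty
      by (auto intro!: exI[of _ "\<lambda>p bs. infty (space p)"] rvlu_const dvlu_infty)
  next
    case Scal
    then obtain t u where ts: "ts = [t, u]" "relt gs FldS (?E t)" "relt gs VecS (?E u)" and s: "s = VecS"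
      using ty args by (auto elim!: list_all2_Cons2E)
    then obtain f g where "rfld gs f" "\<forall>p bs. model gs p bs \<longrightarrow> ?E t p bs = Fld (f p bs)"
        "rvec gs g" "\<forall>p bs. model gs p bs \<longrightarrow> ?E u p bs = Vec (g p bs)" by auto
    then show ?thesis
      unfolding eval s relt.simps using Scal ts(1)
      by (intro exI[of _ "\<lambda>p bs. f p bs \<odot>\<^bsub>vectors (space p)\<^esub> g p bs"]) (auto intro: rvec_smult)
  next
    case Val
    then obtain t where ts: "ts = [t]" "relt gs VecS (?E t)" and s: "s = ValS"
      using ty args by (auto elim!: list_all2_Cons2E)
    then obtain f where "rvec gs f" "\<forall>p bs. model gs p bs \<longrightarrow> ?E t p bs = Vec (f p bs)" by auto
    then show ?thesis
      unfolding eval s relt.simps using Val ts(1)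
      by (intro exI[of _ "\<lambda>p bs. val (space p) (f p bs)"]) (auto intro: rvlu_val[OF gs])
  next
    case (Lam n i)
    then have i: "1 \<le> i" "i \<le> n" and ss: "ss = replicate (Suc n) VecS" and s: "s = FldS"
      using ty by (auto split: if_splits)
    obtain fs where fs: "length fs = Suc n" "\<forall>f\<in>set fs. rvec gs f"
        "\<forall>p bs. model gs p bs \<longrightarrow> map (\<lambda>t. ?E t p bs) ts = map (\<lambda>f. Vec (f p bs)) fs"
      using relt_list[OF args[unfolded ss]] by blast
    obtain f hs where hs: "fs = f # hs" "length hs = n" using fs(1) by (auto simp: length_Suc_conv)
    show ?thesis
      unfolding eval s relt.simps using fs i hs Lam
      by (intro exI[of _ "\<lambda>p bs. lam (space p) i (f p bs) (map (\<lambda>f. f p bs) hs)"])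
        (auto intro!: rfld_lam[OF gs] simp: o_def)
  qed
qed

lemma relt_reindex:
  assumes "relt gs s F" shows "relt (shift_vlus \<rho> \<sigma> gs) s (\<lambda>p bs. F (reindex \<rho> \<sigma> p) bs)"
proof (cases s)
  case VecS
  then obtain f where "rvec gs f" "\<forall>p bs. model gs p bs \<longrightarrow> F p bs = Vec (f p bs)" using assms by auto
  then show ?thesis unfolding VecS relt.simps
    by (intro exI[of _ "\<lambda>p bs. f (reindex \<rho> \<sigma> p) bs"]) (auto intro: rvec_reindex dest: model_reindex)
next
  case FldS
  then obtain f where "rfld gs f" "\<forall>p bs. model gs p bs \<longrightarrow> F p bs = Fld (f p bs)" using assms by auto
  then show ?thesis unfolding FldS relt.simps
    by (intro exI[of _ "\<lambda>p bs. f (reindex \<rho> \<sigma> p) bs"]) (auto intro: rfld_reindex dest: model_reindex)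
next
  case ValS
  then obtain f where "rvlu gs f" "\<forall>p bs. model gs p bs \<longrightarrow> F p bs = Vl (f p bs)" using assms by auto
  then show ?thesis unfolding ValS relt.simps
    by (intro exI[of _ "\<lambda>p bs. f (reindex \<rho> \<sigma> p) bs"]) (auto intro: rvlu_reindex dest: model_reindex)
qed

lemma model_Cons:
  assumes "model (g # gs) p bs"
  obtains w cs where "bs = w # cs" "model gs p cs" "w \<in> carrier (vectors (space p))"
proof -
  obtain w cs where bs: "bs = w # cs" using assms by (cases bs) (auto simp: model_def)
  interpret valued_vector_space "space p" by (rule modelD(2)[OF assms])
  have "model gs p cs" using assms bs by (auto simp: model_def intro: vindep_tl)
  moreover have "w \<in> carrier (vectors (space p))" using modelD(5)[OF assms] bs by simp
  ultimately show ?thesis using bs that by blast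
qed

lemma relative_tl:
  assumes "relative gs A f" shows "relative (g # gs) A (\<lambda>p bs. f p (tl bs))"
proof -
  obtain d where d: "A d" "\<And>p bs. model gs p bs \<Longrightarrow> f p bs = d p" using assms unfolding relative_def by blast
  have "f p (tl bs) = d p" if "model (g # gs) p bs" for p bs
    using that by (rule model_Cons) (simp add: d(2))
  then show ?thesis unfolding relative_def using d(1) by blast
qed

text \<open>Adding a member to the family leaves the old assignment definable: scalars and values do
  not change, and an old vector gets coefficient zero at the new member.\<close>

lemma relt_tl:
  assumes "relt gs s F" shows "relt (g # gs) s (\<lambda>p bs. F p (tl bs))"
proof (cases s)
  case VecS
  then obtain f where f: "rvec gs f" "\<And>p bs. model gs p bs \<Longrightarrow> F p bs = Vec (f p bs)" using assms by auto
  then obtain cs where cs: "length cs = length gs" "\<forall>c\<in>set cs. dfld c"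
      "\<And>p bs. model gs p bs \<Longrightarrow> f p bs = lcomb (space p) (map (\<lambda>c. c p) cs) bs"
    unfolding rvec_def by blast
  have eq: "f p (tl bs) = lcomb (space p) (map (\<lambda>c. c p) ((\<lambda>p. \<zero>\<^bsub>Fp p\<^esub>) # cs)) bs" if m: "model (g # gs) p bs" for p bs
  proof -
    interpret valued_vector_space "space p" by (rule modelD(2)[OF m])
    from m obtain w ds where w: "bs = w # ds" "model gs p ds" "w \<in> carrier (vectors (space p))" by (rule model_Cons)
    then show ?thesis
      using coeffs_closed[OF cs(2) modelD(1)[OF m]] modelD(5)[OF w(2)] by (simp add: cs(3))
  qed
  have "F p (tl bs) = Vec (f p (tl bs))" if "model (g # gs) p bs" for p bs
    using that by (rule model_Cons) (simp add: f(2))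
  moreover have "rvec (g # gs) (\<lambda>p bs. f p (tl bs))"
    unfolding rvec_def using cs eq by (intro exI[of _ "(\<lambda>p. \<zero>\<^bsub>Fp p\<^esub>) # cs"]) (auto intro: dfld_zero)
  ultimately show ?thesis unfolding VecS relt.simps by blast
next
  case FldS
  then obtain f where f: "rfld gs f" "\<And>p bs. model gs p bs \<Longrightarrow> F p bs = Fld (f p bs)" using assms by auto
  have "F p (tl bs) = Fld (f p (tl bs))" if "model (g # gs) p bs" for p bs
    using that by (rule model_Cons) (simp add: f(2))
  then show ?thesis unfolding FldS relt.simps using relative_tl[OF f(1)] by blast
next
  case ValS
  then obtain f where f: "rvlu gs f" "\<And>p bs. model gs p bs \<Longrightarrow> F p bs = Vl (f p bs)" using assms by auto
  have "F p (tl bs) = Vl (f p (tl bs))" if "model (g # gs) p bs" for p bs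
    using that by (rule model_Cons) (simp add: f(2))
  then show ?thesis unfolding ValS relt.simps using relative_tl[OF f(1)] by blast
qed

lemma relt_lcomb:
  assumes "length cs = length gs" "\<forall>c\<in>set cs. dfld c"
  shows "relt gs VecS (\<lambda>p bs. Vec (lcomb (space p) (map (\<lambda>c. c p) cs) bs))"
proof -
  have "rvec gs (\<lambda>p bs. lcomb (space p) (map (\<lambda>c. c p) cs) bs)"
    unfolding rvec_def using assms by blast
  then show ?thesis unfolding relt.simps by blast
qed

abbreviation upd :: "('s \<Rightarrow> nat \<Rightarrow> 'u) \<Rightarrow> 's \<Rightarrow> nat \<Rightarrow> 'u \<Rightarrow> 's \<Rightarrow> nat \<Rightarrow> 'u" where
  "upd e s x a \<equiv> e(s := (e s)(x := a))"

lemma relt_upd: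
  "(\<And>t y. relt gs t (\<lambda>p bs. e p bs t y)) \<Longrightarrow> relt gs s F \<Longrightarrow> relt gs t (\<lambda>p bs. upd (e p bs) s x (F p bs) t y)"
  by (cases "t = s"; cases "y = x") auto

lemma reindex_push: "length ks = n \<Longrightarrow> reindex (\<lambda>i. i + n) Suc (push_flds ks (push_vlu g p)) = p"
  by (cases p) (auto simp: reindex_def push_flds_def push_vlu_def fun_eq_iff)

text \<open>Both \<open>gs\<close> and \<open>e\<close> vary in the induction, since a vector
  quantifier may enlarge the family and every quantifier shifts variables. In the vector case the
  witness is either a combination of the family or such a combination plus a new member.\<close>

lemma rpred_sat:
  assumes "wf_fm L_W_lam \<phi>" "\<forall>g\<in>set gs. dvlu g" "\<And>s x. relt gs s (\<lambda>p bs. e p bs s x)"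
  shows "rpred gs (\<lambda>p bs. sat (valued_struct (space p)) (e p bs) \<phi>)"
  using assms
proof (induction \<phi> arbitrary: gs e)
  case (Eq t u)
  then obtain s where s: "has_sort L_W_lam t s" "has_sort L_W_lam u s" by auto
  have rt: "relt gs s (\<lambda>p bs. eval_trm (valued_struct (space p)) (e p bs) t)"
    by (rule relt_eval[OF s(1) Eq.prems(2,3)])
  have ru: "relt gs s (\<lambda>p bs. eval_trm (valued_struct (space p)) (e p bs) u)"
    by (rule relt_eval[OF s(2) Eq.prems(2,3)])
  show ?case
  proof (cases s)
    case VecS
    obtain f g where f: "rvec gs f" "\<And>p bs. model gs p bs \<Longrightarrow> eval_trm (valued_struct (space p)) (e p bs) t = Vec (f p bs)"
      and g: "rvec gs g" "\<And>p bs. model gs p bs \<Longrightarrow> eval_trm (valued_struct (space p)) (e p bs) u = Vec (g p bs)"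
      using rt ru unfolding VecS relt.simps by blast
    then show ?thesis by (intro relative_cong[OF rpred_eq_vec[OF Eq.prems(2) f(1) g(1)]]) auto
  next
    case FldS
    obtain f g where f: "rfld gs f" "\<And>p bs. model gs p bs \<Longrightarrow> eval_trm (valued_struct (space p)) (e p bs) t = Fld (f p bs)"
      and g: "rfld gs g" "\<And>p bs. model gs p bs \<Longrightarrow> eval_trm (valued_struct (space p)) (e p bs) u = Fld (g p bs)"
      using rt ru unfolding FldS relt.simps by blast
    then show ?thesis by (intro relative_cong[OF rpred_eq_fld[OF f(1) g(1)]]) auto
  next
    case ValS
    obtain f g where f: "rvlu gs f" "\<And>p bs. model gs p bs \<Longrightarrow> eval_trm (valued_struct (space p)) (e p bs) t = Vl (f p bs)"
      and g: "rvlu gs g" "\<And>p bs. model gs p bs \<Longrightarrow> eval_trm (valued_struct (space p)) (e p bs) u = Vl (g p bs)"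
      using rt ru unfolding ValS relt.simps by blast
    then show ?thesis by (intro relative_cong[OF rpred_eq_vlu[OF f(1) g(1)]]) auto
  qed
next
  case (Rel r ts)
  let ?E = "\<lambda>t p bs. eval_trm (valued_struct (space p)) (e p bs) t"
  obtain ss where ty: "vrel_type r = Some ss" and hs: "list_all2 (has_sort L_W_lam) ts ss"
    using Rel.prems(1) by (auto simp: L_W_lam_def)
  have args: "list_all2 (\<lambda>t s. relt gs s (?E t)) ts ss"
    using hs by (rule list_all2_mono) (rule relt_eval[OF _ Rel.prems(2,3)])
  have eval: "sat (valued_struct (space p)) (e p bs) (Rel r ts) \<longleftrightarrow> valued_rel (space p) r (map (\<lambda>t. ?E t p bs) ts)" for p bs
    by (simp add: valued_struct_def)
  show ?case
  proof (cases r)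
    case Less
    then obtain t u where ts: "ts = [t, u]" "relt gs ValS (?E t)" "relt gs ValS (?E u)"
      using ty args by (auto elim!: list_all2_Cons2E)
    then obtain f g where "rvlu gs f" "\<forall>p bs. model gs p bs \<longrightarrow> ?E t p bs = Vl (f p bs)"
        "rvlu gs g" "\<forall>p bs. model gs p bs \<longrightarrow> ?E u p bs = Vl (g p bs)" by auto
    then show ?thesis
      unfolding eval using Less ts(1) by (intro relative_cong[OF rpred_less[of gs f g]]) auto
  next
    case (WRel n)
    then have n: "1 \<le> n" "ss = replicate n VecS" using ty by (auto split: if_splits)
    obtain fs where fs: "length fs = n" "\<forall>f\<in>set fs. rvec gs f"
        "\<forall>p bs. model gs p bs \<longrightarrow> map (\<lambda>t. ?E t p bs) ts = map (\<lambda>f. Vec (f p bs)) fs"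
      using relt_list[OF args[unfolded n(2)]] by blast
    have "fs \<noteq> []" using fs n by auto
    from rpred_W_holds[OF Rel.prems(2) fs(2) this] show ?thesis
      unfolding eval by (rule relative_cong) (use fs WRel in \<open>simp add: o_def\<close>)
  qed
next
  case (Neg \<phi>)
  then have "rpred gs (\<lambda>p bs. sat (valued_struct (space p)) (e p bs) \<phi>)" by (intro Neg.IH) auto
  then show ?case by (simp add: rpred_not)
next
  case (Conj \<phi> \<psi>)
  then have "rpred gs (\<lambda>p bs. sat (valued_struct (space p)) (e p bs) \<phi>)"
      "rpred gs (\<lambda>p bs. sat (valued_struct (space p)) (e p bs) \<psi>)"
    by (auto intro!: Conj.IH)
  then show ?case by (simp add: rpred_conj)
next
  case (Exists s x \<phi>)
  have wf: "wf_fm L_W_lam \<phi>" using Exists.prems by simp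
  note gs = Exists.prems(2)
  define S where "S p bs a \<longleftrightarrow> sat (valued_struct (space p)) (upd (e p bs) s x a) \<phi>" for p bs a
  have sat: "sat (valued_struct (space p)) (e p bs) (Exists s x \<phi>) \<longleftrightarrow> (\<exists>a\<in>valued_univ (space p) s. S p bs a)" for p bs
    by (simp add: S_def valued_struct_def)
  show ?case
  proof (cases s)
    case FldS
    have "rpred (shift_vlus Suc id gs) (\<lambda>p bs. sat (valued_struct (space p)) (upd (e (pop_fld p) bs) s x (Fld (fld p 0))) \<phi>)"
    proof (rule Exists.IH[OF wf dvlu_shift[OF gs] relt_upd[OF relt_reindex[OF Exists.prems(3)]]])
      show "relt (shift_vlus Suc id gs) s (\<lambda>p bs. Fld (fld p 0))"
        unfolding FldS relt.simps by (intro exI[of _ "\<lambda>p bs. fld p 0"]) (auto intro: rfld_const dfld_fld)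
    qed
    then have "rpred (shift_vlus Suc id gs) (\<lambda>p bs. S (pop_fld p) bs (Fld (fld p 0)))" by (simp add: S_def)
    from rpred_ex_fld[where Q = "\<lambda>p bs k. S p bs (Fld k)", OF this] show ?thesis
      unfolding sat by (rule relative_cong) (auto simp: FldS)
  next
    case ValS
    have "rpred (shift_vlus id Suc gs) (\<lambda>p bs. sat (valued_struct (space p)) (upd (e (pop_vlu p) bs) s x (Vl (vlu p 0))) \<phi>)"
    proof (rule Exists.IH[OF wf dvlu_shift[OF gs] relt_upd[OF relt_reindex[OF Exists.prems(3)]]])
      show "relt (shift_vlus id Suc gs) s (\<lambda>p bs. Vl (vlu p 0))"
        unfolding ValS relt.simps by (intro exI[of _ "\<lambda>p bs. vlu p 0"]) (auto intro: rvlu_const dvlu_vlu)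
    qed
    then have "rpred (shift_vlus id Suc gs) (\<lambda>p bs. S (pop_vlu p) bs (Vl (vlu p 0)))" by (simp add: S_def)
    from rpred_ex_vlu[where Q = "\<lambda>p bs k. S p bs (Vl k)", OF this] show ?thesis
      unfolding sat by (rule relative_cong) (auto simp: ValS)
  next
    case VecS
    let ?m = "length gs"
    let ?\<rho> = "\<lambda>i. i + ?m"
    let ?cs = "map (\<lambda>i p. fld p i) [0..<?m]"
    have cs: "map (\<lambda>c. c p) ?cs = map (fld p) [0..<?m]" for p :: "('a, 'b, 'c) point" by (simp add: o_def)
    let ?gs1 = "shift_vlus ?\<rho> id gs"
    have "rpred ?gs1 (\<lambda>p bs. sat (valued_struct (space p)) (upd (e (reindex ?\<rho> id p) bs) s x
        (Vec (lcomb (space p) (map (\<lambda>c. c p) ?cs) bs))) \<phi>)"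
    proof (rule Exists.IH[OF wf dvlu_shift[OF gs] relt_upd[OF relt_reindex[OF Exists.prems(3)]]])
      show "relt ?gs1 s (\<lambda>p bs. Vec (lcomb (space p) (map (\<lambda>c. c p) ?cs) bs))"
        unfolding VecS by (rule relt_lcomb) (auto intro: dfld_fld)
    qed
    then have "rpred ?gs1 (\<lambda>p bs. S (pop_flds ?m p) bs (Vec (lcomb (space (pop_flds ?m p)) (map (fld p) [0..<?m]) bs)))"
      unfolding S_def cs by simp
    from rpred_ex_flds[where Q = "\<lambda>p bs ks. S p bs (Vec (lcomb (space p) ks bs))", OF this]
    have inside: "rpred gs (\<lambda>p bs. \<exists>ks. length ks = ?m \<and> set ks \<subseteq> carrier (Fp p) \<and> S p bs (Vec (lcomb (space p) ks bs)))" .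
    \<comment> \<open>Outside the span the witness is \<open>w\<close> plus a combination of the old
      family. The value of \<open>w\<close> is the new value variable 0, the coefficients of the
      combination are the first field variables, and \<open>w\<close> itself has coefficient
      one.\<close>
    let ?gs2 = "(\<lambda>p. vlu p 0) # shift_vlus ?\<rho> Suc gs"
    let ?cs2 = "(\<lambda>p. \<one>\<^bsub>Fp p\<^esub>) # ?cs"
    have gs2: "\<forall>g\<in>set ?gs2. dvlu g" using dvlu_shift[OF gs] dvlu_vlu by auto
    have "rpred ?gs2 (\<lambda>p bs. sat (valued_struct (space p)) (upd (e (reindex ?\<rho> Suc p) (tl bs)) s x
        (Vec (lcomb (space p) (map (\<lambda>c. c p) ?cs2) bs))) \<phi>)"
    proof (rule Exists.IH[OF wf gs2 relt_upd[OF relt_tl[OF relt_reindex[OF Exists.prems(3)]]]])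
      show "relt ?gs2 s (\<lambda>p bs. Vec (lcomb (space p) (map (\<lambda>c. c p) ?cs2) bs))"
        unfolding VecS by (rule relt_lcomb) (auto intro: dfld_fld dfld_one)
    qed
    then obtain D where D: "dpred D" "\<And>p bs. model ?gs2 p bs \<Longrightarrow>
        S (reindex ?\<rho> Suc p) (tl bs) (Vec (lcomb (space p) (\<one>\<^bsub>Fp p\<^esub> # map (fld p) [0..<?m]) bs)) \<longleftrightarrow> D p"
      unfolding relative_def S_def list.map cs by auto
    \<comment> \<open>The first conjunct says that some \<open>w\<close> of the pushed value extends
      the family, the second that some combination completes such a \<open>w\<close> to a witness.
      Nothing ties the two to the same \<open>w\<close>, and nothing has to: \<open>D\<close> is
      correct for every \<open>w\<close> of this value.\<close>
    define R where "R q \<longleftrightarrow> vlu q 0 \<notin> dim_colour (space q) (length (filter (\<lambda>g. g q = vlu q 0) (shift_vlus id Suc gs))) \<and>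
        (\<exists>ks. length ks = ?m \<and> set ks \<subseteq> carrier (Fp q) \<and> D (push_flds ks q))" for q
    have "dpred R"
      unfolding R_def by (intro dpred_conj dpred_not_saturated dvlu_vlu dvlu_shift gs dpred_ex_flds D(1))
    then have "dpred (\<lambda>p. \<exists>g\<in>carrier (Gp p). R (push_vlu g p))" by (rule dpred_ex_vlu)
    then have outside: "rpred gs (\<lambda>p bs. \<exists>g\<in>carrier (Gp p). R (push_vlu g p))" unfolding relative_def by blast
    show ?thesis
      unfolding sat
    proof (rule relative_cong[OF rpred_disj[OF inside outside]])
      fix p bs assume m: "model gs p bs"
      interpret valued_vector_space "space p" by (rule modelD(2)[OF m])
      note bs = modelD(3)[OF m] and len = modelD(4)[OF m] and bsc = modelD(5)[OF m]
      have vals: "map (val (space p)) bs = map (\<lambda>g. g p) gs" using m by (simp add: model_def)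
      have count: "length (filter (\<lambda>h. h (push_vlu g p) = vlu (push_vlu g p) 0) (shift_vlus id Suc gs)) =
          length (filter (\<lambda>b. val (space p) b = g) bs)" for g
      proof -
        have "length (filter (\<lambda>b. val (space p) b = g) bs) = length (filter (\<lambda>h. h = g) (map (val (space p)) bs))"
          by (simp add: filter_map o_def)
        then show ?thesis unfolding vals by (simp add: filter_map o_def)
      qed
      have D_iff: "D (push_flds ks (push_vlu g p)) \<longleftrightarrow> S p bs (Vec (w \<oplus>\<^bsub>vectors (space p)\<^esub> lcomb (space p) ks bs))"
        if w: "w \<in> carrier (vectors (space p))" "val (space p) w = g" "vindep (space p) (w # bs)"
          and ks: "length ks = ?m" "set ks \<subseteq> carrier (Fp p)" for ks g w
      proof -
        let ?q = "push_flds ks (push_vlu g p)"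
        have "g \<in> carrier (Gp p)" using w by auto
        then have "model ?gs2 ?q (w # bs)"
          using w ks vals modelD(1)[OF m] by (simp add: model_def reindex_push o_def)
        from D(2)[OF this] show ?thesis
          using w ks by (simp add: reindex_push)
      qed
      show "((\<exists>ks. length ks = ?m \<and> set ks \<subseteq> carrier (Fp p) \<and> S p bs (Vec (lcomb (space p) ks bs))) \<or>
          (\<exists>g\<in>carrier (Gp p). R (push_vlu g p))) \<longleftrightarrow> (\<exists>a\<in>valued_univ (space p) s. S p bs a)" (is "?in \<or> ?out \<longleftrightarrow> ?ex")
      proof
        assume "?in \<or> ?out"
        then show ?ex
        proof
          assume ?in
          then obtain ks where "length ks = ?m" "set ks \<subseteq> carrier (Fp p)" "S p bs (Vec (lcomb (space p) ks bs))" by blast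
          then show ?ex using bsc VecS by (intro bexI[of _ "Vec (lcomb (space p) ks bs)"]) auto
        next
          assume ?out
          then obtain g ks where g: "g \<in> carrier (Gp p)" "g \<notin> dim_colour (space p) (length (filter (\<lambda>b. val (space p) b = g) bs))"
            and ks: "length ks = ?m" "set ks \<subseteq> carrier (Fp p)" and Dp: "D (push_flds ks (push_vlu g p))"
            unfolding R_def count by auto
          obtain w where w: "w \<in> carrier (vectors (space p))" "val (space p) w = g" "vindep (space p) (w # bs)"
            using vindep_extensible_iff[OF bs g(1)] g(2) by blast
          have "w \<oplus>\<^bsub>vectors (space p)\<^esub> lcomb (space p) ks bs \<in> carrier (vectors (space p))" using w ks bsc by simp
          then show ?ex using Dp D_iff[OF w ks] VecS by auto
        qed
      next
        assume ?ex
        then obtain v where v: "v \<in> carrier (vectors (space p))" "S p bs (Vec v)" using VecS by auto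
        obtain ks where ks: "length ks = ?m" "set ks \<subseteq> carrier (Fp p)"
          and c: "v = lcomb (space p) ks bs \<or> vindep (space p) ((v \<ominus>\<^bsub>vectors (space p)\<^esub> lcomb (space p) ks bs) # bs)"
          using vindep_approx[OF bs v(1)] len by auto
        show "?in \<or> ?out"
        proof (cases "v = lcomb (space p) ks bs")
          case True
          then have "S p bs (Vec (lcomb (space p) ks bs))" using v by simp
          then have ?in using ks by blast
          then show ?thesis ..
        next
          case False
          \<comment> \<open>The best approximation error serves as the new member; adding the
            approximation back recovers \<open>v\<close>.\<close>
          let ?w = "v \<ominus>\<^bsub>vectors (space p)\<^esub> lcomb (space p) ks bs"
          have lc: "lcomb (space p) ks bs \<in> carrier (vectors (space p))" using ks bsc by simp
          have w: "?w \<in> carrier (vectors (space p))" "vindep (space p) (?w # bs)" using v lc c False by auto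
          let ?g = "val (space p) ?w"
          have g: "?g \<in> carrier (Gp p)" using w by simp
          have "?g \<notin> dim_colour (space p) (length (filter (\<lambda>b. val (space p) b = ?g) bs))"
            using vindep_extensible_iff[OF bs g] w by blast
          moreover have "D (push_flds ks (push_vlu ?g p))"
            using D_iff[OF w(1) refl w(2) ks] v lc by (simp add: diff_add_cancel)
          ultimately have "R (push_vlu ?g p)" unfolding R_def count using ks by auto
          then show ?thesis using g by blast
        qed
      qed
    qed
  qed
qed


section \<open>Interpreting the field and the coloured order\<close>

lemma lang_sel [simp]:
  "fun_type L_W_lam = vfun_type" "rel_type L_W_lam = vrel_type" "rel_type L_field = (\<lambda>_. None)"
  "fun_type L_coloured_order = (\<lambda>_. None)" "rel_type L_coloured_order = crel_type"
  by (simp_all add: L_W_lam_def L_field_def L_coloured_order_def)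

lemma struct_sel [simp]:
  "univ (valued_struct V) = valued_univ V" "fun_int (valued_struct V) = valued_fun V"
  "rel_int (valued_struct V) = valued_rel V"
  "univ (field_struct K) = (\<lambda>_. carrier K)" "fun_int (field_struct K) = field_fun K"
  "univ (coloured_struct G D) = (\<lambda>_. carrier G)" "rel_int (coloured_struct G D) = coloured_rel G D"
  by (simp_all add: valued_struct_def field_struct_def coloured_struct_def)

primrec fld_sym :: "ffun \<Rightarrow> vfun" where
  "fld_sym FAdd = KAdd" | "fld_sym FMul = KMul" | "fld_sym FZero = KZero" | "fld_sym FOne = KOne"

primrec fld_trm :: "(unit, ffun) trm \<Rightarrow> (vsort, vfun) trm" where
  "fld_trm (Var _ x) = Var FldS x"
| "fld_trm (Fn f ts) = Fn (fld_sym f) (map fld_trm ts)"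

text \<open>The language of fields has no relation symbols, so the image of \<open>Rel\<close> is a
  dummy that no well-formed formula reaches.\<close>

primrec fld_fm :: "(unit, ffun, unit) fm \<Rightarrow> (vsort, vfun, vrel) fm" where
  "fld_fm (Eq t u) = Eq (fld_trm t) (fld_trm u)"
| "fld_fm (Rel _ ts) = Rel Less []"
| "fld_fm (Neg \<phi>) = Neg (fld_fm \<phi>)"
| "fld_fm (Conj \<phi> \<psi>) = Conj (fld_fm \<phi>) (fld_fm \<psi>)"
| "fld_fm (Exists _ x \<phi>) = Exists FldS x (fld_fm \<phi>)"

lemma has_sort_fld_trm: "has_sort L_field t s \<Longrightarrow> has_sort L_W_lam (fld_trm t) FldS"
proof (induction rule: has_sort.induct)
  case (has_sort_Fn f ss s ts)
  have "vfun_type (fld_sym f) = Some (map (\<lambda>_. FldS) ss, FldS)"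
    using has_sort_Fn(1) by (cases f) auto
  moreover have "list_all2 (has_sort L_W_lam) (map fld_trm ts) (map (\<lambda>_. FldS) ss)"
    using has_sort_Fn(2) by (auto simp: list.rel_map elim: list_all2_mono)
  ultimately show ?case by (auto intro!: has_sort.has_sort_Fn)
qed (auto intro: has_sort.intros)

lemma eval_fld_trm:
  "has_sort L_field t s \<Longrightarrow> (\<And>x. e FldS x = Fld (a () x)) \<Longrightarrow>
    eval_trm (valued_struct V) e (fld_trm t) = Fld (eval_trm (field_struct (scalars V)) a t)"
proof (induction rule: has_sort.induct)
  case (has_sort_Fn f ss s ts)
  have len: "length ts = length ss" using has_sort_Fn(2) by (rule list_all2_lengthD)
  have "map (eval_trm (valued_struct V) e) (map fld_trm ts) = map Fld (map (eval_trm (field_struct (scalars V)) a) ts)"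
    using has_sort_Fn(2,3) by (induction ts ss rule: list_all2_induct) auto
  then have "eval_trm (valued_struct V) e (fld_trm (Fn f ts)) =
      valued_fun V (fld_sym f) (map Fld (map (eval_trm (field_struct (scalars V)) a) ts))"
    by (simp only: fld_trm.simps eval_trm.simps struct_sel)
  then show ?case
    using has_sort_Fn(1) len by (cases f) (auto simp: nth_map)
qed auto

lemma wf_fld_fm: "wf_fm L_field \<phi> \<Longrightarrow> wf_fm L_W_lam (fld_fm \<phi>)"
  by (induction \<phi>) (auto intro: has_sort_fld_trm)

lemma sat_fld_fm:
  "wf_fm L_field \<phi> \<Longrightarrow> (\<And>x. e FldS x = Fld (a () x)) \<Longrightarrow>
    sat (valued_struct V) e (fld_fm \<phi>) \<longleftrightarrow> sat (field_struct (scalars V)) a \<phi>"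
proof (induction \<phi> arbitrary: e a)
  case (Eq t u)
  then obtain s where "has_sort L_field t s" "has_sort L_field u s" by auto
  then show ?case using eval_fld_trm[where e = e and a = a, OF _ Eq.prems(2)] by simp
next
  case (Neg \<phi>)
  then show ?case using Neg.IH[of e a] by simp
next
  case (Conj \<phi> \<psi>)
  then show ?case using Conj.IH[of e a] by simp
next
  case (Exists s x \<phi>)
  have "sat (valued_struct V) (upd e FldS x (Fld k)) (fld_fm \<phi>) \<longleftrightarrow> sat (field_struct (scalars V)) (upd a s x k) \<phi>" for k
    using Exists.prems by (intro Exists.IH) auto
  then show ?case by auto
qed simp

section \<open>Formulas for the colours\<close>

primrec exists_vecs :: "nat \<Rightarrow> (vsort, vfun, vrel) fm \<Rightarrow> (vsort, vfun, vrel) fm" where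
  "exists_vecs 0 \<phi> = \<phi>"
| "exists_vecs (Suc n) \<phi> = Exists VecS n (exists_vecs n \<phi>)"

lemma sat_exists_vecs:
  "sat M e (exists_vecs n \<phi>) \<longleftrightarrow>
    (\<exists>ws. length ws = n \<and> set ws \<subseteq> univ M VecS \<and> sat M (e(VecS := \<lambda>x. if x < n then ws ! x else e VecS x)) \<phi>)"
proof (induction n arbitrary: e)
  case (Suc n)
  \<comment> \<open>The outermost quantifier binds the largest index, so its witness is appended at
    the end of the list.\<close>
  have *: "(upd e VecS n a)(VecS := \<lambda>x. if x < n then ws ! x else upd e VecS n a VecS x) =
      e(VecS := \<lambda>x. if x < Suc n then (ws @ [a]) ! x else e VecS x)" if "length ws = n" for ws a
    using that by (auto simp: fun_eq_iff nth_append)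
  have "sat M e (exists_vecs (Suc n) \<phi>) \<longleftrightarrow>
      (\<exists>a\<in>univ M VecS. \<exists>ws. length ws = n \<and> set ws \<subseteq> univ M VecS \<and>
        sat M (e(VecS := \<lambda>x. if x < Suc n then (ws @ [a]) ! x else e VecS x)) \<phi>)"
    by (simp only: exists_vecs.simps sat.simps Suc.IH * cong: conj_cong)
  also have "\<dots> \<longleftrightarrow> (\<exists>ws. length ws = Suc n \<and> set ws \<subseteq> univ M VecS \<and>
      sat M (e(VecS := \<lambda>x. if x < Suc n then ws ! x else e VecS x)) \<phi>)"
    unfolding length_Suc_conv_rev by force
  finally show ?case .
qed (simp add: fun_upd_def)

text \<open>For positive \<open>n\<close>, says that the quotient at the value variable
  \<open>x\<close> contains \<open>n\<close> independent residues. Fixing the value of one vector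
  suffices because \<open>W_n\<close> makes all values equal.\<close>

definition indep_fm :: "nat \<Rightarrow> nat \<Rightarrow> (vsort, vfun, vrel) fm" where
  "indep_fm n x = exists_vecs n (Conj (Eq (Fn Val [Var VecS 0]) (Var ValS x)) (Rel (WRel n) (map (Var VecS) [0..<n])))"

text \<open>Dimension \<open>n\<close> means that \<open>n\<close> independent residues exist but
  not \<open>n + 1\<close>. Zero is a separate case, as the relations \<open>W_n\<close> start at
  \<open>n = 1\<close>.\<close>

primrec colour_fm :: "nat \<Rightarrow> nat \<Rightarrow> (vsort, vfun, vrel) fm" where
  "colour_fm 0 x = Neg (indep_fm 1 x)"
| "colour_fm (Suc n) x = Conj (indep_fm (Suc n) x) (Neg (indep_fm (Suc (Suc n)) x))"

lemma wf_exists_vecs: "wf_fm S (exists_vecs n \<phi>) \<longleftrightarrow> wf_fm S \<phi>"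
  by (induction n) auto

lemma wf_indep_fm: "1 \<le> n \<Longrightarrow> wf_fm L_W_lam (indep_fm n x)"
proof -
  assume n: "1 \<le> n"
  have "has_sort L_W_lam (Fn Val [Var VecS 0]) ValS"
    by (rule has_sort_Fn[of _ _ "[VecS]"]) (auto intro: has_sort_Var)
  moreover have "list_all2 (has_sort L_W_lam) (map (Var VecS) [0..<n]) (replicate n VecS)"
    by (auto simp: list_all2_conv_all_nth intro: has_sort_Var)
  ultimately show ?thesis
    using n unfolding indep_fm_def wf_exists_vecs by (auto intro: has_sort_Var)
qed

lemma wf_colour_fm: "wf_fm L_W_lam (colour_fm n x)"
  by (cases n) (auto intro: wf_indep_fm)

context valued_vector_space
begin

lemma sat_indep_fm:
  assumes n: "1 \<le> n" and e: "e ValS x = Vl \<gamma>" and \<gamma>: "\<gamma> \<in> carrier G"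
  shows "sat (valued_struct V) e (indep_fm n x) \<longleftrightarrow> (\<exists>vs. length vs = n \<and> rindep V \<gamma> vs)"
proof -
  define P where "P vs \<longleftrightarrow> val V (hd vs) = \<gamma> \<and> W_holds V vs" for vs
  have body: "sat (valued_struct V) (e(VecS := \<lambda>x. if x < n then ws ! x else e VecS x))
      (Conj (Eq (Fn Val [Var VecS 0]) (Var ValS x)) (Rel (WRel n) (map (Var VecS) [0..<n]))) \<longleftrightarrow> P (map the_vec ws)"
    if ws: "length ws = n" for ws
  proof -
    have "ws \<noteq> []" using ws n by auto
    then have hd: "hd (map the_vec ws) = the_vec (ws ! 0)" by (simp add: hd_map hd_conv_nth)
    have "map (\<lambda>x. the_vec (if x < n then ws ! x else e VecS x)) [0..<n] = map the_vec ws"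
      using ws by (auto intro: nth_equalityI)
    then show ?thesis
      using n e unfolding P_def hd by (simp add: o_def)
  qed
  have "sat (valued_struct V) e (indep_fm n x) \<longleftrightarrow>
      (\<exists>ws :: ('k, 'v, 'g) elt list. length ws = n \<and> set ws \<subseteq> Vec ` carrier M \<and> P (map the_vec ws))"
    unfolding indep_fm_def sat_exists_vecs by (simp only: struct_sel valued_univ.simps body cong: conj_cong)
  also have "\<dots> \<longleftrightarrow> (\<exists>vs. length vs = n \<and> set vs \<subseteq> carrier M \<and> P vs)"
  proof
    assume "\<exists>ws :: ('k, 'v, 'g) elt list. length ws = n \<and> set ws \<subseteq> Vec ` carrier M \<and> P (map the_vec ws)"
    then obtain ws :: "('k, 'v, 'g) elt list" where "length ws = n" "set ws \<subseteq> Vec ` carrier M" "P (map the_vec ws)" by blast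
    then show "\<exists>vs. length vs = n \<and> set vs \<subseteq> carrier M \<and> P vs"
      by (intro exI[of _ "map the_vec ws"]) auto
  next
    assume "\<exists>vs. length vs = n \<and> set vs \<subseteq> carrier M \<and> P vs"
    then obtain vs where "length vs = n" "set vs \<subseteq> carrier M" "P vs" by blast
    then show "\<exists>ws :: ('k, 'v, 'g) elt list. length ws = n \<and> set ws \<subseteq> Vec ` carrier M \<and> P (map the_vec ws)"
      by (intro exI[of _ "map Vec vs"]) (auto simp: o_def)
  qed
  also have "\<dots> \<longleftrightarrow> (\<exists>vs. length vs = n \<and> rindep V \<gamma> vs)"
  proof -
    have "set vs \<subseteq> carrier M \<and> P vs \<longleftrightarrow> rindep V \<gamma> vs" if "length vs = n" for vs
    proof -
      have "vs \<noteq> []" using that n by auto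
      moreover have "set vs \<subseteq> carrier M" if "rindep V \<gamma> vs" using rindep_closed[OF that] closed_ballD(1) by blast
      ultimately show ?thesis using rindep_iff_W_holds[OF \<gamma>, of vs] by (auto simp: P_def)
    qed
    then show ?thesis by (auto cong: conj_cong)
  qed
  finally show ?thesis .
qed

lemma sat_colour_fm:
  assumes e: "e ValS x = Vl \<gamma>" and \<gamma>: "\<gamma> \<in> carrier G"
  shows "sat (valued_struct V) e (colour_fm n x) \<longleftrightarrow> \<gamma> \<in> dim_colour V n"
proof -
  have "sat (valued_struct V) e (indep_fm m x) \<longleftrightarrow> (\<exists>vs. length vs = m \<and> rindep V \<gamma> vs)" if "1 \<le> m" for m
    using that e \<gamma> by (rule sat_indep_fm)
  then show ?thesis
    unfolding dim_colour_iff_rindep[OF \<gamma>] by (cases n) simp_all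
qed

end

text \<open>The language of coloured orders has no function symbols, so its terms are variables.\<close>

primrec trm_var :: "('s, 'f) trm \<Rightarrow> nat" where
  "trm_var (Var _ x) = x"
| "trm_var (Fn _ _) = 0"

primrec vlu_rel :: "crel \<Rightarrow> (unit, unit) trm list \<Rightarrow> (vsort, vfun, vrel) fm" where
  "vlu_rel CLess = (\<lambda>ts. Rel Less (map (\<lambda>t. Var ValS (trm_var t)) ts))"
| "vlu_rel (Colour n) = (\<lambda>ts. colour_fm n (trm_var (hd ts)))"

primrec vlu_fm :: "(unit, unit, crel) fm \<Rightarrow> (vsort, vfun, vrel) fm" where
  "vlu_fm (Eq t u) = Eq (Var ValS (trm_var t)) (Var ValS (trm_var u))"
| "vlu_fm (Rel p ts) = vlu_rel p ts"
| "vlu_fm (Neg \<phi>) = Neg (vlu_fm \<phi>)"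
| "vlu_fm (Conj \<phi> \<psi>) = Conj (vlu_fm \<phi>) (vlu_fm \<psi>)"
| "vlu_fm (Exists _ x \<phi>) = Exists ValS x (vlu_fm \<phi>)"

lemma has_sort_coloured_cases:
  assumes "has_sort L_coloured_order t s" obtains x where "t = Var () x" "trm_var t = x"
  using assms by cases auto

lemma coloured_rel_cases:
  assumes "wf_fm L_coloured_order (Rel p ts)"
  obtains x y where "p = CLess" "ts = [Var () x, Var () y]" | n x where "p = Colour n" "ts = [Var () x]"
proof (cases p)
  case CLess
  then obtain t u where "ts = [t, u]" "has_sort L_coloured_order t ()" "has_sort L_coloured_order u ()"
    using assms by (auto elim!: list_all2_Cons2E)
  then show ?thesis using CLess that(1) by (metis has_sort_coloured_cases)
next
  case (Colour n)
  then obtain t where "ts = [t]" "has_sort L_coloured_order t ()"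
    using assms by (auto elim!: list_all2_Cons2E)
  then show ?thesis using Colour that(2) by (metis has_sort_coloured_cases)
qed

lemma wf_vlu_fm: "wf_fm L_coloured_order \<phi> \<Longrightarrow> wf_fm L_W_lam (vlu_fm \<phi>)"
proof (induction \<phi>)
  case (Rel p ts)
  then show ?case
    by (rule coloured_rel_cases) (auto simp: wf_colour_fm intro: has_sort_Var)
qed (auto intro: has_sort_Var)

lemma sat_vlu_fm:
  assumes "valued_vector_space V"
  shows "wf_fm L_coloured_order \<phi> \<Longrightarrow> (\<And>x. e ValS x = Vl (a () x)) \<Longrightarrow> (\<And>x. a () x \<in> carrier (value_set V)) \<Longrightarrow>
    sat (valued_struct V) e (vlu_fm \<phi>) \<longleftrightarrow> sat (coloured_struct (value_set V) (dim_colour V)) a \<phi>"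
proof (induction \<phi> arbitrary: e a)
  case (Eq t u)
  then obtain s where "has_sort L_coloured_order t s" "has_sort L_coloured_order u s" by auto
  then show ?case using Eq.prems by (auto elim!: has_sort_coloured_cases)
next
  case (Rel p ts)
  from Rel.prems(1) show ?case
  proof (cases rule: coloured_rel_cases)
    case (1 x y)
    then show ?thesis using Rel.prems by simp
  next
    case (2 n x)
    then show ?thesis
      using valued_vector_space.sat_colour_fm[where e = e and x = x and \<gamma> = "a () x" and n = n, OF assms]
        Rel.prems by simp
  qed
next
  case (Exists s x \<phi>)
  have "sat (valued_struct V) (upd e ValS x (Vl g)) (vlu_fm \<phi>) \<longleftrightarrow>
      sat (coloured_struct (value_set V) (dim_colour V)) (upd a s x g) \<phi>" if "g \<in> carrier (value_set V)" for g
    using Exists.prems that by (intro Exists.IH) auto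
  then show ?case by auto
qed auto

section \<open>Extensions\<close>

locale vvs_extension =
  fixes V W :: "('k, 'v, 'g) valued_space"
  assumes V: "valued_vector_space V" and W: "valued_vector_space W"
    and sub: "substructure L_W_lam (valued_struct V) (valued_struct W)"
begin

sublocale V: valued_vector_space V by (rule V)
sublocale W: valued_vector_space W by (rule W)

lemma carrier_sub:
  "carrier (vectors V) \<subseteq> carrier (vectors W)" "carrier (scalars V) \<subseteq> carrier (scalars W)"
  "carrier (value_set V) \<subseteq> carrier (value_set W)"
proof -
  have "univ (valued_struct V) s \<subseteq> univ (valued_struct W) s" for s
    using sub by (simp add: substructure_def)
  from this[of VecS] this[of FldS] this[of ValS]
  show "carrier (vectors V) \<subseteq> carrier (vectors W)" "carrier (scalars V) \<subseteq> carrier (scalars W)"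
    "carrier (value_set V) \<subseteq> carrier (value_set W)"
    by auto
qed

lemma fun_eq:
  "vfun_type f = Some (ss, s) \<Longrightarrow> list_all2 (\<lambda>x s. x \<in> valued_univ V s) xs ss \<Longrightarrow> valued_fun V f xs = valued_fun W f xs"
  using sub by (simp add: substructure_def)

lemma rel_eq:
  "vrel_type r = Some ss \<Longrightarrow> list_all2 (\<lambda>x s. x \<in> valued_univ V s) xs ss \<Longrightarrow> valued_rel V r xs \<longleftrightarrow> valued_rel W r xs"
  using sub by (simp add: substructure_def)

lemma ops_eq:
  "x \<in> carrier (vectors V) \<Longrightarrow> y \<in> carrier (vectors V) \<Longrightarrow> x \<oplus>\<^bsub>vectors W\<^esub> y = x \<oplus>\<^bsub>vectors V\<^esub> y"
  "\<zero>\<^bsub>vectors W\<^esub> = \<zero>\<^bsub>vectors V\<^esub>"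
  "k \<in> carrier (scalars V) \<Longrightarrow> l \<in> carrier (scalars V) \<Longrightarrow> k \<oplus>\<^bsub>scalars W\<^esub> l = k \<oplus>\<^bsub>scalars V\<^esub> l"
  "k \<in> carrier (scalars V) \<Longrightarrow> l \<in> carrier (scalars V) \<Longrightarrow> k \<otimes>\<^bsub>scalars W\<^esub> l = k \<otimes>\<^bsub>scalars V\<^esub> l"
  "\<zero>\<^bsub>scalars W\<^esub> = \<zero>\<^bsub>scalars V\<^esub>" "\<one>\<^bsub>scalars W\<^esub> = \<one>\<^bsub>scalars V\<^esub>"
  "k \<in> carrier (scalars V) \<Longrightarrow> x \<in> carrier (vectors V) \<Longrightarrow> k \<odot>\<^bsub>vectors W\<^esub> x = k \<odot>\<^bsub>vectors V\<^esub> x"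
  "x \<in> carrier (vectors V) \<Longrightarrow> val W x = val V x"
  using fun_eq[of VAdd _ _ "[Vec x, Vec y]"] fun_eq[of VZero _ _ "[]"] fun_eq[of KAdd _ _ "[Fld k, Fld l]"]
    fun_eq[of KMul _ _ "[Fld k, Fld l]"] fun_eq[of KZero _ _ "[]"] fun_eq[of KOne _ _ "[]"]
    fun_eq[of Scal _ _ "[Fld k, Vec x]"] fun_eq[of Val _ _ "[Vec x]"]
  by auto

lemma less_eq: "g \<in> carrier (value_set V) \<Longrightarrow> h \<in> carrier (value_set V) \<Longrightarrow>
    g \<sqsubset>\<^bsub>value_set W\<^esub> h \<longleftrightarrow> g \<sqsubset>\<^bsub>value_set V\<^esub> h"
  using rel_eq[of Less _ "[Vl g, Vl h]"] by auto

lemma W_holds_eq: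
  assumes "vs \<noteq> []" "set vs \<subseteq> carrier (vectors V)"
  shows "W_holds W vs \<longleftrightarrow> W_holds V vs"
proof -
  have "list_all2 (\<lambda>x s. x \<in> valued_univ V s) (map Vec vs) (replicate (length vs) VecS)"
    using assms(2) by (auto simp: list_all2_conv_all_nth intro!: imageI subsetD[OF assms(2)])
  then show ?thesis
    using rel_eq[of "WRel (length vs)" _ "map Vec vs"] assms(1) by (cases vs) (auto simp: o_def)
qed

lemma lcomb_eq:
  "set ks \<subseteq> carrier (scalars V) \<Longrightarrow> set vs \<subseteq> carrier (vectors V) \<Longrightarrow> lcomb W ks vs = lcomb V ks vs"
  by (induction ks vs rule: list_induct2') (auto simp: ops_eq)

text \<open>The combinations to be controlled in the extension have new scalars, so the inequalities
  cannot be copied. Instead the family is rebuilt member by member: at each step only the later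
  members of the same value matter, their residual independence together with the head is an
  instance of \<open>W_n\<close>, and \<open>vindep_Cons\<close> concludes in the extension.\<close>

lemma vindep_ext: "vindep V bs \<Longrightarrow> vindep W bs"
proof (induction bs)
  case (Cons w bs)
  have bs: "vindep V bs" by (rule V.vindep_tl[OF Cons.prems])
  have c: "set (w # bs) \<subseteq> carrier (vectors V)" by (rule V.vindep_closed[OF Cons.prems])
  have w: "w \<in> carrier (vectors V)" "w \<noteq> \<zero>\<^bsub>vectors V\<^esub>" using Cons.prems by (auto simp: vindep_def)
  have f: "filter (\<lambda>b. val W b = val V w) bs = filter (\<lambda>b. val V b = val V w) bs"
    using c by (intro filter_cong) (auto simp: ops_eq)
  let ?fs = "w # filter (\<lambda>b. val V b = val V w) bs"
  have fc: "set ?fs \<subseteq> carrier (vectors V)" using c by auto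
  have "rindep V (val V w) ?fs" using V.rindep_filter[OF Cons.prems, of "val V w"] w by simp
  then have "W_holds W ?fs"
    using V.rindep_iff_W_holds[of "val V w" ?fs] w fc W_holds_eq[of ?fs] by simp
  then have "rindep W (val W w) ?fs"
    using W.rindep_iff_W_holds[of "val W w" ?fs] w fc carrier_sub by auto
  then show ?case
    using w carrier_sub by (intro W.vindep_Cons Cons.IH bs) (auto simp: ops_eq f)
qed simp

section \<open>From the space to its field and its coloured order\<close>

lemma elementary_imp_field:
  assumes "elementary_substructure L_W_lam (valued_struct V) (valued_struct W)"
  shows "elementary_substructure L_field (field_struct (scalars V)) (field_struct (scalars W))"
  unfolding elementary_substructure_def
proof (intro conjI allI impI)
  have "field_fun (scalars V) f xs = field_fun (scalars W) f xs"
    if "ffun_type f = Some (ss, s)" "list_all2 (\<lambda>x s. x \<in> carrier (scalars V)) xs ss" for f ss s xs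
    using that by (cases f) (auto elim!: list_all2_Cons2E simp: ops_eq)
  then show "substructure L_field (field_struct (scalars V)) (field_struct (scalars W))"
    using carrier_sub by (auto simp: substructure_def)
  fix \<phi> :: "(unit, ffun, unit) fm" and a :: "unit \<Rightarrow> nat \<Rightarrow> 'k"
  assume a: "wf_fm L_field \<phi> \<and> (\<forall>s x. a s x \<in> univ (field_struct (scalars V)) s)"
  \<comment> \<open>The translated formula mentions scalars only; zero and \<infinity> are arbitrary
    elements of the other two sorts that complete the assignment.\<close>
  define e where "e s x = (case s of VecS \<Rightarrow> Vec \<zero>\<^bsub>vectors V\<^esub> | FldS \<Rightarrow> Fld (a () x) | ValS \<Rightarrow> Vl (infty V))"
    for s and x :: nat
  have e: "e s x \<in> univ (valued_struct V) s" for s x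
    using a V.infty_closed by (cases s) (auto simp: e_def)
  have eF: "e FldS x = Fld (a () x)" for x by (simp add: e_def)
  have "sat (valued_struct V) e (fld_fm \<phi>) \<longleftrightarrow> sat (valued_struct W) e (fld_fm \<phi>)"
    using assms a e wf_fld_fm[of \<phi>] by (simp add: elementary_substructure_def)
  then show "sat (field_struct (scalars V)) a \<phi> \<longleftrightarrow> sat (field_struct (scalars W)) a \<phi>"
    using a eF by (simp add: sat_fld_fm)
qed

lemma elementary_imp_coloured:
  assumes "elementary_substructure L_W_lam (valued_struct V) (valued_struct W)"
  shows "elementary_substructure L_coloured_order (coloured_struct (value_set V) (dim_colour V))
    (coloured_struct (value_set W) (dim_colour W))"
proof -
  let ?V = "coloured_struct (value_set V) (dim_colour V)" and ?W = "coloured_struct (value_set W) (dim_colour W)"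
  have sat: "sat ?V a \<phi> \<longleftrightarrow> sat ?W a \<phi>"
    if \<phi>: "wf_fm L_coloured_order \<phi>" and a: "\<And>x. a () x \<in> carrier (value_set V)" for \<phi> a
  proof -
    define e where "e s x = (case s of VecS \<Rightarrow> Vec \<zero>\<^bsub>vectors V\<^esub> | FldS \<Rightarrow> Fld \<zero>\<^bsub>scalars V\<^esub> | ValS \<Rightarrow> Vl (a () x))"
      for s and x :: nat
    have e: "e s x \<in> univ (valued_struct V) s" for s x
      using a by (cases s) (auto simp: e_def)
    have eV: "e ValS x = Vl (a () x)" for x by (simp add: e_def)
    have "sat (valued_struct V) e (vlu_fm \<phi>) \<longleftrightarrow> sat (valued_struct W) e (vlu_fm \<phi>)"
      using assms \<phi> e wf_vlu_fm[of \<phi>] by (simp add: elementary_substructure_def)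
    moreover have "a () x \<in> carrier (value_set W)" for x using a carrier_sub by blast
    ultimately show ?thesis
      using sat_vlu_fm[where e = e and a = a, OF V \<phi> eV a] sat_vlu_fm[where e = e and a = a, OF W \<phi> eV] by simp
  qed
  \<comment> \<open>That the colours agree on the smaller order belongs to the substructure relation
    but does not follow from \<open>sub\<close>. It is the transfer of an atomic formula.\<close>
  have colour: "g \<in> dim_colour V n \<longleftrightarrow> g \<in> dim_colour W n" if "g \<in> carrier (value_set V)" for g n
    using sat[of "Rel (Colour n) [Var () 0]" "\<lambda>_ _. g"] that
    by (simp add: has_sort_Var)
  have "coloured_rel (value_set V) (dim_colour V) p xs \<longleftrightarrow> coloured_rel (value_set W) (dim_colour W) p xs"
    if "crel_type p = Some ss" "list_all2 (\<lambda>x s. x \<in> carrier (value_set V)) xs ss" for p ss xs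
    using that by (cases p) (auto elim!: list_all2_Cons2E simp: less_eq colour)
  then have "substructure L_coloured_order ?V ?W"
    using carrier_sub by (auto simp: substructure_def)
  then show ?thesis
    using sat by (simp add: elementary_substructure_def)
qed

text \<open>The list of formulas is the same over both spaces, and each of its components transfers
  by the elementarity of the field or of the order separately.\<close>

lemma dpred_elementary:
  assumes fld: "elementary_substructure L_field (field_struct (scalars V)) (field_struct (scalars W))"
    and vlu: "elementary_substructure L_coloured_order (coloured_struct (value_set V) (dim_colour V))
      (coloured_struct (value_set W) (dim_colour W))"
    and D: "dpred D" and a: "\<And>n. a n \<in> carrier (scalars V)" and g: "\<And>n. g n \<in> carrier (value_set V)"
  shows "D (Point V a g) \<longleftrightarrow> D (Point W a g)"
proof -
  obtain cs where cs: "wf_dnf cs" "\<And>p. valid p \<Longrightarrow> D p \<longleftrightarrow> sat_dnf p cs"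
    using D unfolding dpred_def by blast
  have "valid (Point V a g)" "valid (Point W a g)"
    using V W a g carrier_sub by (auto simp: valid_def)
  moreover have "sat_fld (Point V a g) \<phi> \<longleftrightarrow> sat_fld (Point W a g) \<phi>" if "wf_fm L_field \<phi>" for \<phi>
    using fld that a by (simp add: elementary_substructure_def sat_fld_def)
  moreover have "sat_vlu (Point V a g) \<psi> \<longleftrightarrow> sat_vlu (Point W a g) \<psi>" if "wf_fm L_coloured_order \<psi>" for \<psi>
    using vlu that g by (simp add: elementary_substructure_def sat_vlu_def)
  ultimately show ?thesis
    using cs(1) by (auto simp: cs(2) sat_dnf_def wf_dnf_def)
qed

lemma elementaryI:
  assumes fld: "elementary_substructure L_field (field_struct (scalars V)) (field_struct (scalars W))"
    and vlu: "elementary_substructure L_coloured_order (coloured_struct (value_set V) (dim_colour V))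
      (coloured_struct (value_set W) (dim_colour W))"
  shows "elementary_substructure L_W_lam (valued_struct V) (valued_struct W)"
  unfolding elementary_substructure_def
proof (intro conjI sub allI impI, elim conjE)
  fix \<phi> :: "(vsort, vfun, vrel) fm" and e :: "vsort \<Rightarrow> nat \<Rightarrow> ('k, 'v, 'g) elt"
  assume \<phi>: "wf_fm L_W_lam \<phi>" and e: "\<forall>s x. e s x \<in> univ (valued_struct V) s"
  let ?N = "fm_bound \<phi>"
  have eV: "e VecS x \<in> Vec ` carrier (vectors V)" and eF: "e FldS x \<in> Fld ` carrier (scalars V)"
    and eG: "e ValS x \<in> Vl ` carrier (value_set V)" for x
    using e[rule_format, of VecS] e[rule_format, of FldS] e[rule_format, of ValS] by auto
  have "(\<lambda>x. the_vec (e VecS x)) ` {..<?N} \<subseteq> carrier (vectors V)"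
  proof clarify
    fix x show "the_vec (e VecS x) \<in> carrier (vectors V)" using eV[of x] by auto
  qed
  then obtain bs where bs: "vindep V bs"
    and span: "\<forall>v\<in>(\<lambda>x. the_vec (e VecS x)) ` {..<?N}. \<exists>ks. length ks = length bs \<and> set ks \<subseteq> carrier (scalars V) \<and> v = lcomb V ks bs"
    using V.vindep_cover[of "(\<lambda>x. the_vec (e VecS x)) ` {..<?N}"] by auto
  let ?m = "length bs"
  note bsc = V.vindep_closed[OF bs]
  have "\<exists>ks. length ks = ?m \<and> set ks \<subseteq> carrier (scalars V) \<and> (x < ?N \<longrightarrow> e VecS x = Vec (lcomb V ks bs))" for x
  proof (cases "x < ?N")
    case True
    then have "the_vec (e VecS x) \<in> (\<lambda>x. the_vec (e VecS x)) ` {..<?N}" by (intro imageI) simp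
    from bspec[OF span this]
    obtain ks where "length ks = ?m" "set ks \<subseteq> carrier (scalars V)" "the_vec (e VecS x) = lcomb V ks bs"
      by (elim exE conjE)
    then show ?thesis using eV[of x] by (intro exI[of _ ks]) auto
  next
    case False
    then show ?thesis by (intro exI[of _ "replicate ?m \<zero>\<^bsub>scalars V\<^esub>"]) auto
  qed
  then obtain c where c: "\<And>x. length (c x) = ?m" "\<And>x. set (c x) \<subseteq> carrier (scalars V)"
      "\<And>x. x < ?N \<Longrightarrow> e VecS x = Vec (lcomb V (c x) bs)"
    by metis
  \<comment> \<open>A pairing function packs all parameters into one sequence per sort: pairs
    \<open>(0, x)\<close> hold the scalar and value variables of the formula, and
    \<open>(i + 1, x)\<close> the coefficient of the vector variable \<open>x\<close> at member
    \<open>i\<close>. In \<open>g\<close> the pairs \<open>(i + 1, 0)\<close> hold the values of the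
    members. The remaining entries are defaults that keep the sequences inside the carriers.\<close>
  define a where "a n = (case prod_decode n of (i, x) \<Rightarrow>
    if i = 0 then the_fld (e FldS x) else if i \<le> ?m then c x ! (i - 1) else \<zero>\<^bsub>scalars V\<^esub>)" for n
  define g where "g n = (case prod_decode n of (i, x) \<Rightarrow>
    if i = 0 then the_vl (e ValS x) else if i \<le> ?m then val V (bs ! (i - 1)) else infty V)" for n
  have a: "a n \<in> carrier (scalars V)" for n
  proof -
    have "the_fld (e FldS x) \<in> carrier (scalars V)" for x using eF[of x] by auto
    moreover have "c x ! (i - 1) \<in> carrier (scalars V)" if "i \<noteq> 0" "i \<le> ?m" for x i
      using that c(1)[of x] c(2)[of x] nth_mem[of "i - 1" "c x"] by fastforce
    ultimately show ?thesis by (auto simp: a_def split: prod.split)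
  qed
  have g: "g n \<in> carrier (value_set V)" for n
  proof -
    have "the_vl (e ValS x) \<in> carrier (value_set V)" for x using eG[of x] by auto
    moreover have "val V (bs ! (i - 1)) \<in> carrier (value_set V)" if "i \<noteq> 0" "i \<le> ?m" for i
      using that bsc nth_mem[of "i - 1" bs] by fastforce
    ultimately show ?thesis using V.infty_closed by (auto simp: g_def split: prod.split)
  qed
  let ?cs = "\<lambda>x. map (\<lambda>i p. fld p (prod_encode (Suc i, x))) [0..<?m]"
  define E where "E p ds s x = (case s of VecS \<Rightarrow> Vec (lcomb (space p) (map (\<lambda>f. f p) (?cs x)) ds) |
    FldS \<Rightarrow> Fld (fld p (prod_encode (0, x))) | ValS \<Rightarrow> Vl (vlu p (prod_encode (0, x))))"
    for p :: "('k, 'v, 'g) point" and ds s x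
  let ?gs = "map (\<lambda>i p. vlu p (prod_encode (Suc i, 0))) [0..<?m]"
  have gs: "\<forall>h\<in>set ?gs. dvlu h" by (auto intro: dvlu_vlu)
  have "relt ?gs s (\<lambda>p ds. E p ds s x)" for s x
  proof (cases s)
    case VecS
    have "relt ?gs VecS (\<lambda>p ds. Vec (lcomb (space p) (map (\<lambda>f. f p) (?cs x)) ds))"
      by (rule relt_lcomb) (auto intro: dfld_fld)
    then show ?thesis by (simp add: E_def VecS del: relt.simps)
  next
    case FldS
    then show ?thesis
      by (auto simp: E_def intro!: exI[of _ "\<lambda>p ds. fld p (prod_encode (0, x))"] rfld_const dfld_fld)
  next
    case ValS
    then show ?thesis
      by (auto simp: E_def intro!: exI[of _ "\<lambda>p ds. vlu p (prod_encode (0, x))"] rvlu_const dvlu_vlu)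
  qed
  then have "rpred ?gs (\<lambda>p ds. sat (valued_struct (space p)) (E p ds) \<phi>)"
    by (rule rpred_sat[OF \<phi> gs])
  then obtain D where D: "dpred D"
      "\<forall>p ds. model ?gs p ds \<longrightarrow> (sat (valued_struct (space p)) (E p ds) \<phi> \<longleftrightarrow> D p)"
    unfolding relative_def by (elim exE conjE)
  have coeffs: "map (\<lambda>i. a (prod_encode (Suc i, x))) [0..<?m] = c x" for x
    using c(1)[of x] by (auto simp: a_def intro: nth_equalityI)
  have vals: "map (\<lambda>i. g (prod_encode (Suc i, 0))) [0..<?m] = map (val V) bs"
    by (auto simp: g_def intro: nth_equalityI)
  have "valid (Point V a g)" "valid (Point W a g)"
    using V W a g carrier_sub by (auto simp: valid_def)
  moreover have "map (val W) bs = map (val V) bs" using bsc by (auto simp: ops_eq)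
  \<comment> \<open>The same family with the same values is a model over both spaces, so the single
    predicate \<open>D\<close> decides the formula in both.\<close>
  ultimately have models: "model ?gs (Point V a g) bs" "model ?gs (Point W a g) bs"
    using bs vindep_ext[OF bs] vals by (auto simp: model_def o_def)
  have assign: "E (Point U a g) bs s x = e s x" if "U = V \<or> U = W" "x < ?N" for U s x
  proof (cases s)
    case VecS
    have "lcomb U (c x) bs = lcomb V (c x) bs" using that(1) lcomb_eq[OF c(2) bsc] by auto
    then show ?thesis using c(3)[OF that(2)] coeffs[of x] by (simp add: E_def VecS o_def)
  next
    case FldS
    then show ?thesis using eF[of x] by (auto simp: E_def a_def)
  next
    case ValS
    then show ?thesis using eG[of x] by (auto simp: E_def g_def)
  qed
  have "sat (valued_struct V) e \<phi> \<longleftrightarrow> sat (valued_struct V) (E (Point V a g) bs) \<phi>"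
    by (rule sat_cong) (simp add: assign)
  also have "\<dots> \<longleftrightarrow> D (Point V a g)" using D(2)[rule_format, OF models(1)] by simp
  also have "\<dots> \<longleftrightarrow> D (Point W a g)" by (rule dpred_elementary[OF fld vlu D(1) a g])
  also have "\<dots> \<longleftrightarrow> sat (valued_struct W) (E (Point W a g) bs) \<phi>" using D(2)[rule_format, OF models(2)] by simp
  also have "\<dots> \<longleftrightarrow> sat (valued_struct W) e \<phi>"
    by (rule sat_cong) (simp add: assign)
  finally show "sat (valued_struct V) e \<phi> \<longleftrightarrow> sat (valued_struct W) e \<phi>" .
qed

end

theorem proposition3p14:
  fixes V W :: "('k, 'v, 'g) valued_space"
  assumes "valued_vector_space V"
    and "valued_vector_space W"
    and "substructure L_W_lam (valued_struct V) (valued_struct W)"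
  shows "elementary_substructure L_W_lam (valued_struct V) (valued_struct W) \<longleftrightarrow>
    elementary_substructure L_field (field_struct (scalars V)) (field_struct (scalars W)) \<and>
    elementary_substructure L_coloured_order
      (coloured_struct (value_set V) (dim_colour V))
      (coloured_struct (value_set W) (dim_colour W))"
proof -
  interpret vvs_extension V W using assms by (rule vvs_extension.intro)
  show ?thesis using elementary_imp_field elementary_imp_coloured elementaryI by blast
qed

end
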